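(* For every integer $d \ge 2$ and every positive integer $n$, there exists a wavelet $\psi$ for dilation $d$ having the translation invariance property of order $n$; that is, the collection $\mathcal{M}_n$ (for dilation factor $d$) is non-empty.
   Context: Fix an integer dilation factor $d \ge 2$. A wavelet for dilation $d$ is a function $\psi \in L^2(\mathbb{R})$ such that $\{ d^{n/2}\psi(d^n x - l) : n, l \in \mathbb{Z}\}$ is an orthonormal basis of $L^2(\mathbb{R})$. Define unitary operators on $L^2(\mathbb{R})$ by $Tf(x) = f(x-1)$ and $Df(x) = \sqrt{d}\, f(dx)$. For a wavelet $\psi$ and $j \in \mathbb{Z}$, let $V_j$ be the closed linear span of $\{D^n T^l \psi : n < j,\ l \in \mathbb{Z}\}$. For an integer $n \ge 0$, $\mathcal{L}_n$ denotes the collection of all wavelets $\psi$ for dilation $d$ such that $V_{-n}$ is invariant under all integer translations $T^l$, $l\in\mathbb{Z}$ (so $\mathcal{L}_{n} \supset \mathcal{L}_{n+1}$), and $\mathcal{M}_n = \mathcal{L}_n \setminus \mathcal{L}_{n+1}$. A wavelet has the translation invariance property of order $n$ if it belongs to $\mathcal{M}_n$; equivalently, $V_j$ is invariant under $T^l$ for all $l \in \mathbb{Z}$ if and only if $j \ge -n$. *)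

theory Defs
  imports "HOL-Analysis.Analysis"
begin

text \<open>
  Elements of \<open>L\<^sup>2(\<real>)\<close> are represented by square-integrable Borel functions rather than by
  classes modulo null sets; every class has a Borel representative.  All notions below depend on
  functions only up to a.e. equality: the inner product and norm do, and \<open>closed_span\<close> is closed
  in the \<open>L\<^sup>2\<close> seminorm, hence contains every Borel function a.e. equal to one of its members.
\<close>

definition L2 :: "(real \<Rightarrow> complex) set" where
  "L2 = {f. f \<in> borel_measurable lborel \<and> integrable lborel (\<lambda>x. (cmod (f x))\<^sup>2)}"

definition L2_inner :: "(real \<Rightarrow> complex) \<Rightarrow> (real \<Rightarrow> complex) \<Rightarrow> complex" where
  "L2_inner f g = (LINT x|lborel. f x * cnj (g x))"

definition L2_norm :: "(real \<Rightarrow> complex) \<Rightarrow> real" where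
  "L2_norm f = sqrt (LINT x|lborel. (cmod (f x))\<^sup>2)"

definition lin_span :: "(real \<Rightarrow> complex) set \<Rightarrow> (real \<Rightarrow> complex) set" where
  "lin_span S = {(\<lambda>x. \<Sum>g\<in>A. c g * g x) |A c. finite A \<and> A \<subseteq> S}"

text \<open>Meaningful for \<open>S \<subseteq> L2\<close> only; elsewhere the integral in \<open>L2_norm\<close> may be the default 0.\<close>

definition closed_span :: "(real \<Rightarrow> complex) set \<Rightarrow> (real \<Rightarrow> complex) set" where
  "closed_span S = {f \<in> L2. \<forall>\<epsilon>>0. \<exists>g\<in>lin_span S. L2_norm (\<lambda>x. f x - g x) < \<epsilon>}"

definition orthonormal_basis :: "('i \<Rightarrow> real \<Rightarrow> complex) \<Rightarrow> bool" where
  "orthonormal_basis e \<longleftrightarrow>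
     range e \<subseteq> L2 \<and>
     (\<forall>i j. L2_inner (e i) (e j) = (if i = j then 1 else 0)) \<and>
     closed_span (range e) = L2"

text \<open>
  Integer powers of the operators \<open>T f(x) = f(x - 1)\<close> and \<open>D f(x) = \<surd>d f(d x)\<close>, in closed form;
  the lemmas after the definitions confirm that they are the powers of \<open>T\<close> and \<open>D\<close>.
\<close>

definition T_pow :: "int \<Rightarrow> (real \<Rightarrow> complex) \<Rightarrow> real \<Rightarrow> complex" where
  "T_pow l f = (\<lambda>x. f (x - of_int l))"

definition D_pow :: "nat \<Rightarrow> int \<Rightarrow> (real \<Rightarrow> complex) \<Rightarrow> real \<Rightarrow> complex" where
  "D_pow d n f = (\<lambda>x. of_real (real d powr (of_int n / 2)) * f (real d powi n * x))"

lemma T_pow_0: "T_pow 0 f = f"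
  and T_pow_1: "T_pow 1 f = (\<lambda>x. f (x - 1))"
  and T_pow_add: "T_pow (k + l) f = T_pow k (T_pow l f)"
  by (simp_all add: T_pow_def algebra_simps)

lemma D_pow_0: "d > 0 \<Longrightarrow> D_pow d 0 f = f"
  and D_pow_1: "D_pow d 1 f = (\<lambda>x. of_real (sqrt (real d)) * f (real d * x))"
  and D_pow_add: "d > 0 \<Longrightarrow> D_pow d (m + n) f = D_pow d m (D_pow d n f)"
  by (simp_all add: D_pow_def powr_half_sqrt power_int_add powr_add add_divide_distrib mult_ac)

lemma D_pow_T_pow:
  "D_pow d n (T_pow l f) x =
     of_real (real d powr (of_int n / 2)) * f (real d powi n * x - of_int l)"
  by (simp add: D_pow_def T_pow_def)

definition wavelet :: "nat \<Rightarrow> (real \<Rightarrow> complex) \<Rightarrow> bool" where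
  "wavelet d \<psi> \<longleftrightarrow> \<psi> \<in> L2 \<and> orthonormal_basis (\<lambda>(n, l). D_pow d n (T_pow l \<psi>))"

definition V :: "nat \<Rightarrow> (real \<Rightarrow> complex) \<Rightarrow> int \<Rightarrow> (real \<Rightarrow> complex) set" where
  "V d \<psi> j = closed_span {D_pow d n (T_pow l \<psi>) |n l. n < j}"

definition translation_invariant :: "(real \<Rightarrow> complex) set \<Rightarrow> bool" where
  "translation_invariant W \<longleftrightarrow> (\<forall>l. \<forall>f\<in>W. T_pow l f \<in> W)"

definition \<L> :: "nat \<Rightarrow> nat \<Rightarrow> (real \<Rightarrow> complex) set" where
  "\<L> d n = {\<psi>. wavelet d \<psi> \<and> translation_invariant (V d \<psi> (- int n))}"

definition \<M> :: "nat \<Rightarrow> nat \<Rightarrow> (real \<Rightarrow> complex) set" where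
  "\<M> d n = \<L> d n - \<L> d (n + 1)"

end

theory Submission
  imports Defs "HOL-Probability.Characteristic_Functions"
begin

text \<open>
  Write \<open>N = d ^ n\<close>, \<open>M = d * N\<close>, \<open>v = N / (d * M - 1)\<close>, \<open>u = (d - 1) * v\<close>.  The set
  \<open>[-du, -u) \<union> [v, 1 - du) \<union> [N - u, N + v)\<close> tiles the line both under integer translations and
  under dilations by \<open>d\<close>.  Put \<open>A = [-du, -u)\<close> and \<open>B = [N - u, N - u/d)\<close>, so that
  \<open>B = A/d + N\<close> and \<open>d B = A + M\<close>.  Interpolating between this wavelet set and the one in which
  \<open>A\<close>, \<open>B\<close> are replaced by \<open>A + M\<close>, \<open>A/d\<close>, the Fourier transform of \<open>\<psi>\<close> is taken to be
  \<open>1 / sqrt 2\<close> on \<open>A\<close>, \<open>B\<close> and \<open>A + M\<close>, \<open>-1 / sqrt 2\<close> on \<open>A/d\<close>, and \<open>1\<close> on the rest of the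
  wavelet set.  The only integer translates by which this support meets itself are \<open>N = d ^ n\<close> and
  \<open>M = d ^ (n + 1)\<close>, hence the closed span of the \<open>T\<^sup>l \<psi>\<close> is invariant under
  translation by \<open>d ^ (- n)\<close>, but not by \<open>d ^ (- n - 1)\<close>.
\<close>

subsection \<open>Square-integrable functions\<close>

text \<open>The constants come from two linear equations. Moving \<open>[-u, v)\<close> out of
  \<open>[-a, 1 - a)\<close> by \<open>N\<close> keeps the translation tiling; the positive half
  line is tiled by dilates only if \<open>[N - u, N + v)\<close>, shrunk by \<open>M\<close>, fills
  the gap \<open>[y, d v)\<close>. So \<open>M * (1 - d u) = N - u\<close> and
  \<open>M * d * v = N + v\<close>, whose solution is the given \<open>u\<close>, \<open>v\<close>.
  The minus sign on \<open>A/d\<close> serves orthogonality between adjacent scales: there the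
  product of profile and dilated profile is -1/2 on \<open>A\<close> and +1/2 on
  \<open>A + M\<close>, and the two cancel against integer characters because \<open>M\<close> and
  \<open>M / d = N\<close> are integers. \<open>V d \<psi> (- n)\<close> is controlled through its
  orthogonal complement, spanned by the levels \<open>j \<ge> -n\<close>, each of which is invariant
  by itself. Failure one step lower comes from the same cancellation: a translate of a level
  \<open>-n-2\<close> element meets a level \<open>-n-1\<close> element, where the character jumps
  over \<open>M\<close> by the nontrivial phase of \<open>1 / d\<close>. The Fourier side is
  confined to bounded functions of compact support, where the transform is an absolutely convergent
  integral; density carries the results to all of \<open>L2\<close>.\<close>

definition nsq :: "(real \<Rightarrow> complex) \<Rightarrow> real" where
  "nsq f = (LINT x|lborel. (cmod (f x))\<^sup>2)"

lemma L2_norm_eq: "L2_norm f = sqrt (nsq f)"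
  by (simp add: L2_norm_def nsq_def)

lemma nsq_nonneg [simp]: "0 \<le> nsq f"
  by (simp add: nsq_def)

lemma L2_measurable [measurable_dest]: "f \<in> L2 \<Longrightarrow> f \<in> borel_measurable borel"
  by (simp add: L2_def)

lemma L2_integrable: "f \<in> L2 \<Longrightarrow> integrable lborel (\<lambda>x. (cmod (f x))\<^sup>2)"
  by (simp add: L2_def)

lemma L2I: "f \<in> borel_measurable borel \<Longrightarrow> integrable lborel (\<lambda>x. (cmod (f x))\<^sup>2) \<Longrightarrow> f \<in> L2"
  by (simp add: L2_def)

lemma norm_add_sq_le: "(cmod (a + b))\<^sup>2 \<le> 2 * (cmod a)\<^sup>2 + 2 * (cmod b)\<^sup>2"
proof -
  have "(cmod (a + b))\<^sup>2 \<le> (cmod a + cmod b)\<^sup>2"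
    by (intro power_mono norm_triangle_ineq) auto
  moreover have "0 \<le> (cmod a - cmod b)\<^sup>2" by simp
  ultimately show ?thesis by (simp add: power2_eq_square algebra_simps)
qed

lemma L2_zero [simp]: "(\<lambda>x. 0) \<in> L2"
  by (simp add: L2_def)

lemma L2_add [intro]:
  assumes "f \<in> L2" "g \<in> L2" shows "(\<lambda>x. f x + g x) \<in> L2"
proof (rule L2I)
  note [measurable] = L2_measurable[OF assms(1)] L2_measurable[OF assms(2)]
  show "(\<lambda>x. f x + g x) \<in> borel_measurable borel" by measurable
  show "integrable lborel (\<lambda>x. (cmod (f x + g x))\<^sup>2)"
  proof (rule Bochner_Integration.integrable_bound)
    show "integrable lborel (\<lambda>x. 2 * (cmod (f x))\<^sup>2 + 2 * (cmod (g x))\<^sup>2)"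
      using assms by (intro Bochner_Integration.integrable_add integrable_mult_right L2_integrable)
  qed (auto intro!: AE_I2 norm_add_sq_le)
qed

lemma L2_cmult [intro]:
  assumes "f \<in> L2" shows "(\<lambda>x. c * f x) \<in> L2"
  using assms by (auto simp: L2_def norm_mult power_mult_distrib intro!: integrable_mult_right)

lemma L2_uminus [intro]: "f \<in> L2 \<Longrightarrow> (\<lambda>x. - f x) \<in> L2"
  using L2_cmult[of f "-1"] by simp

lemma L2_diff [intro]: "f \<in> L2 \<Longrightarrow> g \<in> L2 \<Longrightarrow> (\<lambda>x. f x - g x) \<in> L2"
  using L2_add[of f "\<lambda>x. - g x"] by auto

lemma borel_measurable_cnj' [measurable (raw)]:
  "f \<in> borel_measurable M \<Longrightarrow> (\<lambda>x. cnj (f x)) \<in> borel_measurable M"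
  by (rule borel_measurable_continuous_on[where f = cnj]) (intro continuous_intros)

lemma integrable_inner:
  assumes "f \<in> L2" "g \<in> L2" shows "integrable lborel (\<lambda>x. f x * cnj (g x))"
proof (rule Bochner_Integration.integrable_bound)
  note [measurable] = L2_measurable[OF assms(1)] L2_measurable[OF assms(2)]
  show "integrable lborel (\<lambda>x. (cmod (f x))\<^sup>2 + (cmod (g x))\<^sup>2)"
    using assms by (intro Bochner_Integration.integrable_add L2_integrable)
  show "(\<lambda>x. f x * cnj (g x)) \<in> borel_measurable lborel" by measurable
  have "cmod a * cmod b \<le> (cmod a)\<^sup>2 + (cmod b)\<^sup>2" for a b
  proof -
    have "0 \<le> (cmod a - cmod b)\<^sup>2" "0 \<le> (cmod a)\<^sup>2 + (cmod b)\<^sup>2" by auto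
    then show ?thesis unfolding power2_diff by linarith
  qed
  then show "AE x in lborel. norm (f x * cnj (g x)) \<le> norm ((cmod (f x))\<^sup>2 + (cmod (g x))\<^sup>2)"
    by (auto simp: norm_mult)
qed

lemma L2_inner_add_left:
  "f \<in> L2 \<Longrightarrow> g \<in> L2 \<Longrightarrow> h \<in> L2 \<Longrightarrow> L2_inner (\<lambda>x. f x + g x) h = L2_inner f h + L2_inner g h"
  by (simp add: L2_inner_def ring_distribs integrable_inner)

lemma L2_inner_cmult_left: "L2_inner (\<lambda>x. c * f x) h = c * L2_inner f h"
  by (simp add: L2_inner_def mult.assoc)

lemma L2_inner_commute: "L2_inner g f = cnj (L2_inner f g)"
proof -
  have "cnj (L2_inner f g) = (LINT x|lborel. cnj (f x * cnj (g x)))"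
    unfolding L2_inner_def by (rule Bochner_Integration.integral_cnj[symmetric])
  then show ?thesis by (simp add: L2_inner_def mult.commute)
qed

lemma L2_inner_diff_left:
  "f \<in> L2 \<Longrightarrow> g \<in> L2 \<Longrightarrow> h \<in> L2 \<Longrightarrow> L2_inner (\<lambda>x. f x - g x) h = L2_inner f h - L2_inner g h"
  by (simp add: L2_inner_def ring_distribs left_diff_distrib integrable_inner)

lemma L2_inner_self: "L2_inner f f = of_real (nsq f)"
  unfolding L2_inner_def nsq_def complex_norm_square[symmetric] by (simp flip: of_real_power)

lemma nsq_add:
  assumes "f \<in> L2" "g \<in> L2"
  shows "nsq (\<lambda>x. f x + g x) = nsq f + 2 * Re (L2_inner f g) + nsq g"
proof -
  have eq: "(cmod (f x + g x))\<^sup>2 = (cmod (f x))\<^sup>2 + 2 * Re (f x * cnj (g x)) + (cmod (g x))\<^sup>2" for x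
    unfolding cmod_power2 by (simp add: power2_eq_square algebra_simps)
  have "Re (L2_inner f g) = (LINT x|lborel. Re (f x * cnj (g x)))"
    using integral_Re[OF integrable_inner[OF assms]] by (simp add: L2_inner_def)
  then show ?thesis
    unfolding nsq_def eq using integrable_Re[OF integrable_inner[OF assms]] assms[THEN L2_integrable]
    by (simp del: Re_complex_of_real complex_cnj_mult times_complex.simps)
qed

lemma nsq_cmult: "nsq (\<lambda>x. c * f x) = (cmod c)\<^sup>2 * nsq f"
  by (simp add: nsq_def norm_mult power_mult_distrib)

lemma nsq_diff:
  assumes "f \<in> L2" "g \<in> L2"
  shows "nsq (\<lambda>x. f x - g x) = nsq f - 2 * Re (L2_inner f g) + nsq g"
  using nsq_add[OF assms(1) L2_cmult[OF assms(2), of "-1"]] nsq_cmult[of "-1" g]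
    L2_inner_cmult_left[of "-1" g f] L2_inner_commute[of f g]
    L2_inner_commute[of f "\<lambda>x. -1 * g x"] by simp

lemma nsq_add_le:
  assumes "f \<in> L2" "g \<in> L2"
  shows "nsq (\<lambda>x. f x + g x) \<le> 2 * nsq f + 2 * nsq g"
proof -
  have "nsq (\<lambda>x. f x + g x) \<le> (LINT x|lborel. 2 * (cmod (f x))\<^sup>2 + 2 * (cmod (g x))\<^sup>2)"
    unfolding nsq_def using assms
    by (intro integral_mono Bochner_Integration.integrable_add integrable_mult_right L2_integrable
        norm_add_sq_le L2_add)
  also have "\<dots> = 2 * nsq f + 2 * nsq g"
    using assms by (simp add: nsq_def L2_integrable)
  finally show ?thesis .
qed

text \<open>Inner products are recovered from \<open>nsq\<close> alone, so a linear map that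
  preserves \<open>nsq\<close> preserves them too; this turns Plancherel into Parseval.\<close>

lemma L2_inner_polarization:
  assumes "f \<in> L2" "g \<in> L2"
  shows "Re (L2_inner f g) = (nsq (\<lambda>x. f x + g x) - nsq f - nsq g) / 2"
    and "Im (L2_inner f g) = (nsq (\<lambda>x. f x + \<i> * g x) - nsq f - nsq g) / 2"
proof -
  show "Re (L2_inner f g) = (nsq (\<lambda>x. f x + g x) - nsq f - nsq g) / 2"
    using nsq_add[OF assms] by simp
  show "Im (L2_inner f g) = (nsq (\<lambda>x. f x + \<i> * g x) - nsq f - nsq g) / 2"
    using nsq_add[OF assms(1) L2_cmult[OF assms(2), of \<i>]] nsq_cmult[of \<i> g]
      L2_inner_cmult_left[of \<i> g f] L2_inner_commute[of f g]
      L2_inner_commute[of f "\<lambda>x. \<i> * g x"] by simp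
qed

text \<open>Expanding \<open>nsq\<close> of \<open>sqrt t * f + g / sqrt t\<close> and of
  \<open>sqrt t * f - g / sqrt t\<close> gives both signs. The free weight \<open>t\<close> lets a
  small error in \<open>f\<close> absorb a large \<open>g\<close>.\<close>

lemma L2_Cauchy_Schwarz_weak:
  assumes "f \<in> L2" "g \<in> L2" "t > 0"
  shows "2 * \<bar>Re (L2_inner f g)\<bar> \<le> t * nsq f + nsq g / t"
proof -
  define s where "s = complex_of_real (sqrt t)"
  have s: "(cmod s)\<^sup>2 = t" "(cmod (1 / s))\<^sup>2 = 1 / t" "s \<noteq> 0" "cnj s = s"
    using assms(3) by (auto simp: s_def norm_divide power_divide)
  have in1: "L2_inner (\<lambda>x. s * f x) (\<lambda>x. 1 / s * g x) = L2_inner f g"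
    using s by (simp add: L2_inner_def)
  note L = L2_cmult[OF assms(1), of s] L2_cmult[OF assms(2), of "1 / s"]
  have "0 \<le> t * nsq f + 2 * Re (L2_inner f g) + nsq g / t"
    using nsq_add[OF L] nsq_nonneg[of "\<lambda>x. s * f x + 1 / s * g x"]
    unfolding nsq_cmult in1 s by simp
  moreover have "0 \<le> t * nsq f - 2 * Re (L2_inner f g) + nsq g / t"
    using nsq_diff[OF L] nsq_nonneg[of "\<lambda>x. s * f x - 1 / s * g x"]
    unfolding nsq_cmult in1 s by simp
  ultimately show ?thesis by linarith
qed

subsection \<open>Closed spans\<close>

lemma lin_span_zero: "(\<lambda>x. 0) \<in> lin_span S"
  unfolding lin_span_def by (intro CollectI exI[of _ "{}"]) auto

lemma lin_span_cmult:
  assumes "f \<in> lin_span S" shows "(\<lambda>x. c * f x) \<in> lin_span S"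
proof -
  obtain A a where "finite A" "A \<subseteq> S" "f = (\<lambda>x. \<Sum>g\<in>A. a g * g x)"
    using assms by (auto simp: lin_span_def)
  then show ?thesis
    unfolding lin_span_def
    by (intro CollectI exI[of _ A] exI[of _ "\<lambda>g. c * a g"]) (auto simp: sum_distrib_left mult.assoc)
qed

lemma lin_span_base: "f \<in> S \<Longrightarrow> f \<in> lin_span S"
  unfolding lin_span_def by (intro CollectI exI[of _ "{f}"] exI[of _ "\<lambda>_. 1"]) auto

lemma lin_span_add:
  assumes "f \<in> lin_span S" "g \<in> lin_span S" shows "(\<lambda>x. f x + g x) \<in> lin_span S"
proof -
  obtain A a where A: "finite A" "A \<subseteq> S" "f = (\<lambda>x. \<Sum>g\<in>A. a g * g x)"
    using assms by (auto simp: lin_span_def)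
  obtain B b where B: "finite B" "B \<subseteq> S" "g = (\<lambda>x. \<Sum>g\<in>B. b g * g x)"
    using assms by (auto simp: lin_span_def)
  have "(\<Sum>g\<in>A. a g * g x) + (\<Sum>g\<in>B. b g * g x) =
    (\<Sum>g\<in>A \<union> B. ((if g \<in> A then a g else 0) + (if g \<in> B then b g else 0)) * g x)" for x
    using A(1) B(1)
    by (simp add: ring_distribs sum.distrib if_distrib[of "\<lambda>x. x * _"] sum.If_cases Int_absorb1 cong: if_cong)
  then show ?thesis
    unfolding lin_span_def using A B
    by (intro CollectI exI[of _ "A \<union> B"]
        exI[of _ "\<lambda>g. (if g \<in> A then a g else 0) + (if g \<in> B then b g else 0)"]) auto
qed

lemma lin_span_induct [consumes 1, case_names zero add]:
  assumes "f \<in> lin_span S" "P (\<lambda>x. 0)"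
    "\<And>c g h. g \<in> S \<Longrightarrow> h \<in> lin_span S \<Longrightarrow> P h \<Longrightarrow> P (\<lambda>x. c * g x + h x)"
  shows "P f"
proof -
  obtain A c where A: "finite A" "A \<subseteq> S" "f = (\<lambda>x. \<Sum>g\<in>A. c g * g x)"
    using assms by (auto simp: lin_span_def)
  have "P (\<lambda>x. \<Sum>g\<in>A. c g * g x)"
    using A(1,2)
  proof (induction A)
    case (insert a A)
    have "(\<lambda>x. \<Sum>g\<in>A. c g * g x) \<in> lin_span S"
      using insert unfolding lin_span_def by blast
    then show ?case
      using insert assms(3)[of a "\<lambda>x. \<Sum>g\<in>A. c g * g x" "c a"] by simp
  qed (simp add: assms(2))
  then show ?thesis using A(3) by simp
qed

lemma lin_span_mono: "f \<in> lin_span S \<Longrightarrow> S \<subseteq> S' \<Longrightarrow> f \<in> lin_span S'"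
  unfolding lin_span_def by blast

lemma lin_span_L2: "f \<in> lin_span S \<Longrightarrow> S \<subseteq> L2 \<Longrightarrow> f \<in> L2"
  by (induction rule: lin_span_induct) (auto intro!: L2_add L2_cmult)

lemma closed_span_iff:
  "f \<in> closed_span S \<longleftrightarrow> f \<in> L2 \<and> (\<forall>\<epsilon>>0. \<exists>g\<in>lin_span S. nsq (\<lambda>x. f x - g x) < \<epsilon>)"
proof -
  have "(\<forall>\<epsilon>>0. \<exists>g\<in>lin_span S. sqrt (nsq (\<lambda>x. f x - g x)) < \<epsilon>) \<longleftrightarrow>
    (\<forall>\<epsilon>>0. \<exists>g\<in>lin_span S. nsq (\<lambda>x. f x - g x) < \<epsilon>)" (is "?L \<longleftrightarrow> ?R")
  proof
    assume L: ?L
    show ?R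
    proof safe
      fix \<epsilon> :: real assume "\<epsilon> > 0"
      then show "\<exists>g\<in>lin_span S. nsq (\<lambda>x. f x - g x) < \<epsilon>"
        using L[rule_format, of "sqrt \<epsilon>"] by simp
    qed
  next
    assume R: ?R
    show ?L
    proof safe
      fix \<epsilon> :: real assume "\<epsilon> > 0"
      then show "\<exists>g\<in>lin_span S. sqrt (nsq (\<lambda>x. f x - g x)) < \<epsilon>"
        using R[rule_format, of "\<epsilon>\<^sup>2"]
        by (metis abs_of_pos real_sqrt_abs real_sqrt_less_iff zero_less_power)
    qed
  qed
  then show ?thesis by (simp add: closed_span_def L2_norm_eq)
qed

lemma closed_spanE:
  assumes "f \<in> closed_span S" "\<epsilon> > 0"
  obtains g where "g \<in> lin_span S" "nsq (\<lambda>x. f x - g x) < \<epsilon>"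
  using assms by (auto simp: closed_span_iff)

lemma closed_span_L2: "f \<in> closed_span S \<Longrightarrow> f \<in> L2"
  by (simp add: closed_span_iff)

lemma closed_span_lin_span: "f \<in> lin_span S \<Longrightarrow> S \<subseteq> L2 \<Longrightarrow> f \<in> closed_span S"
  unfolding closed_span_iff using lin_span_L2 by (auto simp: nsq_def intro!: bexI[of _ f])

lemma closed_span_mono: "f \<in> closed_span S \<Longrightarrow> S \<subseteq> S' \<Longrightarrow> f \<in> closed_span S'"
  unfolding closed_span_iff using lin_span_mono by blast

lemma closed_span_closed:
  assumes "S \<subseteq> L2" "f \<in> L2" "\<And>\<epsilon>. \<epsilon> > 0 \<Longrightarrow> \<exists>g\<in>closed_span S. nsq (\<lambda>x. f x - g x) < \<epsilon>"
  shows "f \<in> closed_span S"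
  unfolding closed_span_iff
proof (intro conjI allI impI)
  fix \<epsilon> :: real assume "\<epsilon> > 0"
  then obtain g where g: "g \<in> closed_span S" "nsq (\<lambda>x. f x - g x) < \<epsilon> / 4"
    using assms(3)[of "\<epsilon> / 4"] by auto
  obtain h where h: "h \<in> lin_span S" "nsq (\<lambda>x. g x - h x) < \<epsilon> / 4"
    using g(1) \<open>\<epsilon> > 0\<close> by (elim closed_spanE[where \<epsilon> = "\<epsilon> / 4"]) auto
  have "nsq (\<lambda>x. (f x - g x) + (g x - h x)) \<le> 2 * nsq (\<lambda>x. f x - g x) + 2 * nsq (\<lambda>x. g x - h x)"
    using assms g h lin_span_L2 closed_span_L2 by (intro nsq_add_le L2_diff) auto
  then show "\<exists>g\<in>lin_span S. nsq (\<lambda>x. f x - g x) < \<epsilon>"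
    using g h by (intro bexI[of _ h]) auto
qed (rule assms)

lemma closed_span_limit:
  assumes "S \<subseteq> L2" "f \<in> L2" "\<And>k. g k \<in> closed_span S"
    "(\<lambda>k::nat. nsq (\<lambda>x. f x - g k x)) \<longlonglongrightarrow> 0"
  shows "f \<in> closed_span S"
proof (rule closed_span_closed[OF assms(1,2)])
  fix \<epsilon> :: real assume "\<epsilon> > 0"
  then have "\<forall>\<^sub>F k in sequentially. nsq (\<lambda>x. f x - g k x) < \<epsilon>"
    using assms(4) by (rule order_tendstoD(2)[rotated])
  then show "\<exists>g\<in>closed_span S. nsq (\<lambda>x. f x - g x) < \<epsilon>"
    using assms(3) by (auto simp: eventually_sequentially)
qed

lemma closed_span_trans:
  assumes "f \<in> closed_span S" "S \<subseteq> closed_span S'" "S' \<subseteq> L2"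
  shows "f \<in> closed_span S'"
proof -
  have add: "(\<lambda>x. c * g x + h x) \<in> closed_span S'" if gh: "g \<in> closed_span S'" "h \<in> closed_span S'" for c g h
    unfolding closed_span_iff
  proof (intro conjI allI impI)
    show "(\<lambda>x. c * g x + h x) \<in> L2" using that by (auto intro!: L2_add L2_cmult dest: closed_span_L2)
    fix \<epsilon> :: real assume "\<epsilon> > 0"
    \<comment> \<open>Twice the squared modulus of \<open>c\<close>, the factor lost in
      \<open>nsq_add_le\<close>, enlarged to stay positive when \<open>c = 0\<close>.\<close>
    define K where "K = 2 * ((cmod c)\<^sup>2 + 1)"
    have "K > 0" unfolding K_def by (smt (verit) zero_le_power2)
    then have e: "\<epsilon> / (2 * K) > 0" "\<epsilon> / 4 > 0" using \<open>\<epsilon> > 0\<close> by auto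
    obtain g' where g': "g' \<in> lin_span S'" "nsq (\<lambda>x. g x - g' x) < \<epsilon> / (2 * K)"
      using gh(1) e(1) by (rule closed_spanE)
    obtain h' where h': "h' \<in> lin_span S'" "nsq (\<lambda>x. h x - h' x) < \<epsilon> / 4"
      using gh(2) e(2) by (rule closed_spanE)
    have "nsq (\<lambda>x. c * (g x - g' x) + (h x - h' x)) \<le>
      2 * nsq (\<lambda>x. c * (g x - g' x)) + 2 * nsq (\<lambda>x. h x - h' x)"
      using that g' h' lin_span_L2 closed_span_L2 assms(3)
      by (intro nsq_add_le L2_diff L2_cmult) auto
    also have "2 * nsq (\<lambda>x. c * (g x - g' x)) = 2 * (cmod c)\<^sup>2 * nsq (\<lambda>x. g x - g' x)"
      by (simp add: nsq_cmult)
    also have "\<dots> \<le> K * nsq (\<lambda>x. g x - g' x)"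
      by (intro mult_right_mono) (auto simp: K_def)
    also have "\<dots> < \<epsilon> / 2"
      using g'(2) \<open>K > 0\<close> by (simp add: field_simps)
    also have "(\<lambda>x. c * (g x - g' x) + (h x - h' x)) = (\<lambda>x. c * g x + h x - (c * g' x + h' x))"
      by (auto simp: algebra_simps)
    finally show "\<exists>k\<in>lin_span S'. nsq (\<lambda>x. c * g x + h x - k x) < \<epsilon>"
      using g' h' by (intro bexI[of _ "\<lambda>x. c * g' x + h' x"] lin_span_add lin_span_cmult) auto
  qed
  have "g \<in> closed_span S'" if "g \<in> lin_span S" for g
    using that
  proof (induction rule: lin_span_induct)
    case zero
    then show ?case using closed_span_lin_span[OF lin_span_zero assms(3)] .
  qed (use assms add in auto)
  note sp = this
  show ?thesis
  proof (rule closed_span_closed[OF assms(3) closed_span_L2[OF assms(1)]])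
    fix \<epsilon> :: real assume "\<epsilon> > 0"
    with assms(1) obtain g where "g \<in> lin_span S" "nsq (\<lambda>x. f x - g x) < \<epsilon>" by (rule closed_spanE)
    then show "\<exists>g\<in>closed_span S'. nsq (\<lambda>x. f x - g x) < \<epsilon>" using sp by blast
  qed
qed

lemma closed_span_base: "f \<in> S \<Longrightarrow> S \<subseteq> L2 \<Longrightarrow> f \<in> closed_span S"
  by (intro closed_span_lin_span lin_span_base)

lemma closed_span_idem: "S \<subseteq> L2 \<Longrightarrow> f \<in> lin_span (closed_span S) \<Longrightarrow> f \<in> closed_span S"
  using closed_span_trans[of f "closed_span S" S] closed_span_lin_span[of f "closed_span S"]
    closed_span_L2 by auto

lemma closed_span_add:
  "S \<subseteq> L2 \<Longrightarrow> f \<in> closed_span S \<Longrightarrow> g \<in> closed_span S \<Longrightarrow> (\<lambda>x. f x + g x) \<in> closed_span S"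
  by (rule closed_span_idem, assumption) (rule lin_span_add; rule lin_span_base)

lemma closed_span_cmult:
  "S \<subseteq> L2 \<Longrightarrow> f \<in> closed_span S \<Longrightarrow> (\<lambda>x. c * f x) \<in> closed_span S"
  by (rule closed_span_idem, assumption) (rule lin_span_cmult, rule lin_span_base)

text \<open>Orthogonality passes to finite sums by linearity and to limits by the weighted
  Cauchy-Schwarz bound. That bound sees real parts only; the imaginary part follows by applying it
  to \<open>\<i> * q\<close>.\<close>

lemma closed_span_orthogonal:
  assumes "f \<in> closed_span S" "S \<subseteq> L2" "q \<in> L2" "\<And>g. g \<in> S \<Longrightarrow> L2_inner g q = 0"
  shows "L2_inner f q = 0"
proof -
  have sp: "L2_inner g q = 0" if "g \<in> lin_span S" for g
    using that
  proof (induction rule: lin_span_induct)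
    case (add c g h)
    then have "g \<in> L2" "h \<in> L2" using lin_span_L2 assms by auto
    then show ?case using add assms L2_inner_add_left[of "\<lambda>x. c * g x" h q]
      by (auto simp: L2_inner_cmult_left)
  qed (simp add: L2_inner_def)
  have Re0: "Re (L2_inner f q) = 0"
    if fq: "f \<in> closed_span S" "q \<in> L2" "\<And>g. g \<in> lin_span S \<Longrightarrow> L2_inner g q = 0" for f q
  proof (rule ccontr)
    assume ne: "Re (L2_inner f q) \<noteq> 0"
    define r where "r = \<bar>Re (L2_inner f q)\<bar>"
    have r: "r > 0" using ne by (simp add: r_def)
    \<comment> \<open>The weight makes \<open>nsq q / t\<close> at most \<open>r\<close>, and an
      approximation within \<open>r / t\<close> makes the other term smaller than \<open>r\<close>;
      together they contradict the value \<open>2 * r\<close>.\<close>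
    define t where "t = (nsq q + 1) / r"
    have t: "t > 0" using r by (auto simp: t_def intro!: divide_pos_pos add_nonneg_pos)
    obtain g where g: "g \<in> lin_span S" "nsq (\<lambda>x. f x - g x) < r / t"
      using fq(1) divide_pos_pos[OF r t] by (rule closed_spanE)
    have L: "f \<in> L2" "g \<in> L2" using lin_span_L2[OF g(1) assms(2)] closed_span_L2 fq(1) by auto
    have "2 * r = 2 * \<bar>Re (L2_inner (\<lambda>x. f x - g x) q)\<bar>"
      using fq(3)[OF g(1)] L fq(2) by (simp add: r_def L2_inner_diff_left)
    also have "\<dots> \<le> t * nsq (\<lambda>x. f x - g x) + nsq q / t"
      using L fq(2) t by (intro L2_Cauchy_Schwarz_weak) auto
    also have "\<dots> < r + r"
    proof (rule add_less_le_mono)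
      show "t * nsq (\<lambda>x. f x - g x) < r" using g(2) t by (simp add: field_simps)
      have "nsq q / (nsq q + 1) \<le> 1" using nsq_nonneg[of q] by (intro divide_le_eq_1_pos[THEN iffD2]) linarith+
      then show "nsq q / t \<le> r"
        using mult_left_mono[of "nsq q / (nsq q + 1)" 1 r] r unfolding t_def by (simp add: mult.commute)
    qed
    finally show False by simp
  qed
  have "Re (L2_inner f (\<lambda>x. \<i> * q x)) = 0"
  proof (rule Re0)
    show "L2_inner g (\<lambda>x. \<i> * q x) = 0" if "g \<in> lin_span S" for g
      using sp[OF that] L2_inner_cmult_left[of \<i> q g] L2_inner_commute[of g "\<lambda>x. \<i> * q x"]
        L2_inner_commute[of q g] by simp
  qed (use assms in auto)
  moreover have "L2_inner f (\<lambda>x. \<i> * q x) = - \<i> * L2_inner f q"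
    using L2_inner_cmult_left[of \<i> q f] L2_inner_commute[of f "\<lambda>x. \<i> * q x"]
      L2_inner_commute[of q f] by simp
  ultimately show ?thesis
    using Re0[OF assms(1,3) sp] by (simp add: complex_eq_iff)
qed

text \<open>If \<open>s\<^sub>1 + s\<^sub>2\<close> with \<open>s\<^sub>1\<close>, \<open>s\<^sub>2\<close> in the spans of \<open>S\<close>, \<open>S'\<close> approximates \<open>f\<close>, then by
  orthogonality \<open>s\<^sub>1\<close> alone approximates it at least as well.\<close>

lemma closed_span_orthogonal_complement:
  assumes "f \<in> closed_span (S \<union> S')" "S \<union> S' \<subseteq> L2"
    and "\<And>g h. g \<in> S \<Longrightarrow> h \<in> S' \<Longrightarrow> L2_inner g h = 0"
    and "\<And>h. h \<in> S' \<Longrightarrow> L2_inner f h = 0"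
  shows "f \<in> closed_span S"
  unfolding closed_span_iff
proof (intro conjI allI impI)
  show f: "f \<in> L2" using assms(1) closed_span_L2 by auto
  fix \<epsilon> :: real assume "\<epsilon> > 0"
  with assms(1) obtain s where s: "s \<in> lin_span (S \<union> S')" "nsq (\<lambda>x. f x - s x) < \<epsilon>"
    by (rule closed_spanE)
  have "\<exists>s1\<in>lin_span S. \<exists>s2\<in>lin_span S'. s = (\<lambda>x. s1 x + s2 x)"
    using s(1)
  proof (induction rule: lin_span_induct)
    case zero
    show ?case by (intro bexI[OF _ lin_span_zero]) auto
  next
    case (add c g h)
    then obtain s1 s2 where ih: "s1 \<in> lin_span S" "s2 \<in> lin_span S'" "h = (\<lambda>x. s1 x + s2 x)"
      by blast
    from add(1) show ?case
    proof
      assume "g \<in> S"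
      then have "(\<lambda>x. c * g x + s1 x) \<in> lin_span S"
        by (intro lin_span_add[OF lin_span_cmult ih(1)] lin_span_base)
      then show ?thesis using ih by (intro bexI[of _ "\<lambda>x. c * g x + s1 x"] bexI[of _ s2]) auto
    next
      assume "g \<in> S'"
      then have "(\<lambda>x. c * g x + s2 x) \<in> lin_span S'"
        by (intro lin_span_add[OF lin_span_cmult ih(2)] lin_span_base)
      then show ?thesis using ih by (intro bexI[of _ s1] bexI[of _ "\<lambda>x. c * g x + s2 x"]) auto
    qed
  qed
  then obtain s1 s2 where s12: "s1 \<in> lin_span S" "s2 \<in> lin_span S'" "s = (\<lambda>x. s1 x + s2 x)"
    by blast
  have L: "s1 \<in> L2" "s2 \<in> L2" using s12 lin_span_L2 assms(2) by auto
  have S': "L2_inner g s2 = 0" if "g \<in> L2" "\<And>h. h \<in> S' \<Longrightarrow> L2_inner g h = 0" for g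
    using closed_span_orthogonal[of s2 S' g] that closed_span_lin_span[OF s12(2)] assms(2)
      L2_inner_commute by (metis Un_subset_iff complex_cnj_zero)
  have "L2_inner s1 s2 = 0"
    using closed_span_orthogonal[OF closed_span_lin_span[OF s12(1)]] assms L
    by (intro S' L(1)) (auto intro!: closed_span_orthogonal[OF closed_span_lin_span[OF s12(1)]])
  moreover have "L2_inner f s2 = 0" using assms(4) f by (intro S')
  ultimately have "nsq (\<lambda>x. (f x - s1 x) - s2 x) = nsq (\<lambda>x. f x - s1 x) + nsq s2"
    using nsq_diff[of "\<lambda>x. f x - s1 x" s2] f L L2_inner_diff_left[of f s1 s2] by auto
  moreover have "(\<lambda>x. f x - s x) = (\<lambda>x. (f x - s1 x) - s2 x)" using s12 by auto
  ultimately have "nsq (\<lambda>x. f x - s1 x) < \<epsilon>" using s(2) nsq_nonneg[of s2] by (simp del: nsq_nonneg)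
  then show "\<exists>g\<in>lin_span S. nsq (\<lambda>x. f x - g x) < \<epsilon>" using s12 by blast
qed

subsection \<open>The Fourier transform on bounded functions with compact support\<close>

text \<open>Bounded with compact support: a class that is integrable and square integrable at once,
  stable under dilation, translation, modulation and cutting off, and dense in
  \<open>L2\<close>.\<close>

definition bcs :: "(real \<Rightarrow> complex) set" where
  "bcs = {g \<in> borel_measurable borel. (\<exists>B. \<forall>x. cmod (g x) \<le> B) \<and> (\<exists>R. \<forall>x. R < \<bar>x\<bar> \<longrightarrow> g x = 0)}"

lemma bcsI:
  assumes "g \<in> borel_measurable borel" "\<And>x. cmod (g x) \<le> B" "\<And>x. R < \<bar>x\<bar> \<Longrightarrow> g x = 0"
  shows "g \<in> bcs"
  using assms by (auto simp: bcs_def)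

lemma bcsE:
  assumes "g \<in> bcs"
  obtains B R where "g \<in> borel_measurable borel" "\<And>x. cmod (g x) \<le> B" "\<And>x. R < \<bar>x\<bar> \<Longrightarrow> g x = 0"
    "B > 0" "R > 0"
proof -
  obtain B R where *: "g \<in> borel_measurable borel" "\<And>x. cmod (g x) \<le> B" "\<And>x. R < \<bar>x\<bar> \<Longrightarrow> g x = 0"
    using assms by (auto simp: bcs_def)
  show ?thesis
  proof (rule that[of "max 1 B" "max 1 R"])
    show "cmod (g x) \<le> max 1 B" for x using *(2)[of x] by simp
  qed (use * in auto)
qed

lemma bcs_measurable [measurable_dest]: "g \<in> bcs \<Longrightarrow> g \<in> borel_measurable borel"
  by (auto simp: bcs_def)

lemma integrable_bounded_support:
  fixes f :: "real \<Rightarrow> 'a :: {banach, second_countable_topology}"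
  assumes "f \<in> borel_measurable borel" "\<And>x. norm (f x) \<le> B" "\<And>x. R < \<bar>x\<bar> \<Longrightarrow> f x = 0"
  shows "integrable lborel f"
proof (rule Bochner_Integration.integrable_bound)
  show "integrable lborel (\<lambda>x. B * indicator {-R..R} x :: real)"
    by (intro integrable_mult_right integrable_real_indicator) (auto simp: emeasure_lborel_Icc_eq)
  have "norm (f x) \<le> norm (B * indicator {-R..R} x :: real)" for x
    using assms(2)[of x] assms(3)[of x] by (cases "\<bar>x\<bar> \<le> R") (auto simp: abs_le_iff)
  then show "AE x in lborel. norm (f x) \<le> norm (B * indicator {-R..R} x :: real)" by simp
qed (use assms in simp)

lemma integrable_bcs: "g \<in> bcs \<Longrightarrow> integrable lborel g"
  by (elim bcsE) (rule integrable_bounded_support)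

lemma bcs_bounded_mult:
  assumes "m \<in> borel_measurable borel" "\<And>x. cmod (m x) \<le> M" "g \<in> bcs"
  shows "(\<lambda>x. m x * g x) \<in> bcs"
proof -
  obtain B R where *: "g \<in> borel_measurable borel" "\<And>x. cmod (g x) \<le> B" "\<And>x. R < \<bar>x\<bar> \<Longrightarrow> g x = 0" "B > 0"
    using assms(3) by (elim bcsE) blast
  note [measurable] = assms(1) *(1)
  show ?thesis
  proof (rule bcsI)
    show "cmod (m x * g x) \<le> M * B" for x
      using assms(2)[of x] *(2)[of x] by (auto simp: norm_mult intro!: mult_mono order_trans[OF norm_ge_zero])
  qed (use * in auto)
qed

lemma bcs_cmult: "g \<in> bcs \<Longrightarrow> (\<lambda>x. c * g x) \<in> bcs"
  by (rule bcs_bounded_mult[of "\<lambda>_. c" "cmod c"]) auto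

lemma bcs_zero: "(\<lambda>x. 0) \<in> bcs"
  by (rule bcsI[of _ 0]) auto

lemma bcs_add:
  assumes "f \<in> bcs" "g \<in> bcs" shows "(\<lambda>x. f x + g x) \<in> bcs"
proof -
  obtain B R where f: "f \<in> borel_measurable borel" "\<And>x. cmod (f x) \<le> B" "\<And>x. R < \<bar>x\<bar> \<Longrightarrow> f x = 0"
    using assms(1) by (elim bcsE) blast
  obtain B' R' where g: "g \<in> borel_measurable borel" "\<And>x. cmod (g x) \<le> B'" "\<And>x. R' < \<bar>x\<bar> \<Longrightarrow> g x = 0"
    using assms(2) by (elim bcsE) blast
  note [measurable] = f(1) g(1)
  show ?thesis
  proof (rule bcsI)
    show "cmod (f x + g x) \<le> B + B'" for x
      using f(2)[of x] g(2)[of x] by norm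
    show "f x + g x = 0" if "max R R' < \<bar>x\<bar>" for x
      using that f(3)[of x] g(3)[of x] by simp
  qed auto
qed

lemma bcs_diff: "f \<in> bcs \<Longrightarrow> g \<in> bcs \<Longrightarrow> (\<lambda>x. f x - g x) \<in> bcs"
  using bcs_add[of f "\<lambda>x. -1 * g x"] bcs_cmult[of g "-1"] by simp

lemma bcs_cnj: "g \<in> bcs \<Longrightarrow> (\<lambda>x. cnj (g x)) \<in> bcs"
  by (auto simp: bcs_def)

lemma bcs_affine:
  assumes "g \<in> bcs" "c \<noteq> 0" shows "(\<lambda>x. g (t + c * x)) \<in> bcs"
proof -
  obtain B R where *: "g \<in> borel_measurable borel" "\<And>x. cmod (g x) \<le> B" "\<And>x. R < \<bar>x\<bar> \<Longrightarrow> g x = 0"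
    using assms(1) by (elim bcsE) blast
  note [measurable] = *(1)
  show ?thesis
  proof (rule bcsI)
    show "g (t + c * x) = 0" if "(R + \<bar>t\<bar>) / \<bar>c\<bar> < \<bar>x\<bar>" for x
    proof (rule *(3))
      have "R + \<bar>t\<bar> < \<bar>c * x\<bar>"
        using that assms(2) by (simp add: abs_mult divide_less_eq mult.commute)
      then show "R < \<bar>t + c * x\<bar>" by linarith
    qed
  qed (use * in auto)
qed

lemma bcs_indicator:
  "g \<in> bcs \<Longrightarrow> S \<in> sets borel \<Longrightarrow> (\<lambda>x. indicator S x * g x) \<in> bcs"
  by (rule bcs_bounded_mult[of _ 1]) (auto simp: indicator_def)

lemma bcs_L2: assumes "g \<in> bcs" shows "g \<in> L2"
proof -
  have "(\<lambda>x. cnj (g x) * g x) \<in> bcs"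
    using assms by (elim bcsE) (rule bcs_bounded_mult[OF _ _ assms], auto)
  then have "integrable lborel (\<lambda>x. norm (cnj (g x) * g x))"
    by (intro integrable_norm integrable_bcs)
  then show ?thesis
    using assms by (auto simp: L2_def norm_mult power2_eq_square)
qed

definition ee :: "real \<Rightarrow> complex" where "ee t = cis (2 * pi * t)"

lemma ee_add: "ee (s + t) = ee s * ee t"
  by (simp add: ee_def cis_mult ring_distribs)

lemma ee_0 [simp]: "ee 0 = 1"
  by (simp add: ee_def)

lemma norm_ee [simp]: "cmod (ee t) = 1"
  by (simp add: ee_def)

lemma cnj_ee: "cnj (ee t) = ee (- t)"
  by (simp add: ee_def cis_cnj)

lemma ee_int [simp]: "ee (of_int k) = 1"
  using cis_multiple_2pi[of "of_int k"] by (simp add: ee_def)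

lemma continuous_ee: "continuous_on A ee"
  unfolding ee_def by (intro continuous_intros)

lemma measurable_ee [measurable]: "ee \<in> borel_measurable borel"
  using continuous_ee by (rule borel_measurable_continuous_onI)

lemma bcs_ee_mult: "g \<in> bcs \<Longrightarrow> (\<lambda>x. ee (t * x) * g x) \<in> bcs"
  by (rule bcs_bounded_mult[of _ 1]) auto

text \<open>With the positive sign in the exponent this is the inverse Fourier transform in the
  usual convention: it maps the frequency profile to the wavelet itself.\<close>

definition ft :: "(real \<Rightarrow> complex) \<Rightarrow> real \<Rightarrow> complex" where
  "ft g x = (LINT \<xi>|lborel. g \<xi> * ee (x * \<xi>))"

lemma integrable_ee: "integrable lborel g \<Longrightarrow> integrable lborel (\<lambda>\<xi>. g \<xi> * ee (x * \<xi>))"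
proof (rule Bochner_Integration.integrable_bound[of _ g])
  assume g: "integrable lborel g"
  then have [measurable]: "g \<in> borel_measurable borel" by (auto dest: borel_measurable_integrable)
  show "(\<lambda>\<xi>. g \<xi> * ee (x * \<xi>)) \<in> borel_measurable lborel" by measurable
qed (auto simp: norm_mult)

lemma norm_ft_le: "cmod (ft g x) \<le> (LINT \<xi>|lborel. cmod (g \<xi>))"
  unfolding ft_def by (rule order_trans[OF integral_norm_bound]) (simp add: norm_mult)

lemma measurable_ft [measurable]:
  assumes [measurable]: "g \<in> borel_measurable borel" shows "ft g \<in> borel_measurable borel"
  unfolding ft_def[abs_def] by measurable

lemma ft_add: "integrable lborel f \<Longrightarrow> integrable lborel g \<Longrightarrow> ft (\<lambda>x. f x + g x) = (\<lambda>x. ft f x + ft g x)"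
  by (simp add: ft_def[abs_def] ring_distribs integrable_ee)

lemma ft_cmult: "ft (\<lambda>x. c * g x) = (\<lambda>x. c * ft g x)"
  by (simp add: ft_def[abs_def] mult.assoc)

text \<open>Fubini, with the integrand dominated by the modulus of \<open>f x * g t\<close>. This
  multiplication formula drives both Plancherel and the density of transforms.\<close>

lemma ft_mult_swap:
  assumes f: "integrable lborel f" and g: "integrable lborel g"
  shows "(LINT x|lborel. f x * ft g x) = (LINT t|lborel. g t * ft f t)"
proof -
  note [measurable] = borel_measurable_integrable[OF f, simplified] borel_measurable_integrable[OF g, simplified]
  have "integrable (lborel \<Otimes>\<^sub>M lborel) (\<lambda>(x, t). f x * g t * ee (x * t))"
  proof (rule lborel_pair.Fubini_integrable)
    show "integrable lborel (\<lambda>x. LINT y|lborel. cmod (case (x, y) of (x, t) \<Rightarrow> f x * g t * ee (x * t)))"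
      using integrable_norm[OF f] by (simp add: norm_mult)
    show "AE x in lborel. integrable lborel (\<lambda>y. case (x, y) of (x, t) \<Rightarrow> f x * g t * ee (x * t))"
      using integrable_mult_right[OF integrable_ee[OF g]] by (simp add: mult.assoc)
  qed measurable
  from lborel_pair.Fubini_integral[OF this]
  have "(LINT x|lborel. LINT t|lborel. f x * g t * ee (x * t)) =
    (LINT t|lborel. LINT x|lborel. f x * g t * ee (x * t))" by simp
  moreover have "(LINT t|lborel. f x * g t * ee (x * t)) = f x * ft g x" for x
    by (simp add: ft_def mult.assoc)
  moreover have "(LINT x|lborel. f x * g t * ee (x * t)) = g t * ft f t" for t
  proof -
    have "(LINT x|lborel. f x * g t * ee (x * t)) = (LINT x|lborel. g t * (f x * ee (t * x)))"
      by (intro Bochner_Integration.integral_cong) (auto simp: mult_ac)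
    then show ?thesis by (simp add: ft_def)
  qed
  ultimately show ?thesis by simp
qed

text \<open>The convolution of \<open>g\<close> with its conjugate reflection: its value at 0 is
  \<open>nsq g\<close>, and its transform is the squared modulus of \<open>ft g\<close>.\<close>

definition autocorr :: "(real \<Rightarrow> complex) \<Rightarrow> real \<Rightarrow> complex" where
  "autocorr g t = (LINT \<xi>|lborel. g \<xi> * cnj (g (\<xi> - t)))"

lemma autocorr_bcs:
  assumes "g \<in> bcs" shows "autocorr g \<in> bcs"
proof -
  obtain B R where *: "g \<in> borel_measurable borel" "\<And>x. cmod (g x) \<le> B" "\<And>x. R < \<bar>x\<bar> \<Longrightarrow> g x = 0"
    using assms by (elim bcsE) blast
  note [measurable] = *(1)
  show ?thesis
  proof (rule bcsI)
    show "autocorr g \<in> borel_measurable borel"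
      unfolding autocorr_def[abs_def] by measurable
    show "cmod (autocorr g t) \<le> (LINT \<xi>|lborel. cmod (g \<xi>) * B)" for t
      unfolding autocorr_def
    proof (rule order_trans[OF integral_norm_bound], rule integral_mono)
      have "(\<lambda>\<xi>. cnj (g (\<xi> - t)) * g \<xi>) \<in> bcs"
        by (rule bcs_bounded_mult[OF _ _ assms, of _ B]) (use * in auto)
      then show "integrable lborel (\<lambda>\<xi>. cmod (g \<xi> * cnj (g (\<xi> - t))))"
        by (subst mult.commute) (intro integrable_norm integrable_bcs)
      show "integrable lborel (\<lambda>\<xi>. cmod (g \<xi>) * B)"
        using integrable_bcs[OF assms] by auto
    qed (use * in \<open>auto simp: norm_mult intro!: mult_left_mono\<close>)
    show "autocorr g t = 0" if "2 * R < \<bar>t\<bar>" for t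
    proof -
      have "g \<xi> * cnj (g (\<xi> - t)) = 0" for \<xi>
      proof (cases "R < \<bar>\<xi>\<bar>")
        case False
        then have "R < \<bar>\<xi> - t\<bar>" using that by linarith
        then show ?thesis using * by simp
      qed (use * in simp)
      then show ?thesis unfolding autocorr_def by (simp only: integral_zero)
    qed
  qed
qed

lemma ft_autocorr:
  assumes "g \<in> bcs" shows "ft (autocorr g) x = of_real ((cmod (ft g x))\<^sup>2)"
proof -
  note g = integrable_bcs[OF assms]
  note [measurable] = bcs_measurable[OF assms]
  let ?F = "\<lambda>\<xi> t. g \<xi> * cnj (g (\<xi> - t)) * ee (x * t)"
  have shift: "(LINT t|lborel. f (\<xi> - t)) = (LINT t|lborel. f t)" for f :: "real \<Rightarrow> 'c :: {banach, second_countable_topology}" and \<xi>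
    using lborel_integral_real_affine[of "-1" f \<xi>] by simp
  have ishift: "integrable lborel (\<lambda>t. f (\<xi> - t))" if "integrable lborel f" for f :: "real \<Rightarrow> complex" and \<xi>
    using lborel_integrable_real_affine[of f "-1" \<xi>] that by simp
  have "integrable (lborel \<Otimes>\<^sub>M lborel) (case_prod ?F)"
  proof (rule lborel_pair.Fubini_integrable)
    show "integrable lborel (\<lambda>\<xi>. LINT t|lborel. cmod (case (\<xi>, t) of (\<xi>, t) \<Rightarrow> ?F \<xi> t))"
      using integrable_norm[OF g] by (simp add: norm_mult shift[of "\<lambda>t. cmod (g t)"])
    show "AE \<xi> in lborel. integrable lborel (\<lambda>t. case (\<xi>, t) of (\<xi>, t) \<Rightarrow> ?F \<xi> t)"
    proof (rule AE_I2)
      fix \<xi>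
      have "integrable lborel (\<lambda>t. cnj (g (\<xi> - t)))"
        using ishift[OF g] by simp
      then show "integrable lborel (\<lambda>t. case (\<xi>, t) of (\<xi>, t) \<Rightarrow> ?F \<xi> t)"
        using integrable_ee by (simp add: mult.assoc)
    qed
  qed measurable
  from lborel_pair.Fubini_integral[OF this]
  have "(LINT t|lborel. LINT \<xi>|lborel. ?F \<xi> t) = (LINT \<xi>|lborel. LINT t|lborel. ?F \<xi> t)" .
  moreover have "(LINT t|lborel. LINT \<xi>|lborel. ?F \<xi> t) = ft (autocorr g) x"
    by (simp add: ft_def autocorr_def)
  moreover have "(LINT t|lborel. ?F \<xi> t) = g \<xi> * ee (x * \<xi>) * cnj (ft g x)" for \<xi>
  proof -
    have "(LINT t|lborel. ?F \<xi> t) = (LINT t|lborel. g \<xi> * ee (x * \<xi>) * cnj (g (\<xi> - t) * ee (x * (\<xi> - t))))"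
    proof (intro Bochner_Integration.integral_cong refl)
      fix t
      have "ee (x * \<xi>) * ee (- (x * (\<xi> - t))) = ee (x * t)"
        by (simp add: algebra_simps flip: ee_add)
      then show "?F \<xi> t = g \<xi> * ee (x * \<xi>) * cnj (g (\<xi> - t) * ee (x * (\<xi> - t)))"
        by (simp add: cnj_ee mult_ac)
    qed
    also have "\<dots> = g \<xi> * ee (x * \<xi>) * cnj (LINT t|lborel. g (\<xi> - t) * ee (x * (\<xi> - t)))"
      by (simp only: integral_mult_right_zero Bochner_Integration.integral_cnj)
    also have "(LINT t|lborel. g (\<xi> - t) * ee (x * (\<xi> - t))) = ft g x"
      unfolding ft_def by (rule shift[of "\<lambda>t. g t * ee (x * t)"])
    finally show ?thesis .
  qed
  ultimately have "ft (autocorr g) x = ft g x * cnj (ft g x)"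
    by (simp add: ft_def)
  then show ?thesis by (simp flip: complex_norm_square)
qed

text \<open>Lebesgue measurability already supplies continuous functions that converge almost
  everywhere. Composing with the radial clamp \<open>cl\<close>, which fixes the ball of radius
  \<open>B\<close>, bounds them, and a cutoff confines them to the interval without disturbing the
  limit.\<close>

lemma continuous_approx:
  assumes "g \<in> bcs" and B: "\<And>x. cmod (g x) \<le> B" "B > 0" and ab: "\<And>x. x \<notin> {a<..<b} \<Longrightarrow> g x = 0"
  obtains h :: "nat \<Rightarrow> real \<Rightarrow> complex" where
    "\<And>k. continuous_on UNIV (h k)" "\<And>k x. cmod (h k x) \<le> B"
    "\<And>k x. x \<notin> {a<..<b} \<Longrightarrow> h k x = 0" "AE x in lborel. (\<lambda>k. h k x) \<longlonglongrightarrow> g x"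
proof -
  have "g \<in> borel_measurable lebesgue"
    using assms(1) measurable_completion[of g lborel borel] by (auto dest: bcs_measurable)
  then have "g measurable_on UNIV"
    by (rule lebesgue_measurable_imp_measurable_on) simp
  then obtain N p where N: "negligible N" and p: "\<And>k. continuous_on UNIV (p k)"
    "\<And>x. x \<notin> N \<Longrightarrow> (\<lambda>k. p k x) \<longlonglongrightarrow> g x"
    by (auto simp: measurable_on_def)
  define cl where "cl z = z / of_real (max 1 (cmod z / B))" for z
  have cl_cont: "continuous_on UNIV cl"
    unfolding cl_def using B by (intro continuous_intros) auto
  have cl_le: "cmod (cl z) \<le> B" for z
    using B(2) by (auto simp: cl_def norm_divide max_def field_simps)
  have cl_id: "cl z = z" if "cmod z \<le> B" for z
    using that B(2) by (simp add: cl_def max_def field_simps)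
  \<comment> \<open>Vanishes outside the open interval and is eventually equal to 1 at each point
    inside it.\<close>
  define bump where "bump k x = min 1 (real k * max 0 (min (x - a) (b - x)))" for k x
  define h where "h k x = of_real (bump k x) * cl (p k x)" for k x
  show ?thesis
  proof (rule that)
    show "continuous_on UNIV (h k)" for k
      unfolding h_def bump_def
      by (intro continuous_intros continuous_on_compose2[OF cl_cont] p) auto
    show "cmod (h k x) \<le> B" for k x
    proof -
      have "cmod (h k x) \<le> 1 * B"
        unfolding h_def norm_mult by (intro mult_mono cl_le) (auto simp: bump_def)
      then show ?thesis by simp
    qed
    show "h k x = 0" if "x \<notin> {a<..<b}" for k x
    proof -
      have "max 0 (min (x - a) (b - x)) = 0" using that by (auto simp: max_def min_def)
      then show ?thesis unfolding h_def bump_def by simp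
    qed
    have conv: "(\<lambda>k. h k x) \<longlonglongrightarrow> g x" if "x \<notin> N" for x
    proof -
      have "(\<lambda>k. cl (p k x)) \<longlonglongrightarrow> cl (g x)"
        using continuous_on_tendsto_compose[OF cl_cont p(2)[OF that]] by simp
      then have c: "(\<lambda>k. cl (p k x)) \<longlonglongrightarrow> g x" using cl_id B by simp
      show ?thesis
      proof (cases "x \<in> {a<..<b}")
        case True
        define \<delta> where "\<delta> = min (x - a) (b - x)"
        have \<delta>: "\<delta> > 0" using True by (simp add: \<delta>_def)
        obtain k0 where k0: "1 / \<delta> < real k0" using reals_Archimedean2 by blast
        have "bump k x = 1" if "k \<ge> k0" for k
        proof -
          have "1 / \<delta> \<le> real k" using k0 that by linarith
          then have "1 \<le> real k * \<delta>" using \<delta> by (simp add: field_simps)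
          then show ?thesis using \<delta> by (simp add: bump_def flip: \<delta>_def)
        qed
        then have "\<forall>\<^sub>F k in sequentially. cl (p k x) = h k x"
          by (auto simp: h_def eventually_sequentially intro!: exI[of _ k0])
        then show ?thesis using c by (rule Lim_transform_eventually[rotated])
      next
        case False
        then have "max 0 (min (x - a) (b - x)) = 0" by (auto simp: max_def min_def)
        then have "h k x = 0" for k unfolding h_def bump_def by simp
        then show ?thesis using ab[OF False] by simp
      qed
    qed
    have "AE x in lebesgue. x \<notin> N"
      using N by (intro AE_not_in) (simp add: negligible_iff_null_sets)
    then have "AE x in lebesgue. (\<lambda>k. h k x) \<longlonglongrightarrow> g x"
      by eventually_elim (rule conv)
    then show "AE x in lborel. (\<lambda>k. h k x) \<longlonglongrightarrow> g x"
      by (simp add: AE_completion_iff)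
  qed
qed

text \<open>Replacing the shifted copy of \<open>g\<close> by a continuous \<open>h k\<close> costs
  at most \<open>B * \<delta> k\<close>, uniformly in the shift, and for continuous
  \<open>h k\<close> dominated convergence gives the limit. A three-epsilon argument combines the
  two.\<close>

lemma autocorr_tendsto:
  assumes "g \<in> bcs" "t \<longlonglongrightarrow> 0" shows "(\<lambda>k. autocorr g (t k)) \<longlonglongrightarrow> autocorr g 0"
proof -
  obtain B R where *: "g \<in> borel_measurable borel" "\<And>x. cmod (g x) \<le> B" "\<And>x. R < \<bar>x\<bar> \<Longrightarrow> g x = 0" "B > 0" "R > 0"
    using assms by (elim bcsE) blast
  note [measurable] = *(1)
  have sup: "g x = 0" if "x \<notin> {-R-1<..<R+1}" for x
    using that by (intro *(3)) auto
  obtain h :: "nat \<Rightarrow> real \<Rightarrow> complex" where h: "\<And>k. continuous_on UNIV (h k)" "\<And>k x. cmod (h k x) \<le> B"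
    "\<And>k x. x \<notin> {-R-1<..<R+1} \<Longrightarrow> h k x = 0" "AE x in lborel. (\<lambda>k. h k x) \<longlonglongrightarrow> g x"
    using continuous_approx[OF assms(1) *(2,4) sup] by blast
  have [measurable]: "h k \<in> borel_measurable borel" for k
    using h(1) by (rule borel_measurable_continuous_onI)
  have hb: "h k \<in> bcs" for k
    by (rule bcsI[where B = B and R = "R + 1"]) (auto intro!: h(2,3))
  define a where "a k s = (LINT \<xi>|lborel. g \<xi> * cnj (h k (\<xi> - s)))" for k s
  have int: "integrable lborel (\<lambda>\<xi>. g \<xi> * cnj (h k (\<xi> - s)))" for k s
    by (subst mult.commute, rule integrable_bcs, rule bcs_bounded_mult[OF _ _ assms(1), of _ B])
      (use h(2) in auto)
  have intg: "integrable lborel (\<lambda>\<xi>. g \<xi> * cnj (g (\<xi> - s)))" for s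
    by (subst mult.commute, rule integrable_bcs, rule bcs_bounded_mult[OF _ _ assms(1), of _ B])
      (use * in auto)
  define \<delta> where "\<delta> k = (LINT x|lborel. cmod (g x - h k x))" for k
  have \<delta>_lim: "\<delta> \<longlonglongrightarrow> 0"
  proof -
    have "(\<lambda>k. LINT x|lborel. cmod (g x - h k x)) \<longlonglongrightarrow> (LINT x|(lborel :: real measure). (0::real))"
    proof (rule integral_dominated_convergence)
      show "integrable lborel (\<lambda>x. 2 * B * indicator {-R-1..R+1} x :: real)"
        by (intro integrable_mult_right integrable_real_indicator) (auto simp: emeasure_lborel_Icc_eq)
      show "AE x in lborel. (\<lambda>k. cmod (g x - h k x)) \<longlonglongrightarrow> 0"
        using h(4)
      proof eventually_elim
        case (elim x)
        then show ?case
          using tendsto_norm[OF tendsto_diff[OF tendsto_const[of "g x"] elim]] by simp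
      qed
      show "AE x in lborel. norm (cmod (g x - h k x)) \<le> 2 * B * indicator {-R-1..R+1} x" for k
      proof (rule AE_I2)
        fix x show "norm (cmod (g x - h k x)) \<le> 2 * B * indicator {-R-1..R+1} x"
        proof (cases "x \<in> {-R-1<..<R+1}")
          case True
          then show ?thesis
            using norm_triangle_ineq4[of "g x" "h k x"] *(2)[of x] h(2)[of k x] by auto
        qed (use *(4) in \<open>auto simp: sup h(3)\<close>)
      qed
    qed auto
    then show ?thesis by (simp add: \<delta>_def[abs_def])
  qed
  have le: "cmod (autocorr g s - a k s) \<le> B * \<delta> k" for k s
  proof -
    have "autocorr g s - a k s = (LINT \<xi>|lborel. g \<xi> * cnj (g (\<xi> - s) - h k (\<xi> - s)))"
      using int intg by (simp add: autocorr_def a_def right_diff_distrib)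
    also have "cmod \<dots> \<le> (LINT \<xi>|lborel. B * cmod (g (\<xi> - s) - h k (\<xi> - s)))"
    proof (rule order_trans[OF integral_norm_bound], rule integral_mono)
      have d: "(\<lambda>x. g x - h k x) \<in> bcs" using assms(1) hb by (rule bcs_diff)
      then have "integrable lborel (\<lambda>x. g (x - s) - h k (x - s))"
        using integrable_bcs[OF bcs_affine[OF d, of 1 "-s"]] by simp
      then show "integrable lborel (\<lambda>\<xi>. B * cmod (g (\<xi> - s) - h k (\<xi> - s)))" by simp
      have "(\<lambda>x. cnj (g (x - s) - h k (x - s)) * g x) \<in> bcs"
      proof (rule bcs_bounded_mult[OF _ _ assms(1)])
        show "cmod (cnj (g (x - s) - h k (x - s))) \<le> 2 * B" for x
          using norm_triangle_ineq4[of "g (x - s)" "h k (x - s)"] *(2)[of "x - s"] h(2)[of k "x - s"]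
          by (simp flip: complex_cnj_diff)
      qed auto
      then show "integrable lborel (\<lambda>\<xi>. cmod (g \<xi> * cnj (g (\<xi> - s) - h k (\<xi> - s))))"
        by (subst mult.commute) (intro integrable_norm integrable_bcs)
      show "cmod (g \<xi> * cnj (g (\<xi> - s) - h k (\<xi> - s))) \<le> B * cmod (g (\<xi> - s) - h k (\<xi> - s))" for \<xi>
        using *(2)[of \<xi>] by (simp add: norm_mult mult_right_mono flip: complex_cnj_diff)
    qed
    also have "\<dots> = B * \<delta> k"
      using lborel_integral_real_affine[of 1 "\<lambda>x. cmod (g x - h k x)" "-s"] by (simp add: \<delta>_def)
    finally show ?thesis .
  qed
  have a_lim: "(\<lambda>j. a k (t j)) \<longlonglongrightarrow> a k 0" for k
    unfolding a_def
  proof (rule integral_dominated_convergence)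
    show "integrable lborel (\<lambda>x. cmod (g x) * B)"
      using integrable_bcs[OF assms(1)] by auto
    show "AE x in lborel. (\<lambda>j. g x * cnj (h k (x - t j))) \<longlonglongrightarrow> g x * cnj (h k (x - 0))"
    proof (intro AE_I2 tendsto_mult tendsto_const tendsto_cnj)
      fix x
      have "(\<lambda>j. x - t j) \<longlonglongrightarrow> x - 0" using assms(2) by (intro tendsto_intros)
      then show "(\<lambda>j. h k (x - t j)) \<longlonglongrightarrow> h k (x - 0)"
        by (rule continuous_on_tendsto_compose[OF h(1)]) auto
    qed
  qed (use h(2) in \<open>auto simp: norm_mult intro!: mult_left_mono\<close>)
  show ?thesis
  proof (rule LIMSEQ_I)
    fix \<epsilon> :: real assume "\<epsilon> > 0"
    then have "\<epsilon> / (3 * B) > 0" using *(4) by simp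
    then obtain k where k: "norm (\<delta> k) < \<epsilon> / (3 * B)"
      using LIMSEQ_D[OF \<delta>_lim] by fastforce
    then have k3: "B * \<delta> k < \<epsilon> / 3"
      using *(4) by (simp add: field_simps abs_less_iff)
    obtain j0 where j0: "\<And>j. j \<ge> j0 \<Longrightarrow> cmod (a k (t j) - a k 0) < \<epsilon> / 3"
      using LIMSEQ_D[OF a_lim[of k], of "\<epsilon> / 3"] \<open>\<epsilon> > 0\<close> by auto
    show "\<exists>no. \<forall>j\<ge>no. cmod (autocorr g (t j) - autocorr g 0) < \<epsilon>"
    proof (intro exI allI impI)
      fix j assume "j \<ge> j0"
      have "autocorr g (t j) - autocorr g 0 =
        (autocorr g (t j) - a k (t j)) + (a k (t j) - a k 0) - (autocorr g 0 - a k 0)" by simp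
      also have "cmod \<dots> \<le> cmod (autocorr g (t j) - a k (t j)) + cmod (a k (t j) - a k 0) + cmod (autocorr g 0 - a k 0)"
        by norm
      also have "\<dots> < \<epsilon>"
        using le[of "t j" k] le[of 0 k] k3 j0[OF \<open>j \<ge> j0\<close>] by linarith
      finally show "cmod (autocorr g (t j) - autocorr g 0) < \<epsilon>" .
    qed
  qed
qed

text \<open>The characteristic function of the standard normal distribution, rescaled. The transform
  of the Gaussian of width \<open>K\<close> is a density of total mass 1 that concentrates at 0 as
  \<open>K\<close> grows.\<close>

lemma ft_gaussian:
  assumes "K > 0"
  shows "ft (\<lambda>x. of_real (exp (- (x / K)\<^sup>2 / 2))) t = of_real (2 * pi * K * std_normal_density (2 * pi * K * t))"
    and "integrable lborel (\<lambda>x. complex_of_real (exp (- (x / K)\<^sup>2 / 2)))"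
proof -
  have dens: "std_normal_density x * sqrt (2 * pi) = exp (- x\<^sup>2 / 2)" for x
    by (simp add: std_normal_density_def)
  have "integrable lborel (\<lambda>x. complex_of_real (std_normal_density x * sqrt (2 * pi)))"
    by (intro integrable_of_real integrable_mult_left integrable_normal_density) auto
  then have "integrable lborel (\<lambda>x. complex_of_real (exp (- x\<^sup>2 / 2)))"
    unfolding dens .
  from lborel_integrable_real_affine[OF this, of "1 / K" 0]
  show "integrable lborel (\<lambda>x. complex_of_real (exp (- (x / K)\<^sup>2 / 2)))"
    using assms by simp
  have "(LINT x|lborel. of_real (std_normal_density x) * iexp (s * x)) = of_real (exp (- s\<^sup>2 / 2))" for s
  proof -
    have "char std_normal_distribution s = (LINT x|lborel. std_normal_density x *\<^sub>R iexp (s * x))"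
      unfolding char_def by (subst integral_density) auto
    then show ?thesis by (simp add: char_std_normal_distribution scaleR_conv_of_real)
  qed note char = this
  have "ft (\<lambda>x. of_real (exp (- (x / K)\<^sup>2 / 2))) t =
      K *\<^sub>R (LINT x|lborel. of_real (exp (- x\<^sup>2 / 2)) * ee (t * (K * x)))"
    unfolding ft_def using assms by (subst lborel_integral_real_affine[of K _ 0]) auto
  also have "(LINT x|lborel. of_real (exp (- x\<^sup>2 / 2)) * ee (t * (K * x))) =
      (LINT x|lborel. of_real (sqrt (2 * pi)) * (of_real (std_normal_density x) * iexp ((2 * pi * K * t) * x)))"
    unfolding dens[symmetric] ee_def cis_conv_exp
    by (intro Bochner_Integration.integral_cong) (auto simp: mult_ac)
  also have "\<dots> = of_real (sqrt (2 * pi)) * of_real (exp (- (2 * pi * K * t)\<^sup>2 / 2))"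
    by (simp only: integral_mult_right_zero char)
  finally show "ft (\<lambda>x. of_real (exp (- (x / K)\<^sup>2 / 2))) t = of_real (2 * pi * K * std_normal_density (2 * pi * K * t))"
    unfolding dens[symmetric] by (simp add: scaleR_conv_of_real mult_ac flip: of_real_mult)
qed

text \<open>Gaussian summation: with weights \<open>w k\<close> increasing to 1, the weighted
  integral of the squared modulus of \<open>ft g\<close> equals an average of
  \<open>autocorr g\<close> over shifts shrinking to 0, hence tends to
  \<open>autocorr g 0 = nsq g\<close>. Monotone convergence then yields integrability and the value
  together.\<close>

theorem ft_Plancherel:
  assumes "g \<in> bcs" shows "ft g \<in> L2" and "nsq (ft g) = nsq g"
proof -
  note [measurable] = bcs_measurable[OF assms]
  note a = autocorr_bcs[OF assms]
  note [measurable] = bcs_measurable[OF a]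
  obtain B where B: "\<And>x. cmod (autocorr g x) \<le> B" using a by (elim bcsE) blast
  define w where "w k x = exp (- (x / real (Suc k))\<^sup>2 / 2)" for k x
  have [measurable]: "w k \<in> borel_measurable borel" for k
    unfolding w_def[abs_def] by measurable
  have w: "integrable lborel (\<lambda>x. complex_of_real (w k x))" for k
    unfolding w_def by (rule ft_gaussian) simp
  have eq: "(LINT x|lborel. of_real (w k x) * of_real ((cmod (ft g x))\<^sup>2)) =
    (LINT s|lborel. of_real (std_normal_density s) * autocorr g (s / (2 * pi * real (Suc k))))" for k
  proof -
    define K where "K = 2 * pi * real (Suc k)"
    have K: "K > 0" by (simp add: K_def)
    have "(LINT x|lborel. of_real (w k x) * of_real ((cmod (ft g x))\<^sup>2)) =
      (LINT x|lborel. of_real (w k x) * ft (autocorr g) x)"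
      by (simp only: ft_autocorr[OF assms])
    also have "\<dots> = (LINT t|lborel. autocorr g t * ft (\<lambda>x. of_real (w k x)) t)"
      by (rule ft_mult_swap[OF w integrable_bcs[OF a]])
    also have "\<dots> = (LINT t|lborel. autocorr g t * of_real (K * std_normal_density (K * t)))"
      unfolding w_def K_def by (subst ft_gaussian) (auto simp: mult_ac)
    also have "\<dots> = (1 / K) *\<^sub>R (LINT s|lborel. autocorr g (s / K) * of_real (K * std_normal_density s))"
      using K by (subst lborel_integral_real_affine[of "1 / K" _ 0]) auto
    also have "\<dots> = (LINT s|lborel. (1 / K) *\<^sub>R (autocorr g (s / K) * of_real (K * std_normal_density s)))"
      by simp
    also have "\<dots> = (LINT s|lborel. of_real (std_normal_density s) * autocorr g (s / K))"
      using K by (intro Bochner_Integration.integral_cong) (auto simp: scaleR_conv_of_real)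
    finally show ?thesis by (simp add: K_def)
  qed
  have "(\<lambda>k. LINT s|lborel. of_real (std_normal_density s) * autocorr g (s / (2 * pi * real (Suc k))))
    \<longlonglongrightarrow> (LINT s|lborel. of_real (std_normal_density s) * autocorr g 0)"
  proof (rule integral_dominated_convergence)
    show "integrable lborel (\<lambda>s. std_normal_density s * B)" by simp
    show "AE s in lborel. (\<lambda>k. of_real (std_normal_density s) * autocorr g (s / (2 * pi * real (Suc k))))
        \<longlonglongrightarrow> of_real (std_normal_density s) * autocorr g 0"
    proof (intro AE_I2 tendsto_mult tendsto_const autocorr_tendsto assms)
      fix s :: real
      have "(\<lambda>k. (s / (2 * pi)) * inverse (real (Suc k))) \<longlonglongrightarrow> (s / (2 * pi)) * 0"
        by (intro tendsto_mult tendsto_const LIMSEQ_inverse_real_of_nat)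
      then show "(\<lambda>k. s / (2 * pi * real (Suc k))) \<longlonglongrightarrow> 0"
        by (simp add: field_simps)
    qed
  qed (use B in \<open>auto simp: norm_mult intro!: mult_left_mono\<close>)
  also have "(LINT s|lborel. of_real (std_normal_density s) * autocorr g 0) = autocorr g 0"
    using integral_normal_density[of 1 0] by simp
  also have "autocorr g 0 = of_real (nsq g)"
    using L2_inner_self[of g] by (simp add: autocorr_def L2_inner_def)
  finally have lim: "(\<lambda>k. LINT x|lborel. complex_of_real (w k x) * of_real ((cmod (ft g x))\<^sup>2)) \<longlonglongrightarrow> of_real (nsq g)"
    unfolding eq .
  have lim': "(\<lambda>k. LINT x|lborel. w k x * (cmod (ft g x))\<^sup>2) \<longlonglongrightarrow> nsq g"
    using tendsto_Re[OF lim] by (simp flip: of_real_mult of_real_power)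
  have mono: "AE x in lborel. mono (\<lambda>k. w k x * (cmod (ft g x))\<^sup>2)"
  proof (intro AE_I2 monoI mult_right_mono)
    fix x :: real and i j :: nat assume "i \<le> j"
    then have "(x / real (Suc j))\<^sup>2 \<le> (x / real (Suc i))\<^sup>2"
      unfolding power_divide by (intro divide_left_mono power_mono) auto
    then show "w i x \<le> w j x" by (simp add: w_def)
  qed auto
  have lim1: "AE x in lborel. (\<lambda>k. w k x * (cmod (ft g x))\<^sup>2) \<longlonglongrightarrow> (cmod (ft g x))\<^sup>2"
  proof (intro AE_I2)
    fix x :: real
    have "(\<lambda>k. exp (- (x * inverse (real (Suc k)))\<^sup>2 / 2)) \<longlonglongrightarrow> exp (- (x * 0)\<^sup>2 / 2)"
      by (intro tendsto_intros LIMSEQ_inverse_real_of_nat) auto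
    then have "(\<lambda>k. w k x) \<longlonglongrightarrow> 1" by (simp add: w_def field_simps)
    from tendsto_mult[OF this tendsto_const[of "(cmod (ft g x))\<^sup>2"]]
    show "(\<lambda>k. w k x * (cmod (ft g x))\<^sup>2) \<longlonglongrightarrow> (cmod (ft g x))\<^sup>2" by simp
  qed
  have int: "integrable lborel (\<lambda>x. w k x * (cmod (ft g x))\<^sup>2)" for k
  proof (rule Bochner_Integration.integrable_bound)
    show "integrable lborel (\<lambda>x. w k x * (LINT \<xi>|lborel. cmod (g \<xi>))\<^sup>2)"
      using integrable_norm[OF w[of k]] by (simp add: w_def)
    show "AE x in lborel. norm (w k x * (cmod (ft g x))\<^sup>2) \<le> norm (w k x * (LINT \<xi>|lborel. cmod (g \<xi>))\<^sup>2)"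
      using norm_ft_le[of g] by (auto simp: abs_mult w_def intro!: mult_left_mono power_mono)
  qed measurable
  note mc = integral_monotone_convergence_nonneg[OF int mono _ lim1 lim']
  have "integrable lborel (\<lambda>x. (cmod (ft g x))\<^sup>2)"
    by (rule mc) (auto simp: w_def)
  then show "ft g \<in> L2" by (intro L2I) auto
  show "nsq (ft g) = nsq g"
    unfolding nsq_def[of "ft g"] by (rule mc) (auto simp: w_def)
qed

lemma L2_inner_ft:
  assumes "f \<in> bcs" "g \<in> bcs" shows "L2_inner (ft f) (ft g) = L2_inner f g"
proof -
  note I = assms[THEN integrable_bcs]
  have "ft (\<lambda>x. f x + g x) = (\<lambda>x. ft f x + ft g x)" using I by (rule ft_add)
  moreover have "ft (\<lambda>x. f x + \<i> * g x) = (\<lambda>x. ft f x + \<i> * ft g x)"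
    using ft_add[of f "\<lambda>x. \<i> * g x"] I ft_cmult[of \<i> g] by simp
  ultimately show ?thesis
    using L2_inner_polarization[OF ft_Plancherel(1)[OF assms(1)] ft_Plancherel(1)[OF assms(2)]]
      L2_inner_polarization[OF assms[THEN bcs_L2]]
      ft_Plancherel(2)[OF bcs_add[OF assms]]
      ft_Plancherel(2)[OF bcs_add[OF assms(1) bcs_cmult[OF assms(2), of \<i>]]]
      assms[THEN ft_Plancherel(2)]
    by (simp add: complex_eq_iff)
qed

section \<open>Density of bounded, compactly supported functions and of their transforms\<close>

lemma bcs_dense:
  assumes "f \<in> L2" "\<epsilon> > 0" obtains g where "g \<in> bcs" "nsq (\<lambda>x. f x - g x) < \<epsilon>"
proof -
  note [measurable] = L2_measurable[OF assms(1)]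
  define g where "g k x = indicator {-real k..real k} x * (if cmod (f x) \<le> real k then f x else 0)" for k :: nat and x
  have [measurable]: "g k \<in> borel_measurable borel" for k
    unfolding g_def[abs_def] by measurable
  have gb: "g k \<in> bcs" for k
    by (rule bcsI[where B = "real k" and R = "real k"]) (auto simp: g_def indicator_def)
  have "(\<lambda>k. LINT x|lborel. (cmod (f x - g k x))\<^sup>2) \<longlonglongrightarrow> (LINT x|(lborel :: real measure). (0::real))"
  proof (rule integral_dominated_convergence[where w = "\<lambda>x. (cmod (f x))\<^sup>2"])
    show "integrable lborel (\<lambda>x. (cmod (f x))\<^sup>2)" using assms(1) by (rule L2_integrable)
    show "AE x in lborel. (\<lambda>k. (cmod (f x - g k x))\<^sup>2) \<longlonglongrightarrow> 0"
    proof (rule AE_I2)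
      fix x
      obtain k0 where k0: "max \<bar>x\<bar> (cmod (f x)) < real k0" using reals_Archimedean2 by blast
      have "(cmod (f x - g k x))\<^sup>2 = 0" if "k \<ge> k0" for k
      proof -
        have "real k0 \<le> real k" using that by simp
        then have "\<bar>x\<bar> \<le> real k" "cmod (f x) \<le> real k" using k0 by auto
        then show ?thesis by (auto simp: g_def indicator_def abs_le_iff)
      qed
      then have "\<forall>\<^sub>F k in sequentially. (cmod (f x - g k x))\<^sup>2 = 0"
        by (auto simp: eventually_sequentially intro!: exI[of _ k0])
      then show "(\<lambda>k. (cmod (f x - g k x))\<^sup>2) \<longlonglongrightarrow> 0" by (rule tendsto_eventually)
    qed
    show "AE x in lborel. norm ((cmod (f x - g k x))\<^sup>2) \<le> (cmod (f x))\<^sup>2" for k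
      by (auto simp: g_def indicator_def)
  qed measurable
  then have "(\<lambda>k. nsq (\<lambda>x. f x - g k x)) \<longlonglongrightarrow> 0" by (simp add: nsq_def)
  then have "\<forall>\<^sub>F k in sequentially. nsq (\<lambda>x. f x - g k x) < \<epsilon>"
    using assms(2) by (rule order_tendstoD(2))
  then show ?thesis using gb that by (auto simp: eventually_sequentially)
qed

text \<open>The approximants \<open>h k\<close> truncate the opposite-sign transform of
  \<open>f\<close>. The multiplication formula gives
  \<open>L2_inner f (ft (h k)) = nsq (h k)\<close>, so the squared error is exactly
  \<open>nsq f - nsq (h k)\<close>, and this tends to 0 by Plancherel for \<open>f\<close>.\<close>

lemma ft_dense_bcs:
  assumes f: "f \<in> bcs" and "\<epsilon> > 0" obtains h where "h \<in> bcs" "nsq (\<lambda>x. f x - ft h x) < \<epsilon>"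
proof -
  note [measurable] = bcs_measurable[OF f]
  note If = integrable_bcs[OF f]
  define h where "h k \<xi> = indicator {-real k..real k} \<xi> * ft f (- \<xi>)" for k :: nat and \<xi>
  have [measurable]: "h k \<in> borel_measurable borel" for k
    unfolding h_def[abs_def] by measurable
  have hb: "h k \<in> bcs" for k
    by (rule bcsI[where B = "LINT \<xi>|lborel. cmod (f \<xi>)" and R = "real k"])
      (auto simp: h_def indicator_def norm_ft_le)
  have cnj_ft: "cnj (ft (h k) x) = ft (\<lambda>\<xi>. cnj (h k (- \<xi>))) x" for k x
  proof -
    have "cnj (ft (h k) x) = (LINT \<xi>|lborel. cnj (h k \<xi>) * ee (- (x * \<xi>)))"
      by (simp add: ft_def cnj_ee flip: Bochner_Integration.integral_cnj)
    also have "\<dots> = (LINT \<xi>|lborel. cnj (h k (- \<xi>)) * ee (x * \<xi>))"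
      by (subst lborel_integral_real_affine[of "-1" _ 0]) auto
    finally show ?thesis by (simp add: ft_def)
  qed
  have inner: "L2_inner f (ft (h k)) = of_real (nsq (h k))" for k
  proof -
    have hc: "(\<lambda>\<xi>. cnj (h k (- \<xi>))) \<in> bcs"
      using bcs_cnj[OF bcs_affine[OF hb[of k], of "-1" 0]] by simp
    have "L2_inner f (ft (h k)) = (LINT x|lborel. f x * ft (\<lambda>\<xi>. cnj (h k (- \<xi>))) x)"
      by (simp add: L2_inner_def cnj_ft)
    also have "\<dots> = (LINT \<xi>|lborel. cnj (h k (- \<xi>)) * ft f \<xi>)"
      by (rule ft_mult_swap[OF If integrable_bcs[OF hc]])
    also have "\<dots> = (LINT \<xi>|lborel. cnj (h k \<xi>) * ft f (- \<xi>))"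
      by (subst lborel_integral_real_affine[of "-1" _ 0]) auto
    also have "\<dots> = (LINT \<xi>|lborel. h k \<xi> * cnj (h k \<xi>))"
      by (intro Bochner_Integration.integral_cong) (auto simp: h_def indicator_def)
    finally show ?thesis by (simp add: L2_inner_self[symmetric] L2_inner_def)
  qed
  have n: "nsq (\<lambda>x. f x - ft (h k) x) = nsq f - nsq (h k)" for k
    using nsq_diff[OF bcs_L2[OF f] ft_Plancherel(1)[OF hb]] ft_Plancherel(2)[OF hb] inner by simp
  have "(\<lambda>k. LINT \<xi>|lborel. (cmod (h k \<xi>))\<^sup>2) \<longlonglongrightarrow> (LINT \<xi>|lborel. (cmod (ft f (- \<xi>)))\<^sup>2)"
  proof (rule integral_dominated_convergence)
    show "integrable lborel (\<lambda>\<xi>. (cmod (ft f (- \<xi>)))\<^sup>2)"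
      using lborel_integrable_real_affine[OF L2_integrable[OF ft_Plancherel(1)[OF f]], of "-1" 0] by simp
    show "AE x in lborel. (\<lambda>k. (cmod (h k x))\<^sup>2) \<longlonglongrightarrow> (cmod (ft f (- x)))\<^sup>2"
    proof (rule AE_I2)
      fix x :: real
      obtain k0 where k0: "\<bar>x\<bar> < real k0" using reals_Archimedean2 by blast
      have "(cmod (h k x))\<^sup>2 = (cmod (ft f (- x)))\<^sup>2" if "k \<ge> k0" for k
      proof -
        have "real k0 \<le> real k" using that by simp
        then have "\<bar>x\<bar> \<le> real k" using k0 by auto
        then show ?thesis by (auto simp: h_def indicator_def abs_le_iff)
      qed
      then have "\<forall>\<^sub>F k in sequentially. (cmod (h k x))\<^sup>2 = (cmod (ft f (- x)))\<^sup>2"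
        by (auto simp: eventually_sequentially intro!: exI[of _ k0])
      then show "(\<lambda>k. (cmod (h k x))\<^sup>2) \<longlonglongrightarrow> (cmod (ft f (- x)))\<^sup>2" by (rule tendsto_eventually)
    qed
  qed (auto simp: h_def indicator_def)
  also have "(LINT \<xi>|lborel. (cmod (ft f (- \<xi>)))\<^sup>2) = nsq f"
    using lborel_integral_real_affine[of "-1" "\<lambda>\<xi>. (cmod (ft f \<xi>))\<^sup>2" 0] ft_Plancherel(2)[OF f]
    by (simp add: nsq_def)
  finally have "(\<lambda>k. nsq f - nsq (h k)) \<longlonglongrightarrow> nsq f - nsq f"
    unfolding nsq_def[symmetric] by (intro tendsto_diff tendsto_const)
  then have "(\<lambda>k. nsq (\<lambda>x. f x - ft (h k) x)) \<longlonglongrightarrow> 0" by (simp add: n)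
  then have "\<forall>\<^sub>F k in sequentially. nsq (\<lambda>x. f x - ft (h k) x) < \<epsilon>"
    using assms(2) by (rule order_tendstoD(2))
  then show ?thesis using hb that by (auto simp: eventually_sequentially)
qed

text \<open>Stated on a linear subspace \<open>X\<close> so that one argument covers both
  \<open>ft\<close>, considered on \<open>bcs\<close>, and dilations on all of
  \<open>L2\<close>.\<close>

lemma closed_span_isometry:
  assumes X: "X \<subseteq> L2" "(\<lambda>x. 0) \<in> X" "\<And>c g h. g \<in> X \<Longrightarrow> h \<in> X \<Longrightarrow> (\<lambda>x. c * g x + h x) \<in> X"
    and U: "\<And>c g h. g \<in> X \<Longrightarrow> h \<in> X \<Longrightarrow> U (\<lambda>x. c * g x + h x) = (\<lambda>x. c * U g x + U h x)"
      "\<And>g. g \<in> X \<Longrightarrow> U g \<in> L2" "\<And>g. g \<in> X \<Longrightarrow> nsq (U g) = nsq g"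
    and h: "h \<in> closed_span S" "S \<subseteq> X" "h \<in> X"
  shows "U h \<in> closed_span (U ` S)"
  unfolding closed_span_iff
proof (intro conjI allI impI)
  show "U h \<in> L2" using h(3) by (rule U)
  fix \<epsilon> :: real assume "\<epsilon> > 0"
  with h(1) obtain s where s: "s \<in> lin_span S" "nsq (\<lambda>x. h x - s x) < \<epsilon>"
    by (rule closed_spanE)
  have "s \<in> X \<and> U s \<in> lin_span (U ` S)"
    using s(1)
  proof (induction rule: lin_span_induct)
    case zero
    have "U (\<lambda>x. 0) = (\<lambda>x. 0)" using U(1)[OF X(2) X(2), of "-1"] by simp
    then show ?case using X(2) lin_span_zero by simp
  next
    case (add c g h)
    then have "g \<in> X" "U g \<in> U ` S" using h(2) by auto
    then show ?case
      using add by (auto simp: U(1) X(3) intro!: lin_span_add lin_span_cmult intro: lin_span_base)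
  qed
  then have "s \<in> X" "U s \<in> lin_span (U ` S)" by auto
  moreover have "nsq (\<lambda>x. U h x - U s x) = nsq (\<lambda>x. h x - s x)"
    using U(1)[OF \<open>s \<in> X\<close> h(3), of "-1"] U(3)[OF X(3)[OF \<open>s \<in> X\<close> h(3), of "-1"]] by simp
  ultimately show "\<exists>g\<in>lin_span (U ` S). nsq (\<lambda>x. U h x - g x) < \<epsilon>"
    using s(2) by (intro bexI[of _ "U s"]) simp_all
qed

lemma closed_span_ft:
  assumes "h \<in> closed_span S" "S \<subseteq> bcs" "h \<in> bcs"
  shows "ft h \<in> closed_span (ft ` S)"
proof (rule closed_span_isometry[of bcs])
  show "ft (\<lambda>x. c * g x + h x) = (\<lambda>x. c * ft g x + ft h x)" if "g \<in> bcs" "h \<in> bcs" for c g h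
    using that ft_add[of "\<lambda>x. c * g x" h] ft_cmult[of c g] by (simp add: integrable_bcs)
qed (use assms in \<open>auto simp: bcs_zero bcs_L2 ft_Plancherel intro!: bcs_add bcs_cmult\<close>)

text \<open>Reduces completeness of the wavelet system to the frequency side: spanning
  \<open>bcs\<close> there is enough, since transforms of \<open>bcs\<close> approximate
  \<open>bcs\<close>, which in turn is dense.\<close>

lemma closed_span_ft_eq_L2:
  assumes "S \<subseteq> bcs" "bcs \<subseteq> closed_span S"
  shows "closed_span (ft ` S) = L2"
proof (intro equalityI subsetI)
  fix f assume f: "f \<in> L2"
  have S: "ft ` S \<subseteq> L2" using assms(1) ft_Plancherel(1) by auto
  have "g \<in> closed_span (ft ` S)" if g: "g \<in> bcs" for g
  proof (rule closed_span_closed[OF S bcs_L2[OF g]])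
    fix \<epsilon> :: real assume "\<epsilon> > 0"
    with g obtain h where "h \<in> bcs" "nsq (\<lambda>x. g x - ft h x) < \<epsilon>" by (rule ft_dense_bcs)
    then show "\<exists>h\<in>closed_span (ft ` S). nsq (\<lambda>x. g x - h x) < \<epsilon>"
      using closed_span_ft[of h S] assms by blast
  qed
  then show "f \<in> closed_span (ft ` S)"
    using bcs_dense[OF f] by (intro closed_span_closed[OF S f]) metis
qed (rule closed_span_L2)

subsection \<open>Trigonometric polynomials\<close>

abbreviation trig :: "(real \<Rightarrow> complex) set" where
  "trig \<equiv> lin_span (range (\<lambda>(k::int) \<xi>. ee (of_int k * \<xi>)))"

lemma ee_in_trig: "(\<lambda>\<xi>. ee (of_int k * \<xi>)) \<in> trig"
  by (intro lin_span_base) auto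

lemma const_in_trig: "(\<lambda>\<xi>. c) \<in> trig"
  using lin_span_cmult[OF ee_in_trig[of 0], of c] by simp

lemma mult_in_trig: assumes "f \<in> trig" "g \<in> trig" shows "(\<lambda>\<xi>. f \<xi> * g \<xi>) \<in> trig"
  using assms(1)
proof (induction rule: lin_span_induct)
  case zero
  then show ?case using lin_span_zero by simp
next
  case (add c e h)
  then obtain k :: int where k: "e = (\<lambda>\<xi>. ee (of_int k * \<xi>))" by auto
  have "(\<lambda>\<xi>. ee (of_int k * \<xi>) * g \<xi>) \<in> trig"
    using assms(2)
  proof (induction rule: lin_span_induct)
    case zero
    then show ?case using lin_span_zero by simp
  next
    case (add c' e' h')
    then obtain l :: int where l: "e' = (\<lambda>\<xi>. ee (of_int l * \<xi>))" by auto
    have "(\<lambda>\<xi>. c' * ee (of_int (k + l) * \<xi>) + ee (of_int k * \<xi>) * h' \<xi>) \<in> trig"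
      using add by (intro lin_span_add lin_span_cmult ee_in_trig)
    then show ?case by (simp add: l ee_add algebra_simps)
  qed
  then have "(\<lambda>\<xi>. c * (ee (of_int k * \<xi>) * g \<xi>) + h \<xi> * g \<xi>) \<in> trig"
    using add by (intro lin_span_add lin_span_cmult)
  then show ?case by (simp add: k algebra_simps)
qed

lemma trig_periodic:
  assumes "p \<in> trig" shows "p (\<xi> + of_int k) = p \<xi>"
  using assms
proof (induction rule: lin_span_induct)
  case (add c e h)
  then obtain l :: int where l: "e = (\<lambda>\<xi>. ee (of_int l * \<xi>))" by auto
  have "ee (of_int l * (\<xi> + of_int k)) = ee (of_int l * \<xi>)"
    using ee_int[of "l * k"] by (simp add: ring_distribs ee_add)
  then show ?case using add l by simp
qed simp

lemma trig_measurable_bounded: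
  assumes "p \<in> trig" shows "p \<in> borel_measurable borel \<and> (\<exists>B. \<forall>x. cmod (p x) \<le> B)"
  using assms
proof (induction rule: lin_span_induct)
  case (add c e h)
  then obtain l :: int where l: "e = (\<lambda>\<xi>. ee (of_int l * \<xi>))" by auto
  obtain B where B: "\<And>x. cmod (h x) \<le> B" using add by auto
  have [measurable]: "h \<in> borel_measurable borel" using add by auto
  have "(\<lambda>x. c * e x + h x) \<in> borel_measurable borel" unfolding l by measurable
  moreover have "cmod (c * e x + h x) \<le> cmod c + B" for x
    using B[of x] by (intro norm_triangle_le) (simp add: l norm_mult)
  ultimately show ?case by blast
qed auto

text \<open>On the unit circle the real and imaginary parts of \<open>ee \<xi>\<close> are
  combinations of \<open>ee \<xi>\<close> and \<open>ee (- \<xi>)\<close>; hence real polynomials,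
  as delivered by Stone-Weierstrass, become trigonometric ones.\<close>

lemma real_polynomial_trig:
  fixes p :: "complex \<Rightarrow> real"
  assumes "real_polynomial_function p" shows "(\<lambda>\<xi>. of_real (p (ee \<xi>))) \<in> trig"
  using assms
proof (induction rule: real_polynomial_function.induct)
  case (linear f)
  then interpret bounded_linear f .
  have f: "f z = Re z * f 1 + Im z * f \<i>" for z
  proof -
    have "f z = f (Re z *\<^sub>R 1 + Im z *\<^sub>R \<i>)"
      by (rule arg_cong[where f = f]) (simp add: complex_eq_iff)
    then show ?thesis by (simp only: add scale real_scaleR_def)
  qed
  have ReIm: "of_real (Re z) = (z + cnj z) / 2" "of_real (Im z) = - \<i> / 2 * (z - cnj z)" for z
    by (auto simp: complex_eq_iff Re_divide Im_divide)
  have "complex_of_real (f (ee \<xi>)) = of_real (Re (ee \<xi>)) * of_real (f 1) + of_real (Im (ee \<xi>)) * of_real (f \<i>)" for \<xi>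
    by (subst f) simp
  then have "of_real (f (ee \<xi>)) =
    (f 1 / 2 - \<i> / 2 * f \<i>) * ee (of_int 1 * \<xi>) + (f 1 / 2 + \<i> / 2 * f \<i>) * ee (of_int (-1) * \<xi>)" for \<xi>
    unfolding ReIm by (simp add: cnj_ee algebra_simps add_divide_distrib)
  then show ?case
    by (simp only:) (intro lin_span_add lin_span_cmult ee_in_trig)
qed (auto intro: const_in_trig lin_span_add mult_in_trig)

lemma trig_uniform_approx:
  fixes F :: "complex \<Rightarrow> complex"
  assumes "continuous_on (sphere 0 1) F" "\<epsilon> > 0"
  obtains p where "p \<in> trig" "\<And>\<xi>. cmod (F (ee \<xi>) - p \<xi>) < \<epsilon>"
proof -
  have cR: "continuous_on (sphere 0 1) (\<lambda>z. Re (F z))" and cI: "continuous_on (sphere 0 1) (\<lambda>z. Im (F z))"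
    using assms(1) by (auto intro!: continuous_intros)
  obtain p where p: "real_polynomial_function p" "\<And>z. z \<in> sphere 0 1 \<Longrightarrow> \<bar>Re (F z) - p z\<bar> < \<epsilon> / 2"
    using Stone_Weierstrass_real_polynomial_function[OF compact_sphere cR, of "\<epsilon> / 2"] assms(2) by auto
  obtain q where q: "real_polynomial_function q" "\<And>z. z \<in> sphere 0 1 \<Longrightarrow> \<bar>Im (F z) - q z\<bar> < \<epsilon> / 2"
    using Stone_Weierstrass_real_polynomial_function[OF compact_sphere cI, of "\<epsilon> / 2"] assms(2) by auto
  show ?thesis
  proof (rule that)
    show "(\<lambda>\<xi>. of_real (p (ee \<xi>)) + \<i> * of_real (q (ee \<xi>))) \<in> trig"
      using p q by (intro lin_span_add lin_span_cmult real_polynomial_trig)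
    fix \<xi>
    have "ee \<xi> \<in> sphere 0 1" by simp
    then show "cmod (F (ee \<xi>) - (of_real (p (ee \<xi>)) + \<i> * of_real (q (ee \<xi>)))) < \<epsilon>"
      using p(2)[of "ee \<xi>"] q(2)[of "ee \<xi>"]
        cmod_le[of "F (ee \<xi>) - (of_real (p (ee \<xi>)) + \<i> * of_real (q (ee \<xi>)))"] by simp
  qed
qed

lemma ee_eq_imp:
  assumes "ee s = ee t" obtains k :: int where "s = t + of_int k"
proof -
  have "ee (s - t) = 1"
    using assms ee_add[of "s - t" t] by (auto simp: ee_def)
  then have "cos (2 * pi * (s - t)) = 1"
    by (simp add: ee_def complex_eq_iff)
  then obtain k :: int where "2 * pi * (s - t) = of_int k * (2 * pi)"
    by (auto simp: cos_one_2pi_int)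
  then have "(2 * pi) * (s - t) = (2 * pi) * of_int k" by (simp add: mult.commute)
  then have "s - t = of_int k" by (subst (asm) mult_cancel_left) simp
  then show ?thesis using that[of k] by simp
qed

lemma ee_image: "ee ` {a..a + 1} = sphere 0 1"
proof (intro equalityI subsetI)
  fix z :: complex assume "z \<in> sphere 0 1"
  then obtain \<theta> where "z = cis \<theta>"
    using rcis_cmod_Arg[of z] by (metis dist_0_norm mem_sphere rcis_def mult_1 of_real_1)
  then have z: "z = ee (\<theta> / (2 * pi))" by (simp add: ee_def)
  define k where "k = \<lfloor>\<theta> / (2 * pi) - a\<rfloor>"
  have "z = ee (\<theta> / (2 * pi) - of_int k)"
    using z ee_add[of "\<theta> / (2 * pi) - of_int k" "of_int k"] by simp
  moreover have "\<theta> / (2 * pi) - of_int k \<in> {a..a + 1}"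
    unfolding k_def by simp linarith
  ultimately show "z \<in> ee ` {a..a + 1}" by blast
qed auto

text \<open>Since \<open>h\<close> vanishes at both endpoints it factors through the circle. The
  factor \<open>F\<close> is continuous because \<open>ee\<close> maps the compact interval onto the
  circle as a quotient map.\<close>

lemma trig_approx_continuous:
  assumes h: "continuous_on UNIV h" "\<And>x. x \<notin> {a<..<a + 1} \<Longrightarrow> h x = 0" and "\<epsilon> > 0"
  obtains p where "p \<in> trig" "\<And>\<xi>. \<xi> \<in> {a..<a + 1} \<Longrightarrow> cmod (h \<xi> - p \<xi>) < \<epsilon>"
proof -
  define F where "F z = h (SOME \<xi>. \<xi> \<in> {a..a + 1} \<and> ee \<xi> = z)" for z
  have F: "F (ee \<xi>) = h \<xi>" if \<xi>: "\<xi> \<in> {a..a + 1}" for \<xi>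
  proof -
    define \<eta> where "\<eta> = (SOME \<eta>. \<eta> \<in> {a..a + 1} \<and> ee \<eta> = ee \<xi>)"
    have \<eta>: "\<eta> \<in> {a..a + 1}" "ee \<eta> = ee \<xi>"
      unfolding \<eta>_def using someI_ex[of "\<lambda>\<eta>. \<eta> \<in> {a..a + 1} \<and> ee \<eta> = ee \<xi>"] \<xi> by auto
    from \<eta>(2) obtain k :: int where k: "\<eta> = \<xi> + of_int k" by (rule ee_eq_imp)
    \<comment> \<open>The choice in \<open>F\<close> is ambiguous only where \<open>ee\<close>
      identifies the two endpoints, and \<open>h\<close> is 0 at both.\<close>
    have "h \<eta> = h \<xi>"
    proof (cases "k = 0")
      case False
      then have "1 \<le> \<bar>k\<bar>" by linarith
      then have "1 \<le> \<bar>of_int k :: real\<bar>" by (metis of_int_1_le_iff of_int_abs)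
      then have "\<eta> \<notin> {a<..<a + 1}" "\<xi> \<notin> {a<..<a + 1}"
        using \<eta>(1) \<xi> k by (auto simp: abs_if split: if_splits)
      then show ?thesis using h(2) by simp
    qed (use k in simp)
    then show ?thesis by (simp add: F_def \<eta>_def)
  qed
  have "continuous_on (sphere 0 1) F"
    unfolding continuous_on_open_invariant
  proof (intro allI impI)
    fix B :: "complex set" assume "open B"
    have "{a..a + 1} \<inter> ee -` (sphere 0 1 \<inter> F -` B) = {a..a + 1} \<inter> h -` B"
      using F by auto
    moreover have "openin (top_of_set {a..a + 1}) ({a..a + 1} \<inter> h -` B)"
      using continuous_on_subset[OF h(1)] \<open>open B\<close> by (intro continuous_openin_preimage_gen) auto
    ultimately have "openin (top_of_set (sphere 0 1)) (sphere 0 1 \<inter> F -` B)"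
      using Abstract_Topology_2.continuous_imp_quotient_map[OF continuous_ee ee_image[of a] compact_Icc,
          of "sphere 0 1 \<inter> F -` B"] by auto
    then show "\<exists>A. open A \<and> A \<inter> sphere 0 1 = F -` B \<inter> sphere 0 1"
      unfolding openin_open by (auto simp: Int_commute)
  qed
  then obtain p where "p \<in> trig" "\<And>\<xi>. cmod (F (ee \<xi>) - p \<xi>) < \<epsilon>"
    using assms(3) by (rule trig_uniform_approx) blast
  then show ?thesis using that[of p] F by (metis atLeastAtMost_iff atLeastLessThan_iff less_imp_le)
qed

text \<open>Approximates first in mean square by continuous functions supported in the open
  interval, so that they close up on the circle, and then uniformly by trigonometric polynomials.
  The lost endpoint \<open>a\<close> is a null set.\<close>

lemma trig_dense:
  assumes [measurable]: "m \<in> borel_measurable borel" and B: "\<And>x. cmod (m x) \<le> B" and "\<epsilon> > 0"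
  obtains p where "p \<in> trig" "(LINT \<xi>|lborel. indicator {a..<a + 1} \<xi> * (cmod (m \<xi> - p \<xi>))\<^sup>2) < \<epsilon>"
proof -
  define g where "g \<xi> = indicator {a<..<a + 1} \<xi> * m \<xi>" for \<xi>
  define B' where "B' = max 1 B"
  have B': "cmod (m x) \<le> B'" "B' > 0" for x using B[of x] by (auto simp: B'_def)
  have gB: "cmod (g x) \<le> B'" for x using B'(1)[of x] B'(2) by (auto simp: g_def indicator_def)
  have g0: "g x = 0" if "x \<notin> {a<..<a + 1}" for x using that by (simp add: g_def)
  have "g \<in> borel_measurable borel" unfolding g_def by measurable
  then have "g \<in> bcs"
    by (rule bcsI[where R = "\<bar>a\<bar> + 1", OF _ gB]) (rule g0, auto)
  from continuous_approx[OF this gB B'(2) g0] obtain h :: "nat \<Rightarrow> real \<Rightarrow> complex" where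
    h: "\<And>k. continuous_on UNIV (h k)" "\<And>k x. cmod (h k x) \<le> B'"
    "\<And>k x. x \<notin> {a<..<a + 1} \<Longrightarrow> h k x = 0" "AE x in lborel. (\<lambda>k. h k x) \<longlonglongrightarrow> g x"
    by blast
  have [measurable]: "h k \<in> borel_measurable borel" for k
    using h(1) by (rule borel_measurable_continuous_onI)
  let ?I = "indicator {a..<a + 1} :: real \<Rightarrow> real"
  have I: "integrable lborel (\<lambda>\<xi>. c * ?I \<xi>)" for c
    by (intro integrable_mult_right integrable_real_indicator) auto
  have mh: "(cmod (m \<xi> - h k \<xi>))\<^sup>2 \<le> (2 * B')\<^sup>2" for k \<xi>
    using norm_triangle_ineq4[of "m \<xi>" "h k \<xi>"] B'(1)[of \<xi>] h(2)[of k \<xi>] by (intro power_mono) auto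
  have "(\<lambda>k. LINT \<xi>|lborel. ?I \<xi> * (cmod (m \<xi> - h k \<xi>))\<^sup>2) \<longlonglongrightarrow> (LINT \<xi>|(lborel :: real measure). (0::real))"
  proof (rule integral_dominated_convergence)
    show "integrable lborel (\<lambda>\<xi>. (2 * B')\<^sup>2 * ?I \<xi>)" by (rule I)
    have "AE \<xi> in lborel. \<xi> \<noteq> a" by (rule AE_lborel_singleton)
    then show "AE \<xi> in lborel. (\<lambda>k. ?I \<xi> * (cmod (m \<xi> - h k \<xi>))\<^sup>2) \<longlonglongrightarrow> 0"
      using h(4)
    proof eventually_elim
      case (elim \<xi>)
      show ?case
      proof (cases "\<xi> \<in> {a..<a + 1}")
        case True
        then have "g \<xi> = m \<xi>" using elim(1) by (simp add: g_def)
        then have "(\<lambda>k. (cmod (m \<xi> - h k \<xi>))\<^sup>2) \<longlonglongrightarrow> (cmod (m \<xi> - m \<xi>))\<^sup>2"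
          using elim(2) by (intro tendsto_intros) simp
        then show ?thesis using True by simp
      qed simp
    qed
    show "AE \<xi> in lborel. norm (?I \<xi> * (cmod (m \<xi> - h k \<xi>))\<^sup>2) \<le> (2 * B')\<^sup>2 * ?I \<xi>" for k
      using mh by (auto simp: indicator_def)
  qed measurable
  then have "(\<lambda>k. LINT \<xi>|lborel. ?I \<xi> * (cmod (m \<xi> - h k \<xi>))\<^sup>2) \<longlonglongrightarrow> 0" by simp
  then have "\<forall>\<^sub>F k in sequentially. (LINT \<xi>|lborel. ?I \<xi> * (cmod (m \<xi> - h k \<xi>))\<^sup>2) < \<epsilon> / 4"
    using assms(3) by (intro order_tendstoD(2)) auto
  then obtain k where k: "(LINT \<xi>|lborel. ?I \<xi> * (cmod (m \<xi> - h k \<xi>))\<^sup>2) < \<epsilon> / 4"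
    by (auto simp: eventually_sequentially)
  \<comment> \<open>The squared uniform error is at most a quarter of \<epsilon>; doubling both
    quarters gives the total \<epsilon>.\<close>
  obtain p where p: "p \<in> trig" "\<And>\<xi>. \<xi> \<in> {a..<a + 1} \<Longrightarrow> cmod (h k \<xi> - p \<xi>) < sqrt (\<epsilon> / 4)"
    using trig_approx_continuous[OF h(1,3), where \<epsilon> = "sqrt (\<epsilon> / 4)"] assms(3) by auto
  have [measurable]: "p \<in> borel_measurable borel" using trig_measurable_bounded[OF p(1)] by auto
  have Imh: "integrable lborel (\<lambda>\<xi>. ?I \<xi> * (cmod (m \<xi> - h k \<xi>))\<^sup>2)"
    by (rule Bochner_Integration.integrable_bound[OF I[of "(2 * B')\<^sup>2"]])
      (use mh in \<open>auto simp: indicator_def\<close>)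
  have le: "?I \<xi> * (cmod (m \<xi> - p \<xi>))\<^sup>2 \<le> 2 * (?I \<xi> * (cmod (m \<xi> - h k \<xi>))\<^sup>2) + \<epsilon> / 2 * ?I \<xi>" for \<xi>
  proof (cases "\<xi> \<in> {a..<a + 1}")
    case True
    have "(cmod (h k \<xi> - p \<xi>))\<^sup>2 \<le> (sqrt (\<epsilon> / 4))\<^sup>2"
      using p(2)[OF True] by (intro power_mono) auto
    then have "(cmod (h k \<xi> - p \<xi>))\<^sup>2 \<le> \<epsilon> / 4" using assms(3) by simp
    then show ?thesis
      using norm_add_sq_le[of "m \<xi> - h k \<xi>" "h k \<xi> - p \<xi>"] True by simp
  qed simp
  have "(LINT \<xi>|lborel. ?I \<xi> * (cmod (m \<xi> - p \<xi>))\<^sup>2) \<le>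
    (LINT \<xi>|lborel. 2 * (?I \<xi> * (cmod (m \<xi> - h k \<xi>))\<^sup>2) + \<epsilon> / 2 * ?I \<xi>)"
  proof (rule integral_mono)
    show R: "integrable lborel (\<lambda>\<xi>. 2 * (?I \<xi> * (cmod (m \<xi> - h k \<xi>))\<^sup>2) + \<epsilon> / 2 * ?I \<xi>)"
      using Imh I[of 1] by (intro Bochner_Integration.integrable_add integrable_mult_right) simp_all
    show "integrable lborel (\<lambda>\<xi>. ?I \<xi> * (cmod (m \<xi> - p \<xi>))\<^sup>2)"
      by (rule Bochner_Integration.integrable_bound[OF R])
        (use le in \<open>auto intro!: AE_I2 order_trans[OF _ abs_ge_self]\<close>)
  qed (rule le)
  also have "\<dots> = 2 * (LINT \<xi>|lborel. ?I \<xi> * (cmod (m \<xi> - h k \<xi>))\<^sup>2) + \<epsilon> / 2"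
    using Imh I[of 1] by simp
  also have "\<dots> < \<epsilon>" using k by simp
  finally show ?thesis using that p(1) by blast
qed

lemma orthonormal_ee:
  "(LINT \<xi>|lborel. indicator {a..<a + 1} \<xi> *\<^sub>R ee (of_int k * \<xi>)) = (if k = 0 then 1 else 0)"
proof (cases "k = 0")
  case True
  then show ?thesis by simp
next
  case False
  define F where "F \<xi> = ee (of_int k * \<xi>) / (2 * pi * \<i> * of_int k)" for \<xi>
  have "(LINT \<xi>|lborel. indicator {a..<a + 1} \<xi> *\<^sub>R ee (of_int k * \<xi>)) =
    (LINT \<xi>|lborel. indicator {a..a + 1} \<xi> *\<^sub>R ee (of_int k * \<xi>))"
  proof (rule integral_cong_AE)
    have "AE \<xi> in lborel. \<xi> \<noteq> a + 1" by (rule AE_lborel_singleton)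
    then show "AE \<xi> in lborel. indicator {a..<a + 1} \<xi> *\<^sub>R ee (of_int k * \<xi>) =
      indicator {a..a + 1} \<xi> *\<^sub>R ee (of_int k * \<xi>)"
      by eventually_elim (auto simp: indicator_def)
  qed auto
  also have "\<dots> = F (a + 1) - F a"
  proof (rule integral_FTC_Icc)
    show "(F has_vector_derivative ee (of_int k * x)) (at x within {a..a + 1})" for x
      unfolding F_def ee_def cis_conv_exp using False
      by (auto intro!: derivative_eq_intros has_vector_derivative_real_field simp: field_simps)
    show "continuous_on {a..a + 1} (\<lambda>\<xi>. ee (of_int k * \<xi>))"
      by (intro continuous_on_compose2[OF continuous_ee] continuous_intros) auto
  qed simp
  also have "\<dots> = 0"
    using ee_add[of "of_int k * a" "of_int k"] by (simp add: F_def ring_distribs)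
  finally show ?thesis using False by simp
qed

subsection \<open>Dilations and translations\<close>

context
  fixes d :: nat
  assumes d: "d > 0"
begin

lemma D_pow_powr_mult: "(real d powr (of_int n / 2)) * (real d powr (of_int n / 2)) = real d powi n"
  using d by (simp flip: powr_add add: powr_real_of_int')

lemma LINT_dilate:
  fixes f :: "real \<Rightarrow> 'a :: {banach, second_countable_topology}"
  shows "(LINT x|lborel. f (real d powi n * x)) = inverse (real d powi n) *\<^sub>R (LINT x|lborel. f x)"
  using d lborel_integral_real_affine[of "real d powi n" f 0] by simp

lemma D_pow_inner: "L2_inner (D_pow d n f) (D_pow d n g) = L2_inner f g"
proof -
  have "D_pow d n f x * cnj (D_pow d n g x) =
    of_real ((real d powr (of_int n / 2)) * (real d powr (of_int n / 2))) *
      (f (real d powi n * x) * cnj (g (real d powi n * x)))" for x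
    by (simp add: D_pow_def mult_ac)
  note this[unfolded D_pow_powr_mult]
  then show ?thesis
    using d by (simp add: L2_inner_def LINT_dilate[of "\<lambda>x. f x * cnj (g x)" n] scaleR_conv_of_real)
qed

lemma D_pow_nsq: "nsq (D_pow d n f) = nsq f"
  using D_pow_inner[of n f f] by (simp add: L2_inner_self)

lemma D_pow_L2: assumes "f \<in> L2" shows "D_pow d n f \<in> L2"
proof (rule L2I)
  note [measurable] = L2_measurable[OF assms]
  show "D_pow d n f \<in> borel_measurable borel" unfolding D_pow_def by measurable
  show "integrable lborel (\<lambda>x. (cmod (D_pow d n f x))\<^sup>2)"
    using lborel_integrable_real_affine[OF L2_integrable[OF assms], of "real d powi n" 0] d
    by (simp add: D_pow_def norm_mult power_mult_distrib)
qed

lemma D_pow_bcs: "f \<in> bcs \<Longrightarrow> D_pow d n f \<in> bcs"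
  unfolding D_pow_def using bcs_affine[of f "real d powi n" 0] d by (auto intro!: bcs_cmult)

lemma D_pow_inverse: "D_pow d n (D_pow d (- n) f) = f"
  using D_pow_add[of d n "- n" f] D_pow_0[of d f] d by simp

lemma D_pow_linear: "D_pow d n (\<lambda>x. c * g x + h x) = (\<lambda>x. c * D_pow d n g x + D_pow d n h x)"
  by (simp add: D_pow_def algebra_simps)

lemma closed_span_D_pow:
  assumes "h \<in> closed_span S" "S \<subseteq> L2" shows "D_pow d n h \<in> closed_span (D_pow d n ` S)"
  by (rule closed_span_isometry[of L2])
    (use assms closed_span_L2 in \<open>auto simp: D_pow_L2 D_pow_nsq D_pow_linear intro!: L2_add L2_cmult\<close>)

lemma D_pow_ft: "D_pow d n (ft g) = ft (D_pow d (- n) g)"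
proof
  fix x
  have "ft (D_pow d (- n) g) x =
    of_real (real d powr (- of_int n / 2)) * (LINT \<xi>|lborel. g (real d powi (- n) * \<xi>) * ee (x * \<xi>))"
    by (simp add: ft_def D_pow_def mult.assoc)
  also have "(LINT \<xi>|lborel. g (real d powi (- n) * \<xi>) * ee (x * \<xi>)) =
    (LINT \<xi>|lborel. g (real d powi (- n) * \<xi>) * ee (x * real d powi n * (real d powi (- n) * \<xi>)))"
  proof -
    have "x * real d powi n * (real d powi (- n) * \<xi>) = x * \<xi>" for \<xi>
      using d by (simp add: power_int_minus)
    then show ?thesis by (simp only:)
  qed
  also have "\<dots> = (real d powi n) *\<^sub>R (LINT \<xi>|lborel. g \<xi> * ee (x * real d powi n * \<xi>))"
    by (subst LINT_dilate[of _ "- n"]) (simp add: power_int_minus)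
  also have "of_real (real d powr (- of_int n / 2)) * \<dots> =
      of_real (real d powr (- of_int n / 2) * real d powi n) * ft g (real d powi n * x)"
    by (simp add: ft_def scaleR_conv_of_real mult_ac)
  also have "real d powr (- of_int n / 2) * real d powi n = real d powr (of_int n / 2)"
    unfolding D_pow_powr_mult[symmetric] using d by (simp flip: powr_add mult.assoc)
  finally show "D_pow d n (ft g) x = ft (D_pow d (- n) g) x" by (simp add: D_pow_def)
qed

end

lemma ft_translate: "ft g (x - s) = ft (\<lambda>\<xi>. ee (- (s * \<xi>)) * g \<xi>) x"
  unfolding ft_def
proof (intro Bochner_Integration.integral_cong refl)
  fix \<xi>
  show "g \<xi> * ee ((x - s) * \<xi>) = ee (- (s * \<xi>)) * g \<xi> * ee (x * \<xi>)"
    using ee_add[of "- (s * \<xi>)" "x * \<xi>"] by (simp add: algebra_simps)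
qed

lemma T_pow_L2: assumes "f \<in> L2" shows "T_pow l f \<in> L2"
proof (rule L2I)
  note [measurable] = L2_measurable[OF assms]
  show "T_pow l f \<in> borel_measurable borel" unfolding T_pow_def by measurable
  show "integrable lborel (\<lambda>x. (cmod (T_pow l f x))\<^sup>2)"
    using lborel_integrable_real_affine[OF L2_integrable[OF assms], of 1 "- of_int l"]
    by (simp add: T_pow_def)
qed

lemma T_pow_inner: "L2_inner (T_pow l f) g = L2_inner f (T_pow (- l) g)"
  unfolding L2_inner_def T_pow_def
  by (subst lborel_integral_real_affine[of 1 _ "of_int l"]) (auto simp: add.commute)

subsection \<open>The wavelet\<close>

locale band_wavelet =
  fixes d n :: nat
  assumes d2: "d \<ge> 2" and n1: "n \<ge> 1"
begin

section \<open>Parameters and the frequency profile\<close>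

definition "N = real d ^ n"
definition "M = real d * N"
definition "v = N / (real d * M - 1)"
definition "u = (real d - 1) * v"
definition "a = real d * u"
definition "b = u / real d"
definition "y = 1 - a"

text \<open>In terms of the pieces below, the nonzero branches are \<open>IA\<close>,
  \<open>IC\<close>, \<open>IE\<close>, then \<open>IC + N\<close>, \<open>ID + N\<close> and
  \<open>IA + M\<close>.\<close>

definition g0 :: "real \<Rightarrow> complex" where
  "g0 \<xi> = (if -a \<le> \<xi> \<and> \<xi> < -u then 1 / sqrt 2
    else if -u \<le> \<xi> \<and> \<xi> < -b then - 1 / sqrt 2
    else if v \<le> \<xi> \<and> \<xi> < y then 1
    else if N - u \<le> \<xi> \<and> \<xi> < N - b then 1 / sqrt 2
    else if N - b \<le> \<xi> \<and> \<xi> < N + v then 1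
    else if M - a \<le> \<xi> \<and> \<xi> < M - u then 1 / sqrt 2
    else 0)"

text \<open>Four consecutive pieces of \<open>[-a, 1 - a)\<close>, a fundamental domain of the
  integer translations. Since \<open>a = d * u\<close> and \<open>u = d * b\<close>, dilating
  \<open>IC\<close> by \<open>d\<close> gives \<open>IA\<close>.\<close>

definition "IA = {-a..<-u}"
definition "IC = {-u..<-b}"
definition "ID = {-b..<v}"
definition "IE = {v..<y}"

lemma d_gt: "real d \<ge> 2" "d > 0"
  using d2 by auto

text \<open>The decisive bound is \<open>v + a < 1\<close>: multiplied by \<open>d * M - 1\<close>
  it reads \<open>(d - 1) * N > 1\<close>. It makes \<open>IE\<close> nonempty and, with
  \<open>N \<ge> 2\<close> and \<open>M \<ge> 2 * N\<close>, separates all the pieces. The last two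
  equations are the ones that determine \<open>u\<close> and \<open>v\<close>.\<close>

lemma params:
  "N \<ge> real d" "N \<ge> 2" "0 < v" "0 < b" "b < u" "u < a" "a < 1" "v < y" "y < real d * v"
  "real d * v < N - u" "N + v < M - a" "2 * N \<le> M" "M * y = N - u" "M * (real d * v) = N + v"
proof -
  have "real d ^ 1 \<le> real d ^ n" using d2 n1 by (intro power_increasing) auto
  then show Nd: "N \<ge> real d" by (simp add: N_def)
  then show N2: "N \<ge> 2" using d_gt by simp
  have MN: "M \<ge> 2 * N" using d_gt N2 by (simp add: M_def mult_right_mono)
  then show "2 * N \<le> M" .
  have dM: "real d * M \<ge> 2 * M" using d_gt(1) MN N2 by (intro mult_right_mono) linarith+
  define K where "K = real d * M - 1"
  have K: "K > 0" "K = real d * M - 1" using dM MN N2 unfolding K_def by linarith+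
  have vK: "v * K = N" using K by (simp add: v_def K_def)
  show v: "0 < v" using K N2 by (simp add: v_def K_def)
  have u: "u \<ge> v" using d_gt v by (simp add: u_def)
  then have u0: "u > 0" using v by simp
  then show "0 < b" using d_gt by (simp add: b_def)
  show "b < u" using d_gt u0 by (simp add: b_def divide_less_eq)
  show ua: "u < a" using d_gt u0 by (simp add: a_def)
  have uK: "u * K = (real d - 1) * N" using vK by (simp add: u_def mult.assoc)
  have aK: "a * K = real d * ((real d - 1) * N)" using uK by (simp add: a_def mult.assoc)
  have dN: "N \<le> (real d - 1) * N" using d_gt N2 by simp
  have "(v + a) * K < K"
  proof -
    have "(v + a) * K = N + real d * (real d * N) - real d * N"
      using vK aK by (simp add: algebra_simps)
    also have "\<dots> = K + 1 - (real d - 1) * N" by (simp add: K_def M_def algebra_simps)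
    also have "\<dots> < K" using dN N2 by linarith
    finally show ?thesis .
  qed
  then have va: "v + a < 1" using K by simp
  then show "a < 1" "v < y" using v by (auto simp: y_def)
  have yK: "M * y = N - u" "M * (real d * v) = N + v"
  proof -
    have "(M * y) * K = M * K - M * (a * K)" by (simp add: y_def algebra_simps)
    also have "\<dots> = M * K - (K + 1) * ((real d - 1) * N)"
      unfolding aK by (simp add: K_def)
    also have "\<dots> = (N - u) * K" using uK by (simp add: M_def algebra_simps)
    finally have "(M * y) * K = (N - u) * K" .
    then show "M * y = N - u" using K by simp
    have "(M * (real d * v)) * K = (N + v) * K" using vK by (simp add: K_def algebra_simps)
    then show "M * (real d * v) = N + v" using K by simp
  qed
  then show "M * y = N - u" "M * (real d * v) = N + v" by auto
  have M: "M > 0" using MN N2 by simp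
  have "M * y < M * (real d * v)" using yK u0 v by simp
  then show "y < real d * v" using M by simp
  have "real d * v = a / real d + v" if "d > 0"
    using that by (simp add: a_def u_def field_simps)
  then have "real d * v = u + v" using d_gt by (simp add: a_def)
  then show "real d * v < N - u" using va ua N2 v by linarith
  show "N + v < M - a" using va MN N2 by linarith
qed

lemma scale: "a = real d * u" "u = real d * b" "M = real d * N"
  using d_gt by (auto simp: a_def b_def M_def)

lemma g0_measurable [measurable]: "g0 \<in> borel_measurable borel"
  unfolding g0_def[abs_def] by measurable

lemma intervals:
  obtains "\<xi> < - a" | "- a \<le> \<xi>" "\<xi> < - u" | "- u \<le> \<xi>" "\<xi> < - b" | "- b \<le> \<xi>" "\<xi> < v"
    | "v \<le> \<xi>" "\<xi> < y" | "y \<le> \<xi>" "\<xi> < N - u" | "N - u \<le> \<xi>" "\<xi> < N - b"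
    | "N - b \<le> \<xi>" "\<xi> < N + v" | "N + v \<le> \<xi>" "\<xi> < M - a" | "M - a \<le> \<xi>" "\<xi> < M - u" | "M - u \<le> \<xi>"
  by linarith

text \<open>Records the truth value of every breakpoint comparison in each region, so that a case
  split evaluates \<open>g0\<close> and all indicators with no further arithmetic.\<close>

lemma regions:
  obtains
      "\<not> - a \<le> \<xi>" "\<not> - u \<le> \<xi>" "\<not> - b \<le> \<xi>" "\<not> v \<le> \<xi>" "\<not> y \<le> \<xi>"
      "\<not> N - u \<le> \<xi>" "\<not> N - b \<le> \<xi>" "\<not> N + v \<le> \<xi>" "\<not> M - a \<le> \<xi>" "\<not> M - u \<le> \<xi>"
    | "- a \<le> \<xi>" "\<not> - u \<le> \<xi>" "\<not> - b \<le> \<xi>" "\<not> v \<le> \<xi>" "\<not> y \<le> \<xi>"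
      "\<not> N - u \<le> \<xi>" "\<not> N - b \<le> \<xi>" "\<not> N + v \<le> \<xi>" "\<not> M - a \<le> \<xi>" "\<not> M - u \<le> \<xi>"
    | "- a \<le> \<xi>" "- u \<le> \<xi>" "\<not> - b \<le> \<xi>" "\<not> v \<le> \<xi>" "\<not> y \<le> \<xi>"
      "\<not> N - u \<le> \<xi>" "\<not> N - b \<le> \<xi>" "\<not> N + v \<le> \<xi>" "\<not> M - a \<le> \<xi>" "\<not> M - u \<le> \<xi>"
    | "- a \<le> \<xi>" "- u \<le> \<xi>" "- b \<le> \<xi>" "\<not> v \<le> \<xi>" "\<not> y \<le> \<xi>"
      "\<not> N - u \<le> \<xi>" "\<not> N - b \<le> \<xi>" "\<not> N + v \<le> \<xi>" "\<not> M - a \<le> \<xi>" "\<not> M - u \<le> \<xi>"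
    | "- a \<le> \<xi>" "- u \<le> \<xi>" "- b \<le> \<xi>" "v \<le> \<xi>" "\<not> y \<le> \<xi>"
      "\<not> N - u \<le> \<xi>" "\<not> N - b \<le> \<xi>" "\<not> N + v \<le> \<xi>" "\<not> M - a \<le> \<xi>" "\<not> M - u \<le> \<xi>"
    | "- a \<le> \<xi>" "- u \<le> \<xi>" "- b \<le> \<xi>" "v \<le> \<xi>" "y \<le> \<xi>"
      "\<not> N - u \<le> \<xi>" "\<not> N - b \<le> \<xi>" "\<not> N + v \<le> \<xi>" "\<not> M - a \<le> \<xi>" "\<not> M - u \<le> \<xi>"
    | "- a \<le> \<xi>" "- u \<le> \<xi>" "- b \<le> \<xi>" "v \<le> \<xi>" "y \<le> \<xi>"
      "N - u \<le> \<xi>" "\<not> N - b \<le> \<xi>" "\<not> N + v \<le> \<xi>" "\<not> M - a \<le> \<xi>" "\<not> M - u \<le> \<xi>"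
    | "- a \<le> \<xi>" "- u \<le> \<xi>" "- b \<le> \<xi>" "v \<le> \<xi>" "y \<le> \<xi>"
      "N - u \<le> \<xi>" "N - b \<le> \<xi>" "\<not> N + v \<le> \<xi>" "\<not> M - a \<le> \<xi>" "\<not> M - u \<le> \<xi>"
    | "- a \<le> \<xi>" "- u \<le> \<xi>" "- b \<le> \<xi>" "v \<le> \<xi>" "y \<le> \<xi>"
      "N - u \<le> \<xi>" "N - b \<le> \<xi>" "N + v \<le> \<xi>" "\<not> M - a \<le> \<xi>" "\<not> M - u \<le> \<xi>"
    | "- a \<le> \<xi>" "- u \<le> \<xi>" "- b \<le> \<xi>" "v \<le> \<xi>" "y \<le> \<xi>"
      "N - u \<le> \<xi>" "N - b \<le> \<xi>" "N + v \<le> \<xi>" "M - a \<le> \<xi>" "\<not> M - u \<le> \<xi>"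
    | "- a \<le> \<xi>" "- u \<le> \<xi>" "- b \<le> \<xi>" "v \<le> \<xi>" "y \<le> \<xi>"
      "N - u \<le> \<xi>" "N - b \<le> \<xi>" "N + v \<le> \<xi>" "M - a \<le> \<xi>" "M - u \<le> \<xi>"
proof -
  show ?thesis
  proof (cases rule: intervals[of \<xi>])
    case 1
    then show ?thesis by (intro that(1)) (use params(2-12) in linarith)+
  next
    case 2
    then show ?thesis by (intro that(2)) (use params(2-12) in linarith)+
  next
    case 3
    then show ?thesis by (intro that(3)) (use params(2-12) in linarith)+
  next
    case 4
    then show ?thesis by (intro that(4)) (use params(2-12) in linarith)+
  next
    case 5
    then show ?thesis by (intro that(5)) (use params(2-12) in linarith)+
  next
    case 6
    then show ?thesis by (intro that(6)) (use params(2-12) in linarith)+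
  next
    case 7
    then show ?thesis by (intro that(7)) (use params(2-12) in linarith)+
  next
    case 8
    then show ?thesis by (intro that(8)) (use params(2-12) in linarith)+
  next
    case 9
    then show ?thesis by (intro that(9)) (use params(2-12) in linarith)+
  next
    case 10
    then show ?thesis by (intro that(10)) (use params(2-12) in linarith)+
  next
    case 11
    then show ?thesis by (intro that(11)) (use params(2-12) in linarith)+
  qed
qed

lemma g0_bcs: "g0 \<in> bcs"
proof (rule bcsI[where B = 1 and R = M])
  show "g0 x = 0" if "M < \<bar>x\<bar>" for x
  proof -
    have "g0 x = 0 \<or> (- a \<le> x \<and> \<not> M - u \<le> x)"
      by (rule regions[of x]) (simp_all add: g0_def not_le[symmetric, of _ x])
    then show ?thesis using that params(2-12) by linarith
  qed
qed (auto simp: g0_def norm_divide)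

lemma g0_vals:
  "\<xi> < - a \<Longrightarrow> g0 \<xi> = 0"
  "- a \<le> \<xi> \<Longrightarrow> \<xi> < - u \<Longrightarrow> g0 \<xi> = 1 / sqrt 2"
  "- u \<le> \<xi> \<Longrightarrow> \<xi> < - b \<Longrightarrow> g0 \<xi> = - 1 / sqrt 2"
  "- b \<le> \<xi> \<Longrightarrow> \<xi> < v \<Longrightarrow> g0 \<xi> = 0"
  "v \<le> \<xi> \<Longrightarrow> \<xi> < y \<Longrightarrow> g0 \<xi> = 1"
  "y \<le> \<xi> \<Longrightarrow> \<xi> < N - u \<Longrightarrow> g0 \<xi> = 0"
  "N - u \<le> \<xi> \<Longrightarrow> \<xi> < N - b \<Longrightarrow> g0 \<xi> = 1 / sqrt 2"
  "N - b \<le> \<xi> \<Longrightarrow> \<xi> < N + v \<Longrightarrow> g0 \<xi> = 1"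
  "N + v \<le> \<xi> \<Longrightarrow> \<xi> < M - a \<Longrightarrow> g0 \<xi> = 0"
  "M - a \<le> \<xi> \<Longrightarrow> \<xi> < M - u \<Longrightarrow> g0 \<xi> = 1 / sqrt 2"
  "M - u \<le> \<xi> \<Longrightarrow> g0 \<xi> = 0"
  by (rule regions[of \<xi>]; simp add: g0_def not_le[symmetric, of _ \<xi>])+

section \<open>Orthonormality: the squared profile and the overlaps of dilates\<close>

lemma shift_le: "- t \<le> x - s \<longleftrightarrow> s - t \<le> x" "v \<le> x - N \<longleftrightarrow> N + v \<le> x" for s t x :: real
  by linarith+

text \<open>Groups the squared profile by the shift 0, \<open>N\<close> or \<open>M\<close> that
  brings each piece into \<open>[-a, 1 - a)\<close>. There the weights add up to 1: two halves on
  \<open>IA\<close> and on \<open>IC\<close>, one whole on \<open>ID\<close> and on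
  \<open>IE\<close>.\<close>

lemma norm_g0:
  "(cmod (g0 \<xi>))\<^sup>2 = (indicator IA \<xi> / 2 + indicator IC \<xi> / 2 + indicator IE \<xi>) +
    (indicator IC (\<xi> - N) / 2 + indicator ID (\<xi> - N)) + indicator IA (\<xi> - M) / 2"
  by (rule regions[of \<xi>])
    (simp_all add: g0_def IA_def IC_def ID_def IE_def indicator_def norm_divide power_divide shift_le
      not_le[symmetric, of _ \<xi>] not_le[symmetric, of _ "\<xi> - N"] not_le[symmetric, of _ "\<xi> - M"])

lemma sum_indicators:
  "indicator IA \<xi> + indicator IC \<xi> + indicator ID \<xi> + indicator IE \<xi> = (indicator {-a..<-a + 1} \<xi> :: real)"
  by (rule regions[of \<xi>])
    (simp_all add: IA_def IC_def ID_def IE_def indicator_def y_def not_le[symmetric, of _ \<xi>])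

lemma sets_I [measurable]: "IA \<in> sets borel" "IC \<in> sets borel" "ID \<in> sets borel" "IE \<in> sets borel"
  by (auto simp: IA_def IC_def ID_def IE_def)

text \<open>Folds the integral back into \<open>[-a, 1 - a)\<close>. For \<open>F\<close> invariant
  under shifts by \<open>N\<close> and \<open>M\<close> the result is the plain integral of
  \<open>F\<close> over that period.\<close>

lemma LINT_norm_g0:
  fixes F :: "real \<Rightarrow> 'b :: {banach, second_countable_topology}"
  assumes [measurable]: "F \<in> borel_measurable borel" and B: "\<And>x. norm (F x) \<le> B"
  shows "(LINT \<xi>|lborel. (cmod (g0 \<xi>))\<^sup>2 *\<^sub>R F \<xi>) = (LINT \<xi>|lborel.
    (indicator IA \<xi> / 2 + indicator IC \<xi> / 2 + indicator IE \<xi>) *\<^sub>R F \<xi> +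
    (indicator IC \<xi> / 2 + indicator ID \<xi>) *\<^sub>R F (\<xi> + N) + (indicator IA \<xi> / 2) *\<^sub>R F (\<xi> + M))"
proof -
  have int: "integrable lborel (\<lambda>\<xi>. P \<xi> *\<^sub>R F (s + 1 * \<xi>))"
    if [measurable]: "P \<in> borel_measurable borel" and P: "\<And>x. \<bar>P x\<bar> \<le> 3" "\<And>x. x \<notin> {-1..1} \<Longrightarrow> P x = 0"
    for P :: "real \<Rightarrow> real" and s
  proof (rule integrable_bounded_support[where B = "3 * B" and R = 1])
    show "norm (P x *\<^sub>R F (s + 1 * x)) \<le> 3 * B" for x
      using P(1)[of x] B[of "s + 1 * x"] by (auto intro!: mult_mono)
    show "P x *\<^sub>R F (s + 1 * x) = 0" if "1 < \<bar>x\<bar>" for x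
      using P(2)[of x] that by (auto simp: abs_if split: if_splits)
  qed simp
  define P1 :: "real \<Rightarrow> real" where "P1 \<xi> = indicator IA \<xi> / 2 + indicator IC \<xi> / 2 + indicator IE \<xi>" for \<xi>
  define P2 :: "real \<Rightarrow> real" where "P2 \<xi> = indicator IC \<xi> / 2 + indicator ID \<xi>" for \<xi>
  define P3 :: "real \<Rightarrow> real" where "P3 \<xi> = indicator IA \<xi> / 2" for \<xi>
  have i1: "integrable lborel (\<lambda>\<xi>. P1 \<xi> *\<^sub>R F (0 + 1 * \<xi>))"
    using params by (intro int) (auto simp: P1_def[abs_def] IA_def IC_def IE_def y_def indicator_def)
  have i2: "integrable lborel (\<lambda>\<xi>. P2 \<xi> *\<^sub>R F (N + 1 * \<xi>))"
    using params by (intro int) (auto simp: P2_def[abs_def] IC_def ID_def y_def indicator_def)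
  have i3: "integrable lborel (\<lambda>\<xi>. P3 \<xi> *\<^sub>R F (M + 1 * \<xi>))"
    using params by (intro int) (auto simp: P3_def[abs_def] IA_def indicator_def)
  have sh: "integrable lborel (\<lambda>\<xi>. P (\<xi> - s) *\<^sub>R F \<xi>)"
    "(LINT \<xi>|lborel. P (\<xi> - s) *\<^sub>R F \<xi>) = (LINT \<xi>|lborel. P \<xi> *\<^sub>R F (s + 1 * \<xi>))"
    if "integrable lborel (\<lambda>\<xi>. P \<xi> *\<^sub>R F (s + 1 * \<xi>))" for P :: "real \<Rightarrow> real" and s
    using lborel_integrable_real_affine[OF that, of 1 "-s"]
      lborel_integral_real_affine[of 1 "\<lambda>\<xi>. P \<xi> *\<^sub>R F (s + 1 * \<xi>)" "-s"] by simp_all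
  have "(LINT \<xi>|lborel. (cmod (g0 \<xi>))\<^sup>2 *\<^sub>R F \<xi>) =
    (LINT \<xi>|lborel. P1 \<xi> *\<^sub>R F \<xi> + P2 (\<xi> - N) *\<^sub>R F \<xi> + P3 (\<xi> - M) *\<^sub>R F \<xi>)"
    by (simp add: norm_g0 P1_def P2_def P3_def scaleR_add_left add.assoc)
  also have "\<dots> = (LINT \<xi>|lborel. P1 \<xi> *\<^sub>R F \<xi> + P2 \<xi> *\<^sub>R F (\<xi> + N) + P3 \<xi> *\<^sub>R F (\<xi> + M))"
    using i1 i2 i3 sh[OF i2] sh[OF i3] by (simp add: add.commute)
  finally show ?thesis by (simp add: P1_def P2_def P3_def)
qed

text \<open>Only two pieces of the support are sent into the support by one dilation:
  \<open>IC\<close> onto \<open>IA\<close>, where the signs differ, and \<open>IC + N\<close> onto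
  \<open>IA + M\<close>, where they agree.\<close>

lemma cross1: "g0 (real d * \<eta>) * cnj (g0 \<eta>) =
  of_real ((indicator IA (real d * \<eta> - M) - indicator IA (real d * \<eta>)) / 2)"
proof -
  define z where "z = real d * \<eta>"
  have le: "t \<le> \<eta> \<longleftrightarrow> real d * t \<le> z" "\<eta> < t \<longleftrightarrow> z < real d * t" for t
    using d_gt by (auto simp: z_def)
  have dd: "2 * a \<le> real d * a" "2 * (M - a) \<le> real d * (M - a)" "2 * (M - u) \<le> real d * (M - u)"
    using params(2-12) d_gt(1) by (intro mult_right_mono; linarith)+
  \<comment> \<open>Because \<open>N * (d * y) = N - u\<close> with \<open>N \<ge> 1\<close>, one
    dilation of \<open>IE\<close> ends before \<open>N - u\<close>; it starts at
    \<open>d * v > y\<close>, so it lies in a gap of the support.\<close>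
  have dy: "real d * y \<le> N - u"
  proof -
    have "real d * y * N = N - u" using params(13) by (simp add: M_def mult_ac)
    moreover have "real d * y * 1 \<le> real d * y * N" using params by (intro mult_left_mono) auto
    ultimately show ?thesis by simp
  qed
  have sc: "real d * (- a) = - (real d * a)" "real d * - u = - a" "real d * - b = - u" "real d * (N - u) = M - a"
    "real d * (N - b) = M - u" "real d * (N + v) = M + real d * v" using scale by (auto simp: algebra_simps)
  have s2: "1 / complex_of_real (sqrt 2) * (1 / complex_of_real (sqrt 2)) = 1 / 2"
    by (simp flip: of_real_mult)
  show ?thesis
    unfolding z_def[symmetric]
  proof (cases rule: intervals[of \<eta>])
    case 1
    then have "z < - (real d * a)" by (simp add: le sc)
    then have "z < - a" "z < M - a" using dd params(2-12) by linarith+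
    then show "g0 z * cnj (g0 \<eta>) = of_real ((indicator IA (z - M) - indicator IA z) / 2)"
      using 1 by (simp add: g0_vals IA_def)
  next
    case 2
    then have "z < - (real d * u)" by (simp add: le)
    then have "z < - a" using scale(1) by simp
    then have "z < - a" "z < M - a" using params(2-12) by linarith+
    then show "g0 z * cnj (g0 \<eta>) = of_real ((indicator IA (z - M) - indicator IA z) / 2)"
      by (simp add: g0_vals IA_def)
  next
    case 3
    then have "- (real d * u) \<le> z" "z < - (real d * b)" by (simp_all add: le)
    then have "- a \<le> z" "z < - u" using scale(1,2) by simp_all
    moreover from this have "z < M - a" using params(2-12) by linarith
    ultimately show "g0 z * cnj (g0 \<eta>) = of_real ((indicator IA (z - M) - indicator IA z) / 2)"
      using 3 s2 by (simp add: g0_vals IA_def)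
  next
    case 4
    then have "- (real d * b) \<le> z" "z < real d * v" by (simp_all add: le)
    then have "- u \<le> z" "z < real d * v" using scale(2) by simp_all
    moreover from this have "z < M - a" using params(2-12) by linarith
    ultimately show "g0 z * cnj (g0 \<eta>) = of_real ((indicator IA (z - M) - indicator IA z) / 2)"
      using 4 by (simp add: g0_vals IA_def)
  next
    case 5
    then have "real d * v \<le> z" "z < real d * y" by (simp_all add: le)
    then have "y \<le> z" "z < N - u" "- u \<le> z" "z < M - a" using dy params(2-12) by linarith+
    then show "g0 z * cnj (g0 \<eta>) = of_real ((indicator IA (z - M) - indicator IA z) / 2)"
      by (simp add: g0_vals IA_def)
  next
    case 6
    have "0 \<le> real d * y" using params(3,8) by simp
    moreover have "real d * y \<le> z" "z < M - a" using 6 by (simp_all add: le sc)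
    ultimately have "- u \<le> z" "z < M - a" using params(2-12) by linarith+
    then show "g0 z * cnj (g0 \<eta>) = of_real ((indicator IA (z - M) - indicator IA z) / 2)"
      using 6 by (simp add: g0_vals IA_def)
  next
    case 7
    then have "M - a \<le> z" "z < M - u" by (simp_all add: le sc)
    moreover from this have "- u \<le> z" using params(2-12) by linarith
    ultimately show "g0 z * cnj (g0 \<eta>) = of_real ((indicator IA (z - M) - indicator IA z) / 2)"
      using 7 s2 by (simp add: g0_vals IA_def)
  next
    case 8
    then have "M - u \<le> z" by (simp add: le sc)
    moreover from this have "- u \<le> z" using params(2-12) by linarith
    ultimately show "g0 z * cnj (g0 \<eta>) = of_real ((indicator IA (z - M) - indicator IA z) / 2)"
      by (simp add: g0_vals IA_def)
  next
    case 9
    then have "M - u \<le> z" using params(3) by (simp add: le sc) (use mult_pos_pos[of "real d" v] d_gt params(2-12) in linarith)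
    moreover from this have "- u \<le> z" using params(2-12) by linarith
    ultimately show "g0 z * cnj (g0 \<eta>) = of_real ((indicator IA (z - M) - indicator IA z) / 2)"
      by (simp add: g0_vals IA_def)
  next
    case 10
    then have "real d * (M - a) \<le> z" by (simp add: le)
    then have "2 * (M - a) \<le> z" using dd(2) by linarith
    then have "M - u \<le> z" "- u \<le> z" using params(2,4,5,6,7,12) by (simp_all add: algebra_simps)
    then show "g0 z * cnj (g0 \<eta>) = of_real ((indicator IA (z - M) - indicator IA z) / 2)"
      by (simp add: g0_vals IA_def)
  next
    case 11
    then have "real d * (M - u) \<le> z" by (simp add: le)
    then have "2 * (M - u) \<le> z" using dd(3) by linarith
    then have "M - u \<le> z" "- u \<le> z" using params(2,4,5,6,7,12) by (simp_all add: algebra_simps)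
    then show "g0 z * cnj (g0 \<eta>) = of_real ((indicator IA (z - M) - indicator IA z) / 2)"
      by (simp add: g0_vals IA_def)
  qed
qed

text \<open>Two or more dilations push every piece off the support. The negative pieces pass
  \<open>-a\<close> and the pieces from \<open>N - u\<close> on pass \<open>M - u\<close>. The
  dilates of \<open>IE\<close> stay in the gap \<open>[y, N - u)\<close> up to exponent
  \<open>n + 1\<close>, fall exactly onto the gap \<open>[N + v, M - a)\<close> at
  \<open>n + 2\<close>, since \<open>M * d * v = N + v\<close> and \<open>d * M * y = M - a\<close>,
  and lie beyond \<open>M\<close> afterwards.\<close>

lemma crossk: assumes "k \<ge> 2" shows "g0 (real d ^ k * \<eta>) * cnj (g0 \<eta>) = 0"
proof -
  define z where "z = real d ^ k * \<eta>"
  have dk: "real d ^ 2 \<le> real d ^ k" using assms d_gt by (intro power_increasing) auto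
  have d4: "4 \<le> real d ^ 2" using power_mono[of 2 "real d" 2] d_gt by simp
  have neg: "g0 z = 0" if "\<eta> < - b"
  proof -
    have "z \<le> real d ^ 2 * \<eta>" using that dk params by (auto simp: z_def intro!: mult_right_mono_neg)
    also have "\<dots> < real d ^ 2 * (- b)" using that d_gt by (intro mult_strict_left_mono) auto
    also have "\<dots> = - a" using scale by (simp add: power2_eq_square)
    finally show ?thesis using params by (auto simp: g0_def)
  qed
  have big: "g0 z = 0" if "\<eta> \<ge> N - u"
  proof -
    have "M - u < real d ^ 2 * (N - u)"
    proof -
      have "real d ^ 2 * (N - u) = real d * (M - a)" using scale by (simp add: power2_eq_square algebra_simps)
      moreover have "2 * (M - a) \<le> real d * (M - a)" using params d_gt by (intro mult_right_mono) auto
      moreover have "M - u < 2 * (M - a)" using params(2,4,5,6,7,12) by (simp add: algebra_simps)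
      ultimately show ?thesis by linarith
    qed
    also have "\<dots> \<le> real d ^ k * (N - u)" using dk params by (intro mult_right_mono) auto
    also have "\<dots> \<le> z" using that by (simp add: z_def mult_left_mono)
    finally show ?thesis using params by (auto simp: g0_def)
  qed
  have mid: "g0 z = 0" if \<eta>: "v \<le> \<eta>" "\<eta> < y"
  proof -
    have zl: "real d ^ k * v \<le> z" and zu: "z < real d ^ k * y"
      using \<eta> d_gt by (auto simp: z_def)
    have "real d * v \<le> real d ^ 2 * v" using params d_gt by (intro mult_right_mono) (auto simp: power2_eq_square)
    then have zy: "y < z" using zl params dk mult_right_mono[OF dk, of v] by linarith
    consider "k \<le> n + 1" | "k = n + 2" | "k \<ge> n + 3" by linarith
    then show ?thesis
    proof cases
      case 1
      have "real d ^ k * y \<le> real d ^ (n + 1) * y"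
        using 1 params d_gt by (intro mult_right_mono power_increasing) auto
      also have "\<dots> = N - u" using params(13) by (simp add: M_def N_def)
      finally show ?thesis using zu zy params by (auto simp: g0_def)
    next
      case 2
      have "real d ^ k * v = M * (real d * v)" using 2 by (simp add: M_def N_def mult_ac power_add power2_eq_square)
      then have l: "N + v \<le> z" using zl params by simp
      have "real d ^ k * y = real d * (M * y)" using 2 by (simp add: M_def N_def mult_ac power_add power2_eq_square)
      also have "\<dots> = M - a" unfolding params(13) using scale(1,3) by (simp add: right_diff_distrib)
      finally show ?thesis using l zu params by (auto simp: g0_def)
    next
      case 3
      have "real d ^ (n + 3) * v = real d * (M * (real d * v))"
        by (simp add: M_def N_def mult_ac power_add power3_eq_cube)
      also have "\<dots> = M + real d * v" unfolding params(14) using scale(3) by (simp add: distrib_left)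
      finally have "M + real d * v = real d ^ (n + 3) * v" ..
      also have "\<dots> \<le> real d ^ k * v"
        using 3 params d_gt by (intro mult_right_mono power_increasing) auto
      finally show ?thesis using zl params by (auto simp: g0_def)
    qed
  qed
  show ?thesis
  proof (cases "\<eta> < - b \<or> \<eta> \<ge> N - u \<or> (v \<le> \<eta> \<and> \<eta> < y)")
    case True
    then show ?thesis using neg big mid by (auto simp flip: z_def)
  next
    case False
    then have "g0 \<eta> = 0" using params by (auto simp: g0_def)
    then show ?thesis by simp
  qed
qed

text \<open>The frequency side of the translate of the wavelet by \<open>s\<close>. Real
  \<open>s\<close> is allowed because an integer translation moved past a dilation becomes a
  fractional one.\<close>

definition G :: "real \<Rightarrow> real \<Rightarrow> complex" where
  "G s \<xi> = ee (- (s * \<xi>)) * g0 \<xi>"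

lemma G_bcs: "G s \<in> bcs"
  using bcs_ee_mult[OF g0_bcs, of "-s"] by (simp add: G_def[abs_def])

lemma G_measurable [measurable]: "G s \<in> borel_measurable borel"
  using G_bcs by (rule bcs_measurable)

text \<open>Integer characters are invariant under the integer shifts \<open>N\<close> and
  \<open>M\<close>, so folding leaves the orthonormality of exponentials over one period.\<close>

lemma inner_G: "L2_inner (G (of_int l)) (G (of_int l')) = (if l = l' then 1 else 0)"
proof -
  let ?F = "\<lambda>\<xi>. ee (of_int (l' - l) * \<xi>)"
  have per: "?F (\<xi> + N) = ?F \<xi>" "?F (\<xi> + M) = ?F \<xi>" for \<xi>
  proof -
    have "of_int (l' - l) * N = of_int ((l' - l) * int d ^ n)" "of_int (l' - l) * M = of_int ((l' - l) * int d ^ (n + 1))"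
      by (auto simp: N_def M_def)
    then show "?F (\<xi> + N) = ?F \<xi>" "?F (\<xi> + M) = ?F \<xi>"
      unfolding distrib_left ee_add by (simp_all only: ee_int mult_1_right)
  qed
  have "L2_inner (G (of_int l)) (G (of_int l')) = (LINT \<xi>|lborel. (cmod (g0 \<xi>))\<^sup>2 *\<^sub>R ?F \<xi>)"
    unfolding L2_inner_def
  proof (intro Bochner_Integration.integral_cong refl)
    fix \<xi>
    have "G (of_int l) \<xi> * cnj (G (of_int l') \<xi>) =
      (ee (- (of_int l * \<xi>)) * ee (of_int l' * \<xi>)) * (g0 \<xi> * cnj (g0 \<xi>))"
      by (simp add: G_def cnj_ee mult_ac)
    also have "ee (- (of_int l * \<xi>)) * ee (of_int l' * \<xi>) = ?F \<xi>"
      by (simp add: algebra_simps flip: ee_add)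
    finally show "G (of_int l) \<xi> * cnj (G (of_int l') \<xi>) = (cmod (g0 \<xi>))\<^sup>2 *\<^sub>R ?F \<xi>"
      by (simp add: scaleR_conv_of_real complex_norm_square mult.commute flip: of_real_power)
  qed
  also have "\<dots> = (LINT \<xi>|lborel. indicator {-a..<-a + 1} \<xi> *\<^sub>R ?F \<xi>)"
  proof (subst LINT_norm_g0[where B = 1])
    show "(LINT \<xi>|lborel. (indicator IA \<xi> / 2 + indicator IC \<xi> / 2 + indicator IE \<xi>) *\<^sub>R ?F \<xi> +
      (indicator IC \<xi> / 2 + indicator ID \<xi>) *\<^sub>R ?F (\<xi> + N) + (indicator IA \<xi> / 2) *\<^sub>R ?F (\<xi> + M)) =
      (LINT \<xi>|lborel. indicator {-a..<-a + 1} \<xi> *\<^sub>R ?F \<xi>)"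
      unfolding per scaleR_add_left[symmetric] sum_indicators[symmetric]
      by (intro Bochner_Integration.integral_cong refl arg_cong[where f = "\<lambda>t. t *\<^sub>R _"]) simp
  qed auto
  also have "\<dots> = (if l = l' then 1 else 0)"
    unfolding orthonormal_ee by auto
  finally show ?thesis .
qed

text \<open>Kept general in \<open>s\<close> and \<open>t\<close> because it serves twice: for
  integers the bracket vanishes, which gives orthogonality of adjacent scales, while for a suitable
  fractional \<open>s\<close> it does not, which destroys translation invariance.\<close>

lemma inner_G_dilate1:
  "L2_inner (G s) (D_pow d (-1) (G t)) = of_real (real d powr (- 1 / 2) / 2) *
    (LINT \<xi>|lborel. indicator IA \<xi> *\<^sub>R
      (ee (t * ((\<xi> + M) / real d) - s * (\<xi> + M)) - ee (t * (\<xi> / real d) - s * \<xi>)))"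
proof -
  let ?F = "\<lambda>\<xi>. ee (t * (\<xi> / real d) - s * \<xi>)"
  have IA: "integrable lborel (\<lambda>\<xi>. indicator IA \<xi> *\<^sub>R ee (p + q * \<xi>))" for p q
    by (rule integrable_bounded_support[where B = 1 and R = 1])
      (use params in \<open>auto simp: IA_def indicator_def\<close>)
  have F1: "?F = (\<lambda>\<xi>. ee (0 + (t / real d - s) * \<xi>))"
    by (simp add: algebra_simps)
  have F2: "(\<lambda>\<xi>. ?F (\<xi> + M)) = (\<lambda>\<xi>. ee ((t * M / real d - s * M) + (t / real d - s) * \<xi>))"
    by (simp add: algebra_simps add_divide_distrib)
  have i1: "integrable lborel (\<lambda>\<xi>. indicator IA \<xi> *\<^sub>R ?F \<xi>)"
    using IA[of 0 "t / real d - s"] fun_cong[OF F1] by simp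
  have i2: "integrable lborel (\<lambda>\<xi>. indicator IA \<xi> *\<^sub>R ?F (\<xi> + M))"
    using IA[of "t * M / real d - s * M" "t / real d - s"] fun_cong[OF F2] by simp
  have i3: "integrable lborel (\<lambda>\<xi>. indicator IA (\<xi> - M) *\<^sub>R ?F \<xi>)"
    and e3: "(LINT \<xi>|lborel. indicator IA (\<xi> - M) *\<^sub>R ?F \<xi>) = (LINT \<xi>|lborel. indicator IA \<xi> *\<^sub>R ?F (\<xi> + M))"
    using lborel_integrable_real_affine[OF i2, of 1 "-M"]
      lborel_integral_real_affine[of 1 "\<lambda>\<xi>. indicator IA \<xi> *\<^sub>R ?F (\<xi> + M)" "-M"] by simp_all
  have "G s \<xi> * cnj (D_pow d (-1) (G t) \<xi>) = of_real (real d powr (- 1 / 2) / 2) *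
    (indicator IA (\<xi> - M) *\<^sub>R ?F \<xi> - indicator IA \<xi> *\<^sub>R ?F \<xi>)" for \<xi>
  proof -
    have "G s \<xi> * cnj (D_pow d (-1) (G t) \<xi>) = of_real (real d powr (- 1 / 2)) *
      (ee (- (s * \<xi>)) * ee (t * (\<xi> / real d))) * (g0 \<xi> * cnj (g0 (\<xi> / real d)))"
    proof -
      have "real d powi (- 1) * \<xi> = \<xi> / real d" by (simp add: power_int_minus field_simps)
      then show ?thesis unfolding G_def D_pow_def by (simp only:) (simp add: cnj_ee mult_ac)
    qed
    also have "ee (- (s * \<xi>)) * ee (t * (\<xi> / real d)) = ?F \<xi>"
      by (simp flip: ee_add)
    also have "g0 \<xi> * cnj (g0 (\<xi> / real d)) = of_real ((indicator IA (\<xi> - M) - indicator IA \<xi>) / 2)"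
      using cross1[of "\<xi> / real d"] d_gt by simp
    finally show ?thesis by (simp add: scaleR_conv_of_real algebra_simps)
  qed
  then have "L2_inner (G s) (D_pow d (-1) (G t)) = of_real (real d powr (- 1 / 2) / 2) *
    (LINT \<xi>|lborel. (indicator IA (\<xi> - M) *\<^sub>R ?F \<xi> - indicator IA \<xi> *\<^sub>R ?F \<xi>))"
    by (simp only: L2_inner_def integral_mult_right_zero)
  also have "(LINT \<xi>|lborel. (indicator IA (\<xi> - M) *\<^sub>R ?F \<xi> - indicator IA \<xi> *\<^sub>R ?F \<xi>)) =
    (LINT \<xi>|lborel. indicator IA \<xi> *\<^sub>R (?F (\<xi> + M) - ?F \<xi>))"
    unfolding scaleR_diff_right using i1 i2 i3 e3 by (simp only: Bochner_Integration.integral_diff)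
  finally show ?thesis .
qed

lemma inner_G_dilate:
  assumes "k \<ge> 1"
  shows "L2_inner (G (of_int l)) (D_pow d (- int k) (G (of_int l'))) = 0"
proof (cases "k = 1")
  case True
  \<comment> \<open>The shift by \<open>M\<close> changes the exponent by
    \<open>l' * N - l * M\<close>, an integer.\<close>
  have "ee (of_int l' * ((\<xi> + M) / real d) - of_int l * (\<xi> + M)) = ee (of_int l' * (\<xi> / real d) - of_int l * \<xi>)" for \<xi>
  proof -
    have "of_int l' * ((\<xi> + M) / real d) - of_int l * (\<xi> + M) =
      (of_int l' * (\<xi> / real d) - of_int l * \<xi>) + of_int (l' * int d ^ n - l * int d ^ (n + 1))"
      using d_gt by (simp add: M_def N_def field_simps)
    then show ?thesis by (simp only: ee_add ee_int mult_1_right)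
  qed
  then show ?thesis using True inner_G_dilate1[of "of_int l" "of_int l'"] by simp
next
  case False
  have "G (of_int l) \<xi> * cnj (D_pow d (- int k) (G (of_int l')) \<xi>) = 0" for \<xi>
  proof -
    have "g0 \<xi> * cnj (g0 (inverse (real d ^ k) * \<xi>)) = 0"
      using crossk[of k "inverse (real d ^ k) * \<xi>"] assms False d_gt by (simp add: mult.assoc[symmetric])
    then show ?thesis by (auto simp: G_def D_pow_def power_int_minus)
  qed
  then show ?thesis by (simp only: L2_inner_def integral_zero)
qed

text \<open>The exponent is negated because \<open>ft\<close> reverses dilations; thus
  \<open>ft (E j l)\<close> is the basis element with dilation \<open>j\<close> and translation
  \<open>l\<close>.\<close>

definition E :: "int \<Rightarrow> int \<Rightarrow> real \<Rightarrow> complex" where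
  "E j l = D_pow d (- j) (G (of_int l))"

lemma E_bcs: "E j l \<in> bcs"
  unfolding E_def using d_gt G_bcs by (intro D_pow_bcs)

lemma G_L2: "range (\<lambda>l::int. G (of_int l)) \<subseteq> L2"
  using G_bcs bcs_L2 by auto

lemma inner_E: "L2_inner (E j l) (E j' l') = (if j = j' \<and> l = l' then 1 else 0)"
proof -
  have *: "L2_inner (E j l) (E j' l') = L2_inner (G (of_int l)) (D_pow d (j - j') (G (of_int l')))" for j l j' l'
  proof -
    have "E j' l' = D_pow d (- j) (D_pow d (j - j') (G (of_int l')))"
      using D_pow_add[of d "- j" "j - j'"] d_gt by (simp add: E_def)
    then show ?thesis using d_gt by (simp add: E_def D_pow_inner)
  qed
  have lt: "L2_inner (E j l) (E j' l') = 0" if "j < j'" for j l j' l'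
    using inner_G_dilate[of "nat (j' - j)" l l'] that by (simp add: *)
  consider "j < j'" | "j' < j" | "j = j'" by linarith
  then show ?thesis
  proof cases
    case 2
    then show ?thesis using lt[of j' j l' l] L2_inner_commute[of "E j l" "E j' l'"] by simp
  next
    case 3
    then show ?thesis using *[of j l j l'] D_pow_0[of d] d_gt by (simp add: inner_G)
  qed (use lt in simp)
qed

section \<open>The closed span of the integer translates\<close>

lemma disjoint_intervals:
  "\<xi> \<in> IA \<Longrightarrow> \<xi> \<notin> IC \<and> \<xi> \<notin> ID \<and> \<xi> \<notin> IE" "\<xi> \<in> IC \<Longrightarrow> \<xi> \<notin> IA \<and> \<xi> \<notin> ID \<and> \<xi> \<notin> IE"
  "\<xi> \<in> ID \<Longrightarrow> \<xi> \<notin> IA \<and> \<xi> \<notin> IC \<and> \<xi> \<notin> IE" "\<xi> \<in> IE \<Longrightarrow> \<xi> \<notin> IA \<and> \<xi> \<notin> IC \<and> \<xi> \<notin> ID"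
  using params by (auto simp: IA_def IC_def ID_def IE_def)

lemma trig_mult_g0:
  assumes "p \<in> trig" shows "(\<lambda>\<xi>. p \<xi> * g0 \<xi>) \<in> lin_span (range (\<lambda>l::int. G (of_int l)))"
  using assms
proof (induction rule: lin_span_induct)
  case zero
  then show ?case using lin_span_zero by simp
next
  case (add c e h)
  then obtain k :: int where k: "e = (\<lambda>\<xi>. ee (of_int k * \<xi>))" by auto
  have "(\<lambda>\<xi>. e \<xi> * g0 \<xi>) = G (of_int (- k))"
    by (simp add: k G_def[abs_def])
  then have "(\<lambda>\<xi>. e \<xi> * g0 \<xi>) \<in> lin_span (range (\<lambda>l::int. G (of_int l)))"
    by (simp only:) (rule lin_span_base, rule rangeI)
  then have "(\<lambda>\<xi>. c * (e \<xi> * g0 \<xi>) + h \<xi> * g0 \<xi>) \<in> lin_span (range (\<lambda>l::int. G (of_int l)))"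
    using add by (intro lin_span_add lin_span_cmult)
  then show ?case by (simp add: algebra_simps)
qed

text \<open>A multiplier has to look periodic only where the support meets its own integer
  translates, that is between \<open>IA\<close> and \<open>IA + M\<close> and between
  \<open>IC\<close> and \<open>IC + N\<close>. Folding then turns the distance to
  \<open>p * g0\<close>, for a trigonometric polynomial \<open>p\<close>, into a mean-square
  distance over one period.\<close>

lemma mult_g0_closed_span:
  assumes q: "q \<in> borel_measurable borel" "\<And>x. cmod (q x) \<le> B"
    and per: "\<And>\<xi>. \<xi> \<in> IA \<Longrightarrow> q (\<xi> + M) = q \<xi>" "\<And>\<xi>. \<xi> \<in> IC \<Longrightarrow> q (\<xi> + N) = q \<xi>"
  shows "(\<lambda>\<xi>. q \<xi> * g0 \<xi>) \<in> closed_span (range (\<lambda>l::int. G (of_int l)))"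
  unfolding closed_span_iff
proof (intro conjI allI impI)
  note [measurable] = q(1)
  show "(\<lambda>\<xi>. q \<xi> * g0 \<xi>) \<in> L2"
    using bcs_bounded_mult[OF q g0_bcs] by (rule bcs_L2)
  fix \<epsilon> :: real assume "\<epsilon> > 0"
  \<comment> \<open>The multiplier transported to \<open>[-a, 1 - a)\<close>: over \<open>ID\<close>
    the profile lives only at \<open>\<xi> + N\<close>, so its value there is taken; elsewhere
    \<open>q\<close> itself serves, by the matching conditions.\<close>
  define m where "m \<xi> = (if \<xi> \<in> ID then q (\<xi> + N) else q \<xi>)" for \<xi>
  have "m \<in> borel_measurable borel" unfolding m_def[abs_def] by measurable
  moreover have "cmod (m x) \<le> B" for x using q(2) by (simp add: m_def)
  ultimately obtain p where p: "p \<in> trig"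
    "(LINT \<xi>|lborel. indicator {-a..<-a + 1} \<xi> * (cmod (m \<xi> - p \<xi>))\<^sup>2) < \<epsilon>"
    using \<open>\<epsilon> > 0\<close> by (rule trig_dense)
  have perp: "p (\<xi> + N) = p \<xi>" "p (\<xi> + M) = p \<xi>" for \<xi>
    using trig_periodic[OF p(1), of \<xi> "int d ^ n"] trig_periodic[OF p(1), of \<xi> "int d ^ (n + 1)"]
    by (simp_all add: N_def M_def)
  obtain Bp where Bp: "\<And>x. cmod (p x) \<le> Bp" and [measurable]: "p \<in> borel_measurable borel"
    using trig_measurable_bounded[OF p(1)] by blast
  let ?X = "\<lambda>\<xi>. (cmod (q \<xi> - p \<xi>))\<^sup>2"
  have "nsq (\<lambda>\<xi>. q \<xi> * g0 \<xi> - p \<xi> * g0 \<xi>) = (LINT \<xi>|lborel. (cmod (g0 \<xi>))\<^sup>2 *\<^sub>R ?X \<xi>)"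
    unfolding nsq_def
  proof (intro Bochner_Integration.integral_cong refl)
    fix \<xi>
    have "q \<xi> * g0 \<xi> - p \<xi> * g0 \<xi> = (q \<xi> - p \<xi>) * g0 \<xi>" by (simp add: left_diff_distrib)
    then show "(cmod (q \<xi> * g0 \<xi> - p \<xi> * g0 \<xi>))\<^sup>2 = (cmod (g0 \<xi>))\<^sup>2 *\<^sub>R ?X \<xi>"
      by (simp only: norm_mult power_mult_distrib real_scaleR_def mult.commute)
  qed
  also have "\<dots> = (LINT \<xi>|lborel. indicator {-a..<-a + 1} \<xi> * (cmod (m \<xi> - p \<xi>))\<^sup>2)"
  proof (subst LINT_norm_g0[where B = "(B + Bp)\<^sup>2"])
    show "norm (?X x) \<le> (B + Bp)\<^sup>2" for x
      using norm_triangle_ineq4[of "q x" "p x"] q(2)[of x] Bp[of x] by (auto intro!: power_mono)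
    show "(LINT \<xi>|lborel. (indicator IA \<xi> / 2 + indicator IC \<xi> / 2 + indicator IE \<xi>) *\<^sub>R ?X \<xi> +
      (indicator IC \<xi> / 2 + indicator ID \<xi>) *\<^sub>R ?X (\<xi> + N) + (indicator IA \<xi> / 2) *\<^sub>R ?X (\<xi> + M)) =
      (LINT \<xi>|lborel. indicator {-a..<-a + 1} \<xi> * (cmod (m \<xi> - p \<xi>))\<^sup>2)"
    proof (intro Bochner_Integration.integral_cong refl)
      fix \<xi>
      consider "\<xi> \<in> IA" "\<xi> \<notin> IC" "\<xi> \<notin> ID" "\<xi> \<notin> IE" | "\<xi> \<notin> IA" "\<xi> \<in> IC" "\<xi> \<notin> ID" "\<xi> \<notin> IE"
        | "\<xi> \<notin> IA" "\<xi> \<notin> IC" "\<xi> \<in> ID" "\<xi> \<notin> IE" | "\<xi> \<notin> IA" "\<xi> \<notin> IC" "\<xi> \<notin> ID" "\<xi> \<in> IE"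
        | "\<xi> \<notin> IA" "\<xi> \<notin> IC" "\<xi> \<notin> ID" "\<xi> \<notin> IE"
        using disjoint_intervals[of \<xi>] by blast
      then show "(indicator IA \<xi> / 2 + indicator IC \<xi> / 2 + indicator IE \<xi>) *\<^sub>R ?X \<xi> +
        (indicator IC \<xi> / 2 + indicator ID \<xi>) *\<^sub>R ?X (\<xi> + N) + (indicator IA \<xi> / 2) *\<^sub>R ?X (\<xi> + M) =
        indicator {-a..<-a + 1} \<xi> * (cmod (m \<xi> - p \<xi>))\<^sup>2"
        unfolding sum_indicators[symmetric]
        by cases (simp_all add: per perp m_def)
    qed
  qed measurable
  finally have "nsq (\<lambda>\<xi>. q \<xi> * g0 \<xi> - p \<xi> * g0 \<xi>) < \<epsilon>" using p(2) by simp
  then show "\<exists>g\<in>lin_span (range (\<lambda>l::int. G (of_int l))). nsq (\<lambda>\<xi>. q \<xi> * g0 \<xi> - g \<xi>) < \<epsilon>"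
    using trig_mult_g0[OF p(1)] by (intro bexI[of _ "\<lambda>\<xi>. p \<xi> * g0 \<xi>"])
qed

text \<open>If \<open>s * N\<close> is an integer then so is \<open>s * M\<close>, its multiple by
  \<open>d\<close>; the character therefore satisfies both matching conditions.\<close>

lemma G_closed_span:
  assumes "s * N = of_int k"
  shows "G s \<in> closed_span (range (\<lambda>l::int. G (of_int l)))"
proof -
  have "s * M = of_int (int d * k)" using assms by (simp add: M_def mult_ac)
  then have "- (s * (\<xi> + N)) = - (s * \<xi>) + of_int (- k)"
    "- (s * (\<xi> + M)) = - (s * \<xi>) + of_int (- (int d * k))" for \<xi>
    using assms by (simp_all add: distrib_left)
  then have "ee (- (s * (\<xi> + N))) = ee (- (s * \<xi>))" "ee (- (s * (\<xi> + M))) = ee (- (s * \<xi>))" for \<xi>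
    by (simp_all only: ee_add ee_int mult_1_right)
  then have "(\<lambda>\<xi>. ee (- (s * \<xi>)) * g0 \<xi>) \<in> closed_span (range (\<lambda>l::int. G (of_int l)))"
    by (intro mult_g0_closed_span[where B = 1]) auto
  then show ?thesis by (simp add: G_def[abs_def])
qed

section \<open>Completeness on the frequency side\<close>

abbreviation "EE \<equiv> range (\<lambda>(j, l). E j l)"

lemma E_in_EE: "E j l \<in> EE"
  by (rule range_eqI[of _ _ "(j, l)"]) simp

lemma EE_bcs: "EE \<subseteq> bcs"
  using E_bcs by auto

lemma EE_L2: "EE \<subseteq> L2"
  using EE_bcs bcs_L2 by auto

lemma closed_span_G_D_pow:
  assumes "h \<in> closed_span (range (\<lambda>l::int. G (of_int l)))"
  shows "D_pow d j h \<in> closed_span (range (\<lambda>l. E (- j) l))"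
proof -
  have eq: "D_pow d j ` range (\<lambda>l::int. G (of_int l)) = range (\<lambda>l. E (- j) l)"
    by (auto simp: E_def)
  show ?thesis using closed_span_D_pow[OF d_gt(2) assms G_L2, of j] unfolding eq .
qed

lemma mult_g0_EE:
  assumes "h \<in> bcs" "\<And>\<xi>. \<xi> \<in> IA \<Longrightarrow> h (\<xi> + M) = h \<xi>" "\<And>\<xi>. \<xi> \<in> IC \<Longrightarrow> h (\<xi> + N) = h \<xi>"
  shows "(\<lambda>\<xi>. h \<xi> * g0 \<xi>) \<in> closed_span EE" "D_pow d j (\<lambda>\<xi>. h \<xi> * g0 \<xi>) \<in> closed_span EE"
proof -
  obtain B where "h \<in> borel_measurable borel" "\<And>x. cmod (h x) \<le> B" using assms(1) by (elim bcsE) blast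
  from mult_g0_closed_span[OF this assms(2,3)]
  have *: "(\<lambda>\<xi>. h \<xi> * g0 \<xi>) \<in> closed_span (range (\<lambda>l::int. G (of_int l)))" by blast
  show D: "D_pow d j (\<lambda>\<xi>. h \<xi> * g0 \<xi>) \<in> closed_span EE" for j
    by (rule closed_span_mono[OF closed_span_G_D_pow[OF *]]) auto
  show "(\<lambda>\<xi>. h \<xi> * g0 \<xi>) \<in> closed_span EE" using D[of 0] D_pow_0[of d] d_gt by simp
qed

lemma EE_D_pow:
  assumes "h \<in> closed_span EE" shows "D_pow d j h \<in> closed_span EE"
proof -
  have "D_pow d j (E i l) = E (i - j) l" for i l
    using D_pow_add[of d j "- i" "G (of_int l)"] d_gt by (simp add: E_def)
  then have sub: "D_pow d j ` EE \<subseteq> EE" using E_in_EE by auto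
  show ?thesis
    by (rule closed_span_mono[OF closed_span_D_pow[OF d_gt(2) assms EE_L2] sub])
qed

text \<open>Completeness localized to a set. The property is stable under finite unions and
  dilations, so it can be established on a few intervals and spread from there.\<close>

definition carries :: "real set \<Rightarrow> bool" where
  "carries I \<longleftrightarrow> (\<forall>h\<in>bcs. (\<forall>x. x \<notin> I \<longrightarrow> h x = 0) \<longrightarrow> h \<in> closed_span EE)"

lemma carriesD: "carries I \<Longrightarrow> h \<in> bcs \<Longrightarrow> (\<And>x. x \<notin> I \<Longrightarrow> h x = 0) \<Longrightarrow> h \<in> closed_span EE"
  by (auto simp: carries_def)

lemma carriesI: "(\<And>h. h \<in> bcs \<Longrightarrow> (\<And>x. x \<notin> I \<Longrightarrow> h x = 0) \<Longrightarrow> h \<in> closed_span EE) \<Longrightarrow> carries I"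
  by (auto simp: carries_def)

lemma carries_Un:
  assumes "carries I" "carries J" "I \<in> sets borel" shows "carries (I \<union> J)"
proof (rule carriesI)
  fix h :: "real \<Rightarrow> complex" assume h: "h \<in> bcs" "\<And>x. x \<notin> I \<union> J \<Longrightarrow> h x = 0"
  have "(\<lambda>x. indicator I x * h x) \<in> closed_span EE"
    by (rule carriesD[OF assms(1) bcs_indicator]) (use h assms(3) in auto)
  moreover have "(\<lambda>x. indicator (- I) x * h x) \<in> closed_span EE"
    by (rule carriesD[OF assms(2) bcs_indicator]) (use h assms(3) in \<open>auto simp: indicator_def\<close>)
  ultimately have "(\<lambda>x. indicator I x * h x + indicator (- I) x * h x) \<in> closed_span EE"
    by (rule closed_span_add[OF EE_L2])
  also have "(\<lambda>x. indicator I x * h x + indicator (- I) x * h x) = h"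
    by (auto simp: indicator_def)
  finally show "h \<in> closed_span EE" .
qed

lemma carries_dilate:
  assumes "carries I" shows "carries {x. real d powi j * x \<in> I}"
proof (rule carriesI)
  fix h :: "real \<Rightarrow> complex" assume h: "h \<in> bcs" "\<And>x. x \<notin> {x. real d powi j * x \<in> I} \<Longrightarrow> h x = 0"
  have "D_pow d (- j) h \<in> closed_span EE"
  proof (rule carriesD[OF assms D_pow_bcs])
    fix x assume "x \<notin> I"
    then have "real d powi (- j) * x \<notin> {x. real d powi j * x \<in> I}"
      using d_gt by (simp add: power_int_minus flip: mult.assoc)
    then show "D_pow d (- j) h x = 0" using h(2) by (simp add: D_pow_def)
  qed (use h d_gt in auto)
  then have "D_pow d j (D_pow d (- j) h) \<in> closed_span EE" by (rule EE_D_pow)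
  then show "h \<in> closed_span EE" using D_pow_inverse d_gt by simp
qed

text \<open>Where \<open>g0\<close> is 1, a function supported in \<open>I\<close> is its own
  product with \<open>g0\<close> and can serve as multiplier. The location of \<open>I\<close>, away
  from \<open>IA\<close>, \<open>IC\<close> and their translates by \<open>M\<close> and
  \<open>N\<close>, makes the matching conditions read 0 = 0.\<close>

lemma carries_support:
  assumes "\<And>\<xi>. \<xi> \<in> I \<Longrightarrow> g0 \<xi> = 1"
    and I: "\<And>\<xi>. \<xi> \<in> I \<Longrightarrow> - b \<le> \<xi> \<and> \<xi> < M - a \<and> (\<xi> < N - u \<or> N - b \<le> \<xi>)"
  shows "carries I"
proof (rule carriesI)
  fix h :: "real \<Rightarrow> complex" assume h: "h \<in> bcs" "\<And>x. x \<notin> I \<Longrightarrow> h x = 0"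
  have "(\<lambda>\<xi>. h \<xi> * g0 \<xi>) \<in> closed_span EE"
  proof (rule mult_g0_EE[OF h(1)])
    show "h (\<xi> + M) = h \<xi>" if "\<xi> \<in> IA" for \<xi>
    proof -
      have "- a \<le> \<xi>" "\<xi> < - b" using that params(5) by (auto simp: IA_def)
      then have "\<xi> \<notin> I" "\<xi> + M \<notin> I" using I[of \<xi>] I[of "\<xi> + M"] by auto
      then show ?thesis using h(2) by simp
    qed
    show "h (\<xi> + N) = h \<xi>" if "\<xi> \<in> IC" for \<xi>
    proof -
      have "- u \<le> \<xi>" "\<xi> < - b" using that by (auto simp: IC_def)
      then have "\<xi> \<notin> I" "\<xi> + N \<notin> I" using I[of \<xi>] I[of "\<xi> + N"] by auto
      then show ?thesis using h(2) by simp
    qed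
  qed
  also have "(\<lambda>\<xi>. h \<xi> * g0 \<xi>) = h"
  proof
    show "h \<xi> * g0 \<xi> = h \<xi>" for \<xi>
      using assms(1)[of \<xi>] h(2)[of \<xi>] by (cases "\<xi> \<in> I") simp_all
  qed
  finally show "h \<in> closed_span EE" .
qed

lemma carries_IE: "carries IE"
proof (rule carries_support)
  fix \<xi> assume "\<xi> \<in> IE"
  then have \<xi>: "v \<le> \<xi>" "\<xi> < y" by (auto simp: IE_def)
  then show "g0 \<xi> = 1" by (rule g0_vals)
  have "- b \<le> \<xi>" "\<xi> < M - a" "\<xi> < N - u" using \<xi> params(2-12) by linarith+
  then show "- b \<le> \<xi> \<and> \<xi> < M - a \<and> (\<xi> < N - u \<or> N - b \<le> \<xi>)" by blast
qed

lemma carries_far: "carries {N - b..<N + v}"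
proof (rule carries_support)
  fix \<xi> assume "\<xi> \<in> {N - b..<N + v}"
  then have \<xi>: "N - b \<le> \<xi>" "\<xi> < N + v" by auto
  then show "g0 \<xi> = 1" by (rule g0_vals)
  have "- b \<le> \<xi>" "\<xi> < M - a" using \<xi> params(2-12) by linarith+
  then show "- b \<le> \<xi> \<and> \<xi> < M - a \<and> (\<xi> < N - u \<or> N - b \<le> \<xi>)" using \<xi> by blast
qed

text \<open>On \<open>IA\<close> and \<open>IA + M\<close> the two functions \<open>g0 \<xi>\<close> and \<open>g0 (\<xi> / d)\<close> take the values
  \<open>1 / sqrt 2\<close>, \<open>- 1 / sqrt 2\<close> and \<open>1 / sqrt 2\<close>, \<open>1 / sqrt 2\<close>, so their difference and their sum
  isolate the two intervals.\<close>

lemma carries_pair: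
  assumes h: "h \<in> bcs" "\<And>x. x \<notin> IA \<Longrightarrow> h x = 0"
  shows "h \<in> closed_span EE" "(\<lambda>x. h (x - M)) \<in> closed_span EE"
proof -
  \<comment> \<open>Equal copies of \<open>h\<close> on \<open>IA\<close> and \<open>IA + M\<close>,
    so that \<open>H\<close> matches under the shift by \<open>M\<close>. The factor
    \<open>1 / sqrt 2\<close> makes its products with the profile halves.\<close>
  define H where "H \<xi> = (1 / sqrt 2) * (h \<xi> + h (\<xi> - M))" for \<xi>
  have hM: "(\<lambda>x. h (x - M)) \<in> bcs" using bcs_affine[OF h(1), of 1 "-M"] by simp
  have H: "H \<in> bcs"
    unfolding H_def[abs_def] by (intro bcs_cmult bcs_add h hM)
  \<comment> \<open>Multiplying \<open>g0\<close> by this and dilating back gives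
    \<open>H \<xi> * g0 (\<xi> / d)\<close> up to a constant. A shift of the argument of
    \<open>H'\<close> by \<open>N\<close> is a shift by \<open>M = d * N\<close> in
    \<open>H\<close>, which supplies the matching on \<open>IC\<close>.\<close>
  define H' where "H' \<xi> = H (real d * \<xi>)" for \<xi>
  have H': "H' \<in> bcs" unfolding H'_def[abs_def] using bcs_affine[OF H, of "real d" 0] d_gt by simp
  have h0: "h x = 0" if "x < - a \<or> - u \<le> x" for x using that h(2) by (auto simp: IA_def)
  have Hper: "H (\<xi> + M) = H \<xi>" if "\<xi> \<in> IA" for \<xi>
    using that params(2-12) h0[of "\<xi> + M"] h0[of "\<xi> - M"] by (auto simp: H_def IA_def)
  have H0: "H \<xi> = 0" if "\<xi> < - a \<or> - u \<le> \<xi> \<and> \<xi> < M - a \<or> M - u \<le> \<xi>" for \<xi>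
  proof -
    have "h \<xi> = 0" by (rule h0) (use that params(2-12) in linarith)
    moreover have "h (\<xi> - M) = 0" by (rule h0) (use that params(2-12) in linarith)
    ultimately show ?thesis by (simp add: H_def)
  qed
  have 1: "(\<lambda>\<xi>. H \<xi> * g0 \<xi>) \<in> closed_span EE"
  proof (rule mult_g0_EE[OF H Hper])
    fix \<xi> assume "\<xi> \<in> IC"
    then have "- u \<le> \<xi>" "\<xi> < - b" by (auto simp: IC_def)
    then have "H \<xi> = 0" "H (\<xi> + N) = 0" using params(2-12) by (intro H0; linarith)+
    then show "H (\<xi> + N) = H \<xi>" by simp
  qed
  have "D_pow d (-1) (\<lambda>\<xi>. H' \<xi> * g0 \<xi>) \<in> closed_span EE"
  proof (rule mult_g0_EE(2)[OF H'])
    fix \<xi> assume "\<xi> \<in> IC"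
    then have "- (real d * u) \<le> real d * \<xi>" "real d * \<xi> < - (real d * b)"
      using d_gt mult_left_mono[of "-u" \<xi> "real d"] mult_strict_left_mono[of \<xi> "-b" "real d"]
      by (auto simp: IC_def)
    then have "real d * \<xi> \<in> IA" using scale(1,2) by (simp add: IA_def)
    then show "H' (\<xi> + N) = H' \<xi>" using Hper[of "real d * \<xi>"] by (simp add: H'_def distrib_left M_def)
  next
    fix \<xi> assume "\<xi> \<in> IA"
    then have \<xi>: "- a \<le> \<xi>" "\<xi> < - u" by (auto simp: IA_def)
    have "real d * \<xi> < real d * (- u)" using \<xi> d_gt by (intro mult_strict_left_mono) auto
    then have "H' \<xi> = 0" using scale(1) by (auto simp: H'_def intro!: H0)
    moreover have "H' (\<xi> + M) = 0"
    proof -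
      have "2 * (M - a) \<le> real d * (M - a)" using params(2-12) d_gt(1) by (intro mult_right_mono; linarith)
      moreover have "real d * (M - a) \<le> real d * (\<xi> + M)" using \<xi> d_gt by (intro mult_left_mono) auto
      ultimately have "2 * (M - a) \<le> real d * (\<xi> + M)" by linarith
      then have "M - u \<le> real d * (\<xi> + M)" using params(2,4,5,6,7,12) by (simp add: algebra_simps)
      then show ?thesis by (auto simp: H'_def intro!: H0)
    qed
    ultimately show "H' (\<xi> + M) = H' \<xi>" by simp
  qed
  then have D: "(\<lambda>\<xi>. c * D_pow d (-1) (\<lambda>\<xi>. H' \<xi> * g0 \<xi>) \<xi>) \<in> closed_span EE" for c
    by (rule closed_span_cmult[OF EE_L2])
  have 2: "(\<lambda>\<xi>. c * (H \<xi> * g0 (\<xi> / real d))) \<in> closed_span EE" for c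
  proof -
    have "D_pow d (-1) (\<lambda>\<xi>. H' \<xi> * g0 \<xi>) \<xi> = of_real (real d powr (- 1 / 2)) * (H \<xi> * g0 (\<xi> / real d))" for \<xi>
    proof -
      have "real d powi (- 1) * \<xi> = \<xi> / real d" by (simp add: power_int_minus field_simps)
      then show ?thesis unfolding D_pow_def H'_def using d_gt by (simp only:) simp
    qed
    moreover have "complex_of_real (real d powr (1 / 2)) * (of_real (real d powr (- 1 / 2)) * z) = z" for z
    proof -
      have "real d powr (1 / 2) * real d powr (- 1 / 2) = 1"
        using d_gt by (simp flip: powr_add)
      then show ?thesis by (simp flip: mult.assoc of_real_mult)
    qed
    ultimately show ?thesis
      using D[of "c * of_real (real d powr (1 / 2))"] by (simp only: mult.assoc)
  qed
  have comb: "(\<lambda>\<xi>. H \<xi> * g0 \<xi> + c * (H \<xi> * g0 (\<xi> / real d))) \<in> closed_span EE" for c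
    by (rule closed_span_add[OF EE_L2 1 2])
  have s2: "1 / complex_of_real (sqrt 2) * (1 / complex_of_real (sqrt 2)) = 1 / 2"
    by (simp flip: of_real_mult)
  have val: "H \<xi> * g0 \<xi> = (h \<xi> + h (\<xi> - M)) / 2" "H \<xi> * g0 (\<xi> / real d) = (h (\<xi> - M) - h \<xi>) / 2" for \<xi>
  proof -
    have div: "t \<le> \<xi> / real d \<longleftrightarrow> real d * t \<le> \<xi>" "\<xi> / real d < t \<longleftrightarrow> \<xi> < real d * t" for t
      using d_gt by (auto simp: field_simps)
    have dsc: "real d * (- u) = - a" "real d * (- b) = - u" "real d * (N - u) = M - a" "real d * (N - b) = M - u"
      using scale by (auto simp: right_diff_distrib)
    consider "- a \<le> \<xi>" "\<xi> < - u" | "M - a \<le> \<xi>" "\<xi> < M - u" | "\<xi> < - a \<or> - u \<le> \<xi> \<and> \<xi> < M - a \<or> M - u \<le> \<xi>"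
      by linarith
    then have "H \<xi> * g0 \<xi> = (h \<xi> + h (\<xi> - M)) / 2 \<and> H \<xi> * g0 (\<xi> / real d) = (h (\<xi> - M) - h \<xi>) / 2"
    proof cases
      case 1
      then have "g0 (\<xi> / real d) = - 1 / sqrt 2" by (intro g0_vals) (simp_all only: div dsc)
      moreover have "h (\<xi> - M) = 0" using 1 params(2-12) by (intro h0) linarith
      ultimately show ?thesis using g0_vals(2)[OF 1] s2 by (simp add: H_def)
    next
      case 2
      then have "g0 (\<xi> / real d) = 1 / sqrt 2" by (intro g0_vals(7)) (simp_all only: div dsc)
      moreover have "h \<xi> = 0" using 2 params(2-12) by (intro h0) linarith
      ultimately show ?thesis using g0_vals(10)[OF 2] s2 by (simp add: H_def)
    next
      case 3
      have "h \<xi> = 0" by (rule h0) (use 3 params(2-12) in linarith)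
      moreover have "h (\<xi> - M) = 0" by (rule h0) (use 3 params(2-12) in linarith)
      ultimately show ?thesis using H0[OF 3] by simp
    qed
    then show "H \<xi> * g0 \<xi> = (h \<xi> + h (\<xi> - M)) / 2" "H \<xi> * g0 (\<xi> / real d) = (h (\<xi> - M) - h \<xi>) / 2" by auto
  qed
  show "h \<in> closed_span EE" using comb[of "-1"] unfolding val by (simp add: field_simps)
  show "(\<lambda>x. h (x - M)) \<in> closed_span EE" using comb[of 1] unfolding val by (simp add: field_simps)
qed

lemma carries_IA: "carries IA"
  by (rule carriesI, rule carries_pair(1)) auto

lemma carries_IA_shift: "carries {M - a..<M - u}"
proof (rule carriesI)
  fix h :: "real \<Rightarrow> complex" assume h: "h \<in> bcs" "\<And>x. x \<notin> {M - a..<M - u} \<Longrightarrow> h x = 0"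
  have "(\<lambda>x. h (x - M + M)) \<in> closed_span EE"
  proof (rule carries_pair(2))
    show "(\<lambda>x. h (x + M)) \<in> bcs" using bcs_affine[OF h(1), of 1 M] by (simp add: add.commute)
    show "h (x + M) = 0" if "x \<notin> IA" for x by (rule h(2)) (use that in \<open>auto simp: IA_def\<close>)
  qed
  then show "h \<in> closed_span EE" by simp
qed

text \<open>\<open>IA + M\<close> shrunk by \<open>d\<close> is \<open>[N - u, N - b)\<close>;
  joined to \<open>ID + N\<close> it gives \<open>[N - u, N + v)\<close>, and this shrunk by
  \<open>M\<close> is exactly the gap \<open>[y, d v)\<close> that completes \<open>IE\<close> to a
  full dilation period.\<close>

lemma carries_positive: "carries {v..<real d * v}"
proof -
  have "M - a = real d * (N - u)" "M - u = real d * (N - b)"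
    using scale by (auto simp: right_diff_distrib)
  then have "{x. real d powi 1 * x \<in> {M - a..<M - u}} = {N - u..<N - b}"
    using d_gt by (simp only:) auto
  then have "carries {N - u..<N - b}" using carries_dilate[OF carries_IA_shift, of 1] by simp
  from carries_Un[OF this carries_far] have "carries ({N - u..<N - b} \<union> {N - b..<N + v})" by simp
  also have "{N - u..<N - b} \<union> {N - b..<N + v} = {N - u..<N + v}"
    using params(3,4,5) by (intro ivl_disj_un) auto
  finally have "carries {N - u..<N + v}" .
  from carries_dilate[OF this, of "int (n + 1)"]
  have "carries {x. M * x \<in> {N - u..<N + v}}" unfolding power_int_of_nat by (simp add: M_def N_def)
  also have "{x. M * x \<in> {N - u..<N + v}} = {y..<real d * v}"
    unfolding params(13,14)[symmetric] using params(2,12) by auto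
  finally have "carries {y..<real d * v}" .
  from carries_Un[OF carries_IE this] have "carries ({v..<y} \<union> {y..<real d * v})" by (simp add: IE_def)
  also have "{v..<y} \<union> {y..<real d * v} = {v..<real d * v}"
    using params(8,9) by (intro ivl_disj_un) auto
  finally show ?thesis .
qed

lemma carries_UN:
  assumes "finite A" "\<And>i. i \<in> A \<Longrightarrow> carries (I i)" "\<And>i. i \<in> A \<Longrightarrow> I i \<in> sets borel"
  shows "carries (\<Union>i\<in>A. I i)"
  using assms
proof (induction A)
  case empty
  show ?case
  proof (rule carriesI)
    fix h :: "real \<Rightarrow> complex" assume "\<And>x. x \<notin> (\<Union>i\<in>{}. I i) \<Longrightarrow> h x = 0"
    then have "h = (\<lambda>x. 0)" by auto
    then show "h \<in> closed_span EE" using closed_span_lin_span[OF lin_span_zero EE_L2] by simp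
  qed
next
  case (insert i A)
  then show ?case using carries_Un[of "I i" "\<Union>i\<in>A. I i"] by simp
qed

lemma dilation_orbit:
  assumes "r > 0" "z > 0" obtains j :: int where "r \<le> real d powi j * z" "real d powi j * z < real d * r"
proof -
  define i where "i = \<lfloor>log (real d) (z / r)\<rfloor>"
  have "real d powr of_int i \<le> z / r" "z / r < real d powr of_int (i + 1)"
    using assms d_gt floor_log_eq_powr_iff[of "z / r" "real d" i] by (auto simp: i_def)
  moreover have "real d powr of_int i = real d powi i" "real d powr of_int (i + 1) = real d powi i * real d"
    using d_gt powr_real_of_int'[of "real d" i] powr_real_of_int'[of "real d" "i + 1"]
      power_int_add[of "real d" i 1] by simp_all
  ultimately have "real d powi i * r \<le> z" "z < real d powi i * (real d * r)"
    using assms by (simp_all add: field_simps)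
  moreover have "real d powi i > 0" using d_gt by simp
  ultimately have "r \<le> real d powi (- i) * z" "real d powi (- i) * z < real d * r"
    by (auto simp: power_int_minus field_simps)
  then show ?thesis by (rule that)
qed

text \<open>\<open>IA\<close> together with \<open>[v, d v)\<close> meets the dilation orbit of
  every nonzero point. Finitely many dilates of that set carry the truncations of \<open>h\<close>,
  which converge to \<open>h\<close> by dominated convergence.\<close>

lemma bcs_closed_span_EE: "bcs \<subseteq> closed_span EE"
proof
  fix h :: "real \<Rightarrow> complex" assume h: "h \<in> bcs"
  note [measurable] = bcs_measurable[OF h]
  define I where "I = IA \<union> {v..<real d * v}"
  have [measurable]: "I \<in> sets borel" by (simp add: I_def)
  define J where "J k = (\<Union>j\<in>{- int k..int k}. {x. real d powi j * x \<in> I})" for k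
  have Js [measurable]: "{x. real d powi j * x \<in> I} \<in> sets borel" for j
    by measurable
  have [measurable]: "J k \<in> sets borel" for k
    unfolding J_def by measurable
  have "carries I" unfolding I_def by (intro carries_Un carries_IA carries_positive) auto
  then have J: "carries (J k)" for k
    unfolding J_def by (intro carries_UN carries_dilate Js) auto
  have "(\<lambda>x. indicator (J k) x * h x) \<in> closed_span EE" for k
    by (rule carriesD[OF J[of k] bcs_indicator]) (use h in auto)
  moreover have "(\<lambda>k. nsq (\<lambda>x. h x - indicator (J k) x * h x)) \<longlonglongrightarrow> 0"
  proof -
    have "(\<lambda>k. LINT x|lborel. (cmod (h x - indicator (J k) x * h x))\<^sup>2) \<longlonglongrightarrow> (LINT x|(lborel :: real measure). (0::real))"
    proof (rule integral_dominated_convergence)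
      show "integrable lborel (\<lambda>x. (cmod (h x))\<^sup>2)" by (rule L2_integrable[OF bcs_L2[OF h]])
      have "AE x in lborel. x \<noteq> (0::real)" by (rule AE_lborel_singleton)
      then show "AE x in lborel. (\<lambda>k. (cmod (h x - indicator (J k) x * h x))\<^sup>2) \<longlonglongrightarrow> 0"
      proof eventually_elim
        case (elim x)
        have "\<exists>j. real d powi j * x \<in> I"
        proof (cases "x > 0")
          case True
          obtain j where "v \<le> real d powi j * x" "real d powi j * x < real d * v"
            using dilation_orbit[OF params(3) True] by blast
          then show ?thesis by (auto simp: I_def)
        next
          case False
          then have "- x > 0" using elim by simp
          moreover have "u > 0" using params by simp
          ultimately obtain j where j: "u \<le> real d powi j * (- x)" "real d powi j * (- x) < real d * u"
            using dilation_orbit by blast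
          \<comment> \<open>After reflection \<open>IA\<close> is closed at \<open>a\<close> and
            open at \<open>u\<close>, opposite to the half-open orbit interval; an orbit point at
            \<open>-u\<close> is moved to \<open>-a\<close> by one more dilation.\<close>
          show ?thesis
          proof (cases "u = real d powi j * (- x)")
            case True
            then have "real d powi (j + 1) * x = - a" using d_gt scale by (simp add: power_int_add)
            then show ?thesis using params by (intro exI[of _ "j + 1"]) (simp add: I_def IA_def)
          next
            case False
            then show ?thesis using j scale by (intro exI[of _ j]) (simp add: I_def IA_def)
          qed
        qed
        then obtain j where j: "real d powi j * x \<in> I" by blast
        have "\<forall>\<^sub>F k in sequentially. (cmod (h x - indicator (J k) x * h x))\<^sup>2 = 0"
          unfolding eventually_sequentially
        proof (intro exI allI impI)
          fix k assume "nat \<bar>j\<bar> \<le> k"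
          then have "j \<in> {- int k..int k}" by auto
          then have "x \<in> J k" using j unfolding J_def by blast
          then show "(cmod (h x - indicator (J k) x * h x))\<^sup>2 = 0" by simp
        qed
        then show ?case by (rule tendsto_eventually)
      qed
      show "AE x in lborel. norm ((cmod (h x - indicator (J k) x * h x))\<^sup>2) \<le> (cmod (h x))\<^sup>2" for k
        by (auto simp: indicator_def)
    qed measurable
    then show ?thesis by (simp add: nsq_def)
  qed
  ultimately show "h \<in> closed_span EE"
    by (rule closed_span_limit[OF EE_L2 bcs_L2[OF h]])
qed

section \<open>The wavelet property and the order of translation invariance\<close>

definition \<psi> :: "real \<Rightarrow> complex" where "\<psi> = ft g0"

lemma translate_\<psi>: "\<psi> (x - s) = ft (G s) x"
  unfolding \<psi>_def G_def[abs_def] by (rule ft_translate)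

lemma T_pow_\<psi>: "T_pow l \<psi> = ft (G (of_int l))"
  by (simp add: T_pow_def translate_\<psi>)

lemma D_pow_T_pow_\<psi>: "D_pow d j (T_pow l \<psi>) = ft (E j l)"
  unfolding T_pow_\<psi> E_def using d_gt by (intro D_pow_ft)

lemma wavelet_\<psi>: "wavelet d \<psi>"
  unfolding wavelet_def orthonormal_basis_def
proof (intro conjI allI)
  show "\<psi> \<in> L2" unfolding \<psi>_def by (rule ft_Plancherel[OF g0_bcs])
  have eq: "(\<lambda>(j, l). D_pow d j (T_pow l \<psi>)) = (\<lambda>p. ft ((\<lambda>(j, l). E j l) p))"
    by (auto simp: D_pow_T_pow_\<psi>)
  show "range (\<lambda>(j, l). D_pow d j (T_pow l \<psi>)) \<subseteq> L2"
    unfolding eq using E_bcs ft_Plancherel(1) by auto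
  show "L2_inner (case i of (j, l) \<Rightarrow> D_pow d j (T_pow l \<psi>)) (case i' of (j, l) \<Rightarrow> D_pow d j (T_pow l \<psi>)) =
    (if i = i' then 1 else 0)" for i i'
    by (cases i; cases i') (simp add: D_pow_T_pow_\<psi> L2_inner_ft E_bcs inner_E)
  show "closed_span (range (\<lambda>(j, l). D_pow d j (T_pow l \<psi>))) = L2"
    unfolding eq using closed_span_ft_eq_L2[OF EE_bcs bcs_closed_span_EE] by (simp add: image_image)
qed

lemma inner_basis: "L2_inner (ft (E j l)) (ft (E j' l')) = (if j = j' \<and> l = l' then 1 else 0)"
  by (simp add: L2_inner_ft E_bcs inner_E)

lemma ft_E_L2: "ft (E j l) \<in> L2"
  by (intro ft_Plancherel E_bcs)

lemma V_eq: "V d \<psi> i = closed_span {ft (E j l) |j l. j < i}"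
  by (simp add: V_def D_pow_T_pow_\<psi>)

text \<open>Moving a translation by \<open>m\<close> past the dilation of level \<open>j\<close>
  turns it into the translation by \<open>m * d powi j\<close>, fractional when \<open>j\<close> is
  negative.\<close>

lemma T_pow_ft_E: "T_pow m (ft (E j l)) = ft (D_pow d (- j) (G (of_int m * real d powi j + of_int l)))"
proof
  fix x
  have D: "ft (D_pow d (- j) (G s)) x = of_real (real d powr (of_int j / 2)) * ft (G s) (real d powi j * x)" for s x
    using D_pow_ft[of d j "G s"] d_gt by (metis D_pow_def)
  have "T_pow m (ft (E j l)) x = of_real (real d powr (of_int j / 2)) * \<psi> (real d powi j * (x - of_int m) - of_int l)"
    by (simp add: T_pow_def E_def D translate_\<psi>)
  also have "real d powi j * (x - of_int m) - of_int l = real d powi j * x - (of_int m * real d powi j + of_int l)"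
    by (simp add: algebra_simps)
  finally show "T_pow m (ft (E j l)) x = ft (D_pow d (- j) (G (of_int m * real d powi j + of_int l))) x"
    by (simp add: D translate_\<psi>)
qed

text \<open>For \<open>j \<ge> -n\<close> the product of \<open>d powi j\<close> and
  \<open>N = d ^ n\<close> is an integer, which is the condition under which a translated profile
  stays in its level.\<close>

lemma T_pow_E_closed_span:
  assumes "- int n \<le> j" shows "T_pow m (ft (E j l)) \<in> closed_span (range (\<lambda>l. ft (E j l)))"
proof -
  define s where "s = of_int m * real d powi j + of_int l"
  have "real d powi j * N = real d powi (j + int n)"
    using d_gt by (simp add: N_def power_int_add)
  also have "\<dots> = of_int (int d ^ nat (j + int n))"
    using assms power_int_of_nat[of "real d" "nat (j + int n)"] by simp
  finally have "s * N = of_int (m * int d ^ nat (j + int n) + l * int d ^ n)"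
    unfolding s_def by (simp add: N_def distrib_right mult.assoc)
  from closed_span_G_D_pow[OF G_closed_span[OF this], of "- j"]
  have "D_pow d (- j) (G s) \<in> closed_span (range (E j))" by simp
  then have "ft (D_pow d (- j) (G s)) \<in> closed_span (ft ` range (E j))"
    using G_bcs d_gt by (intro closed_span_ft) (auto intro!: D_pow_bcs E_bcs)
  then show ?thesis by (simp add: T_pow_ft_E s_def image_image)
qed

text \<open>For each \<open>j \<ge> -n\<close> the closed span of the \<open>D\<^sup>j T\<^sup>l \<psi>\<close> is translation invariant, hence so is
  the orthogonal complement \<open>V d \<psi> (- n)\<close> of all of these.\<close>

lemma V_translation_invariant: "translation_invariant (V d \<psi> (- int n))"
  unfolding translation_invariant_def V_eq
proof (intro allI ballI)
  fix m f
  let ?S = "{ft (E j l) |j l. j < - int n}" and ?S' = "{ft (E j l) |j l. - int n \<le> j}"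
  assume f: "f \<in> closed_span ?S"
  then have fL: "f \<in> L2" by (rule closed_span_L2)
  have SL: "?S \<subseteq> L2" "?S' \<subseteq> L2" using ft_E_L2 by auto
  show "T_pow m f \<in> closed_span ?S"
  proof (rule closed_span_orthogonal_complement)
    have "?S \<union> ?S' = range (\<lambda>(j, l). D_pow d j (T_pow l \<psi>))"
      by (force simp: D_pow_T_pow_\<psi>)
    then have "closed_span (?S \<union> ?S') = L2"
      using wavelet_\<psi> by (simp add: wavelet_def orthonormal_basis_def)
    then show "T_pow m f \<in> closed_span (?S \<union> ?S')" using T_pow_L2[OF fL] by simp
    show "?S \<union> ?S' \<subseteq> L2" using SL by simp
    show "L2_inner g h = 0" if "g \<in> ?S" "h \<in> ?S'" for g h
      using that by (auto simp: inner_basis)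
    fix h assume "h \<in> ?S'"
    then obtain j l where h: "h = ft (E j l)" "- int n \<le> j" by auto
    \<comment> \<open>The adjoint of a translation is the opposite translation, which keeps
      \<open>h\<close> within its own level, and that level is orthogonal to
      \<open>f\<close>.\<close>
    have "L2_inner (T_pow (- m) h) f = 0"
    proof (rule closed_span_orthogonal[OF T_pow_E_closed_span[OF h(2), of "- m" l, folded h(1)] _ fL])
      fix g assume "g \<in> range (\<lambda>l. ft (E j l))"
      then obtain l' where g: "g = ft (E j l')" by auto
      have "L2_inner f g = 0"
        unfolding g by (rule closed_span_orthogonal[OF f SL(1) ft_E_L2]) (use h(2) in \<open>auto simp: inner_basis\<close>)
      then show "L2_inner g f = 0" using L2_inner_commute[of g f] by simp
    qed (use ft_E_L2 in auto)
    then show "L2_inner (T_pow m f) h = 0"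
      using T_pow_inner[of m f h] L2_inner_commute[of f "T_pow (- m) h"] by simp
  qed
qed

text \<open>One translate suffices: an element of the space, moved by 1, acquires a nonzero inner
  product with a basis element orthogonal to that space.\<close>

lemma V_not_translation_invariant: "\<not> translation_invariant (V d \<psi> (- int (n + 1)))"
proof
  assume inv: "translation_invariant (V d \<psi> (- int (n + 1)))"
  let ?S = "{ft (E j l) |j l. j < - int (n + 1)}"
  \<comment> \<open>The highest level inside the space, the bound in \<open>V\<close> being strict;
    level \<open>j + 1\<close> is the first one orthogonal to it.\<close>
  define j where "j = - int (n + 2)"
  define s where "s = real d powi j"
  have SL: "?S \<subseteq> L2" using ft_E_L2 by auto
  have "ft (E j 0) \<in> closed_span ?S"
    by (intro closed_span_base SL) (auto simp: j_def)
  then have "T_pow 1 (ft (E j 0)) \<in> closed_span ?S"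
    using inv by (simp add: V_eq translation_invariant_def)
  then have "L2_inner (T_pow 1 (ft (E j 0))) (ft (E (j + 1) 0)) = 0"
    by (rule closed_span_orthogonal[OF _ SL ft_E_L2]) (auto simp: inner_basis j_def)
  moreover have "L2_inner (T_pow 1 (ft (E j 0))) (ft (E (j + 1) 0)) = L2_inner (G s) (D_pow d (-1) (G 0))"
  proof -
    have "E (j + 1) 0 = D_pow d (- j) (D_pow d (-1) (G 0))"
      using D_pow_add[of d "- j" "-1" "G 0"] d_gt by (simp add: E_def)
    then show ?thesis
      using d_gt G_bcs D_pow_bcs by (simp add: T_pow_ft_E s_def L2_inner_ft D_pow_inner)
  qed
  moreover have "L2_inner (G s) (D_pow d (-1) (G 0)) \<noteq> 0"
  proof -
    have s_eq: "s = 1 / real d ^ (n + 2)"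
      unfolding s_def j_def by (simp only: power_int_minus power_int_of_nat inverse_eq_divide)
    then have sM: "s * M = 1 / real d"
      using d_gt by (simp add: M_def N_def)
    \<comment> \<open>On \<open>IA\<close>, where the modulus of \<xi> is at most 1, this keeps the
      angle of \<open>ee (- (s * \<xi>))\<close> within \<open>pi / 4\<close>, so its real part is
      at least 1/2 and the integral cannot vanish. The exponent \<open>n + 2\<close> is at least 3
      since \<open>n \<ge> 1\<close>.\<close>
    have s8: "0 < s" "s \<le> 1 / 8"
    proof -
      have "real 2 ^ 3 \<le> real d ^ 3" using d2 by (intro power_mono) auto
      also have "\<dots> \<le> real d ^ (n + 2)" using n1 d_gt by (intro power_increasing) auto
      finally have 8: "8 \<le> real d ^ (n + 2)" by simp
      then show "0 < s" "s \<le> 1 / 8" unfolding s_eq using d_gt by (simp_all add: divide_le_eq)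
    qed
    have int: "integrable lborel (\<lambda>\<xi>. indicator IA \<xi> *\<^sub>R ee (- (s * \<xi>)))"
      by (rule integrable_bounded_support[where B = 1 and R = 1])
        (use params in \<open>auto simp: IA_def indicator_def\<close>)
    have "L2_inner (G s) (D_pow d (-1) (G 0)) = of_real (real d powr (- 1 / 2) / 2) *
      (LINT \<xi>|lborel. (ee (- (1 / real d)) - 1) * (indicator IA \<xi> *\<^sub>R ee (- (s * \<xi>))))"
    proof (subst inner_G_dilate1, intro arg_cong2[where f = times] refl Bochner_Integration.integral_cong)
      fix \<xi>
      have "ee (- (s * (\<xi> + M))) = ee (- (1 / real d)) * ee (- (s * \<xi>))"
      proof -
        have "- (s * (\<xi> + M)) = - (1 / real d) + - (s * \<xi>)" by (simp add: distrib_left sM)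
        then show ?thesis by (simp only: ee_add)
      qed
      then show "indicator IA \<xi> *\<^sub>R (ee (0 * ((\<xi> + M) / real d) - s * (\<xi> + M)) - ee (0 * (\<xi> / real d) - s * \<xi>)) =
        (ee (- (1 / real d)) - 1) * (indicator IA \<xi> *\<^sub>R ee (- (s * \<xi>)))"
        by (simp add: algebra_simps)
    qed
    also have "\<dots> = of_real (real d powr (- 1 / 2) / 2) * ((ee (- (1 / real d)) - 1) *
        (LINT \<xi>|lborel. indicator IA \<xi> *\<^sub>R ee (- (s * \<xi>))))"
      by (simp only: integral_mult_right_zero)
    finally have eq: "L2_inner (G s) (D_pow d (-1) (G 0)) = \<dots>" .
    \<comment> \<open>The phase picked up over \<open>M\<close> is nontrivial because
      \<open>s * M = 1 / d\<close> lies strictly between 0 and 1; for integer shifts this factor was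
      0.\<close>
    have "ee (- (1 / real d)) \<noteq> 1"
    proof
      assume "ee (- (1 / real d)) = 1"
      then obtain k :: int where k: "- (1 / real d) = 0 + of_int k"
        using ee_eq_imp[of "- (1 / real d)" 0] by auto
      have "0 < 1 / real d" "1 / real d < 1" using d_gt by auto
      then have "- 1 < real_of_int k" "real_of_int k < 0" using k by linarith+
      then have "- 1 < k" "k < 0" by simp_all
      then show False by linarith
    qed
    moreover have "(LINT \<xi>|lborel. indicator IA \<xi> *\<^sub>R ee (- (s * \<xi>))) \<noteq> 0"
    proof -
      have "0 < (LINT \<xi>|lborel. (1 / 2 :: real) * indicator IA \<xi>)"
        using params(6) by (simp add: IA_def)
      also have "\<dots> \<le> (LINT \<xi>|lborel. Re (indicator IA \<xi> *\<^sub>R ee (- (s * \<xi>))))"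
      proof (rule integral_mono)
        show "integrable lborel (\<lambda>\<xi>. (1 / 2) * indicator IA \<xi> :: real)"
          using params(6) by (intro integrable_mult_right integrable_real_indicator) (auto simp: IA_def)
        show "integrable lborel (\<lambda>\<xi>. Re (indicator IA \<xi> *\<^sub>R ee (- (s * \<xi>))))"
          using int by (rule integrable_Re)
        show "(1 / 2) * indicator IA \<xi> \<le> Re (indicator IA \<xi> *\<^sub>R ee (- (s * \<xi>)))" for \<xi>
        proof (cases "\<xi> \<in> IA")
          case True
          then have "\<bar>\<xi>\<bar> \<le> 1" using params by (auto simp: IA_def)
          then have "s * \<bar>\<xi>\<bar> \<le> (1 / 8) * 1" using s8 by (intro mult_mono) auto
          then have "2 * pi * (s * \<bar>\<xi>\<bar>) \<le> 2 * pi * (1 / 8)" by (intro mult_left_mono) auto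
          then have le: "2 * pi * (s * \<bar>\<xi>\<bar>) \<le> pi / 3" using pi_gt_zero by simp
          have "cos (pi / 3) \<le> cos (2 * pi * (s * \<bar>\<xi>\<bar>))"
            using le s8 by (intro cos_monotone_0_pi_le) auto
          moreover have "cos (2 * pi * (s * \<bar>\<xi>\<bar>)) = cos (2 * pi * (s * \<xi>))"
            by (cases "\<xi> \<ge> 0") auto
          ultimately show ?thesis using True by (simp add: ee_def cos_60)
        qed simp
      qed
      also have "\<dots> = Re (LINT \<xi>|lborel. indicator IA \<xi> *\<^sub>R ee (- (s * \<xi>)))"
        using int by (rule integral_Re)
      finally show ?thesis by auto
    qed
    ultimately show ?thesis unfolding eq mult_eq_0_iff using d_gt by simp
  qed
  ultimately show False by simp
qed

end

theorem theorem1: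
  fixes d n :: nat
  assumes "d \<ge> 2" and "n \<ge> 1"
  shows "\<M> d n \<noteq> {}"
proof -
  interpret band_wavelet d n using assms by unfold_locales
  have "\<psi> \<in> \<M> d n"
    unfolding \<M>_def \<L>_def
    using wavelet_\<psi> V_translation_invariant V_not_translation_invariant by simp
  then show ?thesis by blast
qed

end
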